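(* Let $n\ge2$ be an integer. For $r_0\neq0$ and $0<C<+\infty$ or $C=+\infty$, let $g_{r_0,C}$ be the solution of $$\frac{g''}{1+(g')^2}=\Big(\frac r2-\frac{n-1}{r}\Big)g'-\frac g2,\qquad g(r_0)=0,\quad g'(r_0)=C,$$ and, writing $g=g_{r_0,C}$, define $$\eta_{r_0,C}=(1+(g')^2)\Big(\frac{n-1}{r^2}+\frac12\Big)+2\Big[\Big(\frac r2-\frac{n-1}{r}\Big)-\Big(\frac{r_0}2-\frac{n-1}{r_0}\Big)\Big]g'g'' .$$ Let $h_{r_0,C}$ be the linearized function at $r_0$ (defined in the context). (i) Let $r_0\in(-\infty,-\sqrt{2(n-1)})$ or $r_0\in(0,\sqrt{2(n-1)})$, and let $0<C<+\infty$. If $\eta_{r_0,C}\ge0$ on the portion where $g_{r_0,C}\ge0$ and $g_{r_0,C}'\ge0$, then the corresponding solution $h_{r_0,C}$ of the linearized equation satisfies $h_{r_0,C}>0$. (ii) When $g(r_0)=0$ and $g'(r_0)=+\infty$: if the solution $g_{r_0,+\infty}$ satisfies $\eta_{r_0,+\infty}>0$ on the portion where $g_{r_0,+\infty}\ge0$ and $g_{r_0,+\infty}'\ge0$, then the corresponding solution of the linearized equation satisfies $h_{r_0,+\infty}>0$. (iii) If, for arbitrarily large $C$, the corresponding solution $g_{r_0,C}$ satisfies $\eta_{r_0,C}\ge0$ on the portion where $g_{r_0,C}\ge0$ and $g_{r_0,C}'\ge0$, then $h_{r_0,+\infty}>0$.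
   Context: The equation is that of profile curves $x=g(r)$ of rotationally symmetric self-shrinkers in $\mathbb R^{n+1}$; it is also considered for $r<0$ by formal extension (it is invariant under $r\mapsto-r$). The condition $g'(r_0)=+\infty$ means that the profile curve has angle $\arctan g'=\frac{\pi}{2}$ at $r_0$, i.e. $g'(r)\to+\infty$ as $r\to r_0^+$. For $a\ne0$ and $0<C<+\infty$, let $g_{a,C}$ be the solution with $g(a)=0$, $g'(a)=C$, and $\varphi_{a,C}=\arctan g_{a,C}'$ its angle function. The linearized function at $r_0$ is $$h_{r_0,C}(r)=\frac{\partial}{\partial a}\Big|_{a=r_0}\varphi_{a,C}(r)=\lim_{\epsilon\to0}\frac{\varphi_{r_0+\epsilon,C}(r)-\varphi_{r_0,C}(r)}{\epsilon}.$$ With $g=g_{r_0,C}$, it is the solution of the linearized equation $$h''-\Big(\frac r2-\frac{n-1}{r}\Big)(1+(g')^2)h'+\Big[-2\Big(\frac r2-\frac{n-1}{r}\Big)g'g''-\frac{n-1}{r^2}(1+(g')^2)\Big]h=0$$ with initial values $h(r_0)=-\big(\frac{r_0}2-\frac{n-1}{r_0}\big)C$ and $h'(r_0)=\frac C2-(1+C^2)C\big(\frac{r_0}2-\frac{n-1}{r_0}\big)^2$. For $C=+\infty$, $h_{r_0,+\infty}$ is defined as the limit of $h_{r_0,C}$ as $C\to+\infty$, whenever this limit exists. Convention: for a solution $g$ starting at $r_0$, only the portion on which $g\ge0$ and $g'\ge0$ is considered, and $h$ is considered only on the corresponding interval; the positivity of $h$ is meant there. *)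

theory Defs
  imports "HOL-Analysis.Analysis"
begin

definition coef :: "nat \<Rightarrow> real \<Rightarrow> real" where
  "coef n r = r / 2 - (real n - 1) / r"

text \<open>The equation is singular at \<open>r = 0\<close> (where division would silently yield 0),
  so solutions live on open intervals on one side of the origin.\<close>

definition profile_equation :: "nat \<Rightarrow> real set \<Rightarrow> (real \<Rightarrow> real) \<Rightarrow> bool" where
  "profile_equation n J g \<longleftrightarrow>
     open J \<and> is_interval J \<and> 0 \<notin> J \<and>
     (\<forall>r\<in>J. g differentiable (at r) \<and> deriv g differentiable (at r) \<and>
        deriv (deriv g) r / (1 + (deriv g r)\<^sup>2) = coef n r * deriv g r - g r / 2)"

definition profile_ivp :: "nat \<Rightarrow> real \<Rightarrow> real \<Rightarrow> real set \<Rightarrow> (real \<Rightarrow> real) \<Rightarrow> bool" where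
  "profile_ivp n a C J g \<longleftrightarrow>
     profile_equation n J g \<and> a \<in> J \<and> g a = 0 \<and> deriv g a = C"

text \<open>Initial slope \<open>+\<infinity>\<close>: the solution is a graph only to the right of \<open>a\<close>, and both
  initial conditions are one-sided limits. If the solution curve starting vertically at \<open>a\<close>
  is not a graph over some interval to the right of \<open>a\<close>, no \<open>J\<close> and \<open>g\<close> satisfy this.\<close>

definition vertical_ivp :: "nat \<Rightarrow> real \<Rightarrow> real set \<Rightarrow> (real \<Rightarrow> real) \<Rightarrow> bool" where
  "vertical_ivp n a J g \<longleftrightarrow>
     profile_equation n J g \<and> (\<exists>b>a. J = {a<..<b}) \<and>
     (g \<longlongrightarrow> 0) (at_right a) \<and> filterlim (deriv g) at_top (at_right a)"

text \<open>The maximal solution of an initial value problem \<open>P\<close> whose local solutions are unique: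
  \<open>P J g\<close> says that \<open>g\<close> solves it on the interval \<open>J\<close>. Outside \<open>max_domain P\<close> the value of
  \<open>max_solution P\<close> is irrelevant.\<close>

definition max_domain :: "(real set \<Rightarrow> (real \<Rightarrow> real) \<Rightarrow> bool) \<Rightarrow> real set" where
  "max_domain P = \<Union>{J. \<exists>g. P J g}"

definition max_solution :: "(real set \<Rightarrow> (real \<Rightarrow> real) \<Rightarrow> bool) \<Rightarrow> real \<Rightarrow> real" where
  "max_solution P r = (THE y. \<exists>J g. P J g \<and> r \<in> J \<and> y = g r)"

text \<open>The portion of the solution curve, followed from its starting point \<open>a\<close> in the direction
  of increasing \<open>r\<close>, on which \<open>g\<close> and its derivative stay nonnegative.\<close>

definition portion :: "real \<Rightarrow> (real set \<Rightarrow> (real \<Rightarrow> real) \<Rightarrow> bool) \<Rightarrow> real set" where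
  "portion a P = {r \<in> max_domain P. a \<le> r \<and>
     (\<forall>s\<in>max_domain P. a \<le> s \<and> s \<le> r \<longrightarrow> 0 \<le> max_solution P s \<and> 0 \<le> deriv (max_solution P) s)}"

definition eta :: "nat \<Rightarrow> real \<Rightarrow> (real \<Rightarrow> real) \<Rightarrow> real \<Rightarrow> real" where
  "eta n a g r =
     (1 + (deriv g r)\<^sup>2) * ((real n - 1) / r\<^sup>2 + 1 / 2)
     + 2 * (coef n r - coef n a) * deriv g r * deriv (deriv g) r"

definition angle_fun :: "nat \<Rightarrow> real \<Rightarrow> real \<Rightarrow> real \<Rightarrow> real" where
  "angle_fun n a C r = arctan (deriv (max_solution (profile_ivp n a C)) r)"

definition linearized :: "nat \<Rightarrow> real \<Rightarrow> real \<Rightarrow> real \<Rightarrow> real" where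
  "linearized n r0 C r = deriv (\<lambda>a. angle_fun n a C r) r0"

text \<open>\<open>L\<close> is the value at \<open>r\<close> of the linearized function for initial slope \<open>+\<infinity>\<close>, which is
  defined only where the limit exists.\<close>

definition vertical_linearized :: "nat \<Rightarrow> real \<Rightarrow> real \<Rightarrow> real \<Rightarrow> bool" where
  "vertical_linearized n r0 r L \<longleftrightarrow> ((\<lambda>C. linearized n r0 C r) \<longlongrightarrow> L) at_top"

end

theory Submission
  imports Defs
begin

text \<open>
  Write \<open>c\<close> for \<open>coef n\<close> and \<open>c\<^sub>0\<close> for its value at the starting point. When \<open>c\<^sub>0 < 0\<close>, the function
  \<open>v = g / 2 - c\<^sub>0 g'\<close> is positive on the portion and has the same initial values as the linearized
  function \<open>h\<close>, and the linearized operator maps it to \<open>- \<eta> g / 2\<close>. If \<open>\<eta> \<ge> 0\<close>, the Wronskian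
  \<open>h' v - h v'\<close> is therefore nonnegative as long as \<open>h\<close> is, so \<open>h / v\<close> is nondecreasing and \<open>h > 0\<close>.

  To include vertical starting points, curves are parametrized by \<open>t = r - a + g\<close> and the slope is
  replaced by \<open>q = g' / (1 + g')\<close>. This turns the profile equation into an autonomous system for
  \<open>(r, g, q)\<close> that is regular at \<open>q = 1\<close>, i.e. at infinite slope, and an initial slope \<open>C\<close> becomes the
  initial value \<open>C / (1 + C)\<close>, so \<open>C \<rightarrow> \<infinity>\<close> is an ordinary limit of initial values. Differentiable
  dependence on initial values then identifies the linearized function, also in this limit. A
  vertical start is a graph to the right only if \<open>c\<^sub>0 < 0\<close>, so the comparison above applies to it.
\<close>

section \<open>Lipschitz differential equations and their dependence on initial values\<close>

text \<open>The linearized function is a derivative at fixed \<open>r\<close>, whereas a flow is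
  differentiated at fixed time, and the time at which a neighbouring curve passes over
  \<open>r\<close> moves with the starting point. With \<open>R\<close> and \<open>\<sigma>\<close>
  the variations of position and angle at fixed time, the chain rule gives h = \<sigma> - R D / (1 -
  q), where D / (1 - q) is the \<open>r\<close>-derivative of the angle.

  The main obstacle is the comparison at a vertical start. There q = 1 at time 0, and the
  differential equation for the Wronskian has a coefficient with a pole at q = 1. The quotient y =
  (h' v - h v') / g' (primes with respect to \<open>r\<close>) has no such pole: in time it
  satisfies y' = (w Q / (2 q)) y + f, where Q is \<open>QQ q\<close> and f >= 0 as long as h and eta
  are nonnegative. It also tends to 0 at the start, although numerator and denominator degenerate
  there; this uses that 1 - q vanishes to exactly first order, i.e. that the coefficient at the
  starting point is nonzero.

  For arbitrarily large slopes, the sign of eta is passed to the limit at each fixed time, so that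
  the comparison is carried out on the vertical curve alone.\<close>

lemma has_vector_derivative_continuous_on:
  assumes "\<And>t. t \<in> S \<Longrightarrow> (f has_vector_derivative f' t) (at t within S)"
  shows "continuous_on S f"
  using assms has_vector_derivative_continuous by (metis continuous_on_eq_continuous_within)

text \<open>The squared norm is differentiable also where \<open>f\<close> vanishes. The error
  enters through 2 |f| e <= |f|^2 + e^2, which is the origin of the \<open>+ 1\<close> in the rate
  and of the \<open>e^2\<close> added to the initial value.\<close>

lemma gronwall_squared:
  fixes f :: "real \<Rightarrow> 'a::real_inner"
  assumes "0 \<le> T"
    and der: "\<And>s. s \<in> {0..T} \<Longrightarrow> (f has_vector_derivative f' s) (at s within {0..T})"
    and bnd: "\<And>s. s \<in> {0..T} \<Longrightarrow> norm (f' s) \<le> L * norm (f s) + e"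
    and "0 \<le> L" "0 \<le> e"
  shows "(norm (f T))\<^sup>2 \<le> ((norm (f 0))\<^sup>2 + e\<^sup>2) * exp ((2 * L + 1) * T)"
proof -
  define u where "u s = (f s \<bullet> f s + e\<^sup>2) * exp (- ((2 * L + 1) * s))" for s
  have cont: "continuous_on {0..T} f"
    using der by (rule has_vector_derivative_continuous_on)
  have "u T \<le> u 0"
  proof (rule DERIV_nonpos_imp_decreasing_open[where f=u and a=0 and b=T])
    fix s assume s: "0 < s" "s < T"
    then have "(f has_vector_derivative f' s) (at s)"
      using der[of s] at_within_Icc_at[of 0 s T] by auto
    then have d: "(f has_derivative (\<lambda>x. x *\<^sub>R f' s)) (at s)"
      by (simp add: has_vector_derivative_def)
    have "((\<lambda>s. f s \<bullet> f s) has_derivative (\<lambda>x. f s \<bullet> x *\<^sub>R f' s + x *\<^sub>R f' s \<bullet> f s)) (at s)"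
      by (rule has_derivative_inner[OF d d])
    then have "((\<lambda>s. f s \<bullet> f s) has_real_derivative 2 * (f s \<bullet> f' s)) (at s)"
      by (rule has_derivative_imp_has_field_derivative) (simp add: inner_commute)
    then have "(u has_real_derivative
        (2 * (f s \<bullet> f' s) - (2 * L + 1) * (f s \<bullet> f s + e\<^sup>2)) * exp (- ((2 * L + 1) * s))) (at s)"
      unfolding u_def by (auto intro!: derivative_eq_intros simp: algebra_simps)
    moreover have "2 * (f s \<bullet> f' s) \<le> (2 * L + 1) * (f s \<bullet> f s + e\<^sup>2)"
    proof -
      have "f s \<bullet> f' s \<le> norm (f s) * norm (f' s)" by (rule norm_cauchy_schwarz)
      also have "\<dots> \<le> norm (f s) * (L * norm (f s) + e)"
        using bnd[of s] s by (intro mult_left_mono) auto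
      finally have "2 * (f s \<bullet> f' s) \<le> 2 * L * (norm (f s))\<^sup>2 + 2 * (norm (f s) * e)"
        by (simp add: power2_eq_square algebra_simps)
      moreover have "2 * (norm (f s) * e) \<le> (norm (f s))\<^sup>2 + e\<^sup>2"
        using sum_squares_bound[of "norm (f s)" e] by simp
      moreover have "(2 * L + 1) * (f s \<bullet> f s + e\<^sup>2) = 2 * L * (norm (f s))\<^sup>2 + (norm (f s))\<^sup>2 + e\<^sup>2 + 2 * (L * e\<^sup>2)"
        by (simp add: power2_norm_eq_inner algebra_simps)
      moreover have "0 \<le> L * e\<^sup>2" using \<open>0 \<le> L\<close> by simp
      ultimately show ?thesis by linarith
    qed
    ultimately show "\<exists>y. (u has_real_derivative y) (at s) \<and> y \<le> 0"
      by (intro exI[of _ "(2 * (f s \<bullet> f' s) - (2 * L + 1) * (f s \<bullet> f s + e\<^sup>2)) * exp (- ((2 * L + 1) * s))"])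
        (simp add: mult_le_0_iff)
  next
    show "continuous_on {0..T} u"
      unfolding u_def by (intro continuous_intros cont)
  qed fact
  have "(norm (f T))\<^sup>2 \<le> (f T \<bullet> f T + e\<^sup>2)" by (simp add: power2_norm_eq_inner)
  also have "\<dots> = u T * exp ((2 * L + 1) * T)"
    by (simp only: u_def exp_minus mult.assoc) simp
  also have "\<dots> \<le> u 0 * exp ((2 * L + 1) * T)"
    using \<open>u T \<le> u 0\<close> by (rule mult_right_mono) simp
  finally show ?thesis by (simp add: u_def power2_norm_eq_inner)
qed

lemma has_vector_derivative_reflect:
  assumes "(f has_vector_derivative f') (at (- t) within uminus ` S)"
  shows "((\<lambda>s. f (- s)) has_vector_derivative - f') (at t within S)"
proof -
  have "((f \<circ> uminus) has_vector_derivative (- 1) *\<^sub>R f') (at t within S)"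
    by (rule vector_diff_chain_within) (use assms in \<open>auto intro!: derivative_eq_intros\<close>)
  then show ?thesis by (simp add: o_def)
qed

lemma gronwall_squared_sym:
  fixes f :: "real \<Rightarrow> 'a::real_inner"
  assumes der: "\<And>s. s \<in> closed_segment 0 t \<Longrightarrow> (f has_vector_derivative f' s) (at s within closed_segment 0 t)"
    and bnd: "\<And>s. s \<in> closed_segment 0 t \<Longrightarrow> norm (f' s) \<le> L * norm (f s) + e"
    and "0 \<le> L" "0 \<le> e"
  shows "(norm (f t))\<^sup>2 \<le> ((norm (f 0))\<^sup>2 + e\<^sup>2) * exp ((2 * L + 1) * \<bar>t\<bar>)"
proof (cases "0 \<le> t")
  case True
  then show ?thesis
    using gronwall_squared[of t f f' L e] assms by (simp add: closed_segment_eq_real_ivl)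
next
  case False
  have "uminus ` {0..-t} = {t..0}" by simp
  with False have "(norm (f (- (- t))))\<^sup>2 \<le> ((norm (f (- 0)))\<^sup>2 + e\<^sup>2) * exp ((2 * L + 1) * (- t))"
    using assms
    by (intro gronwall_squared[where f="\<lambda>s. f (- s)" and f'="\<lambda>s. - f' (- s)"])
       (auto simp: closed_segment_eq_real_ivl intro!: has_vector_derivative_reflect)
  with False show ?thesis by simp
qed

text \<open>Integrating \<open>K * exp (K * s)\<close> reproduces the weight
  \<open>exp (K * s)\<close>. Measured with this weight, Picard iteration contracts on intervals of
  any length once \<open>K\<close> exceeds the Lipschitz constant.\<close>

lemma norm_le_of_exp_derivative_bound:
  fixes f :: "real \<Rightarrow> 'a::real_normed_vector"
  assumes der: "\<And>s. s \<in> {0..T} \<Longrightarrow> (f has_vector_derivative f' s) (at s within {0..T})"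
    and bnd: "\<And>s. s \<in> {0..T} \<Longrightarrow> norm (f' s) \<le> B * (K * exp (K * s))"
    and "f 0 = 0" "0 \<le> T" "0 \<le> B"
  shows "norm (f T) \<le> B * exp (K * T)"
proof (cases "T = 0")
  case False
  have "norm (f T - f 0) \<le> B * exp (K * T) - B * exp (K * 0)"
  proof (rule differentiable_bound_general[where f'=f' and \<phi>'="\<lambda>s. B * (K * exp (K * s))"])
    show "continuous_on {0..T} f" using der by (rule has_vector_derivative_continuous_on)
    fix s assume s: "0 < s" "s < T"
    show "(f has_vector_derivative f' s) (at s)"
      using der[of s] at_within_Icc_at[of 0 s T] s by auto
    show "((\<lambda>s. B * exp (K * s)) has_vector_derivative B * (K * exp (K * s))) (at s)"
      unfolding has_real_derivative_iff_has_vector_derivative[symmetric]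
      by (auto intro!: derivative_eq_intros)
  qed (use assms False in \<open>auto intro!: continuous_intros\<close>)
  then show ?thesis using assms by simp
qed (use assms in auto)

lemma norm_le_of_exp_derivative_bound_sym:
  fixes f :: "real \<Rightarrow> 'a::real_normed_vector"
  assumes der: "\<And>s. s \<in> {-b..b} \<Longrightarrow> (f has_vector_derivative f' s) (at s within {-b..b})"
    and bnd: "\<And>s. s \<in> {-b..b} \<Longrightarrow> norm (f' s) \<le> B * (K * exp (K * \<bar>s\<bar>))"
    and "f 0 = 0" "0 \<le> B" and t: "t \<in> {-b..b}"
  shows "norm (f t) \<le> B * exp (K * \<bar>t\<bar>)"
proof (cases "0 \<le> t")
  case True
  with t have sub: "{0..t} \<subseteq> {-b..b}" by auto
  have "norm (f t) \<le> B * exp (K * t)"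
    using True assms(3,4) sub bnd
    by (intro norm_le_of_exp_derivative_bound[of t f f'] has_vector_derivative_within_subset[OF der sub])
       (force simp: abs_of_nonneg subset_iff)+
  with True show ?thesis by simp
next
  case False
  with t have sub: "uminus ` {0..-t} \<subseteq> {-b..b}" by auto
  have "norm (f (- (- t))) \<le> B * exp (K * (- t))"
  proof (rule norm_le_of_exp_derivative_bound[where f="\<lambda>s. f (- s)" and f'="\<lambda>s. - f' (- s)"])
    fix s assume s: "s \<in> {0..-t}"
    then have "- s \<in> {-b..b}" using t by auto
    then show "((\<lambda>s. f (- s)) has_vector_derivative - f' (- s)) (at s within {0..-t})"
      by (intro has_vector_derivative_reflect has_vector_derivative_within_subset[OF der sub])
    show "norm (- f' (- s)) \<le> B * (K * exp (K * s))"
      using bnd[OF \<open>- s \<in> {-b..b}\<close>] s by simp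
  qed (use False assms(3,4) in auto)
  with False show ?thesis by simp
qed

section \<open>Existence of solutions by Picard iteration\<close>

theorem picard_existence:
  fixes F :: "real \<Rightarrow> 'a::banach \<Rightarrow> 'a"
  assumes lip: "\<And>t x y. t \<in> {-b..b} \<Longrightarrow> norm (F t x - F t y) \<le> L * norm (x - y)"
    and cont: "\<And>X. continuous_on {-b..b} X \<Longrightarrow> continuous_on {-b..b} (\<lambda>t. F t (X t))"
    and "0 \<le> b"
  shows "\<exists>X. X 0 = x0 \<and> (\<forall>t\<in>{-b..b}. (X has_vector_derivative F t (X t)) (at t within {-b..b}))"
proof -
  define I where "I = {-b..b}"
  define M where "M = \<bar>L\<bar> + 1"
  have "M > 0" "L \<le> M" by (auto simp: M_def)
  have lip: "norm (F t x - F t y) \<le> M * norm (x - y)" if "t \<in> I" for t x y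
    using lip[of t x y] mult_right_mono[OF \<open>L \<le> M\<close>, of "norm (x - y)"] that by (auto simp: I_def)
  have "0 \<in> I" using \<open>0 \<le> b\<close> by (auto simp: I_def)
  define picard where "picard X = (SOME Y. Y 0 = x0 \<and> (\<forall>t\<in>I. (Y has_vector_derivative F t (X t)) (at t within I)))" for X
  have step0: "picard X 0 = x0 \<and> (\<forall>t\<in>I. (picard X has_vector_derivative F t (X t)) (at t within I))"
    if X: "continuous_on I X" for X
  proof -
    obtain g where g: "\<And>t. t \<in> I \<Longrightarrow> (g has_vector_derivative F t (X t)) (at t within I)"
      using antiderivative_continuous[OF cont[OF X[unfolded I_def]]] unfolding I_def by blast
    have "\<exists>Y. Y 0 = x0 \<and> (\<forall>t\<in>I. (Y has_vector_derivative F t (X t)) (at t within I))"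
      using has_vector_derivative_add[OF g has_vector_derivative_const[of "x0 - g 0"]]
      by (intro exI[of _ "\<lambda>t. g t + (x0 - g 0)"]) simp
    from someI_ex[OF this] show ?thesis unfolding picard_def .
  qed
  define X where "X k = (picard ^^ k) (\<lambda>_. x0)" for k
  have X_Suc: "X (Suc k) = picard (X k)" for k by (simp add: X_def)
  have Xcont: "continuous_on I (X k)" for k
  proof (induction k)
    case (Suc k)
    show ?case unfolding X_Suc
      using step0[OF Suc] by (intro has_vector_derivative_continuous_on) auto
  qed (simp add: X_def)
  have X0: "X k 0 = x0" for k
  proof (cases k)
    case (Suc j)
    then show ?thesis using step0[OF Xcont[of j]] by (simp only: X_Suc)
  qed (simp add: X_def)
  have Xder: "(X (Suc k) has_vector_derivative F t (X k t)) (at t within I)" if "t \<in> I" for k t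
    using step0[OF Xcont[of k]] that by (simp add: X_Suc)
  have "bounded ((\<lambda>t. X 1 t - X 0 t) ` I)"
    by (intro compact_imp_bounded compact_continuous_image continuous_on_diff Xcont) (simp add: I_def)
  then obtain A where A: "A > 0" "\<And>t. t \<in> I \<Longrightarrow> norm (X 1 t - X 0 t) \<le> A"
    unfolding bounded_pos by auto
  \<comment> \<open>The weight grows at rate \<open>2 * M\<close> while the field has Lipschitz
    constant \<open>M\<close>, so each integration gains a factor 1/2.\<close>
  have diff: "norm (X (Suc k) t - X k t) \<le> (A * (1/2) ^ k) * exp (2 * M * \<bar>t\<bar>)" if "t \<in> I" for k t
    using that
  proof (induction k arbitrary: t)
    case 0
    have "A * 1 \<le> A * exp (2 * M * \<bar>t\<bar>)"
      using A(1) \<open>M > 0\<close> by (intro mult_left_mono) auto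
    with A(2)[OF 0] show ?case by simp
  next
    case (Suc k)
    show ?case
    proof (rule norm_le_of_exp_derivative_bound_sym[where f="\<lambda>t. X (Suc (Suc k)) t - X (Suc k) t" and b=b])
      fix s assume s: "s \<in> {-b..b}"
      show "((\<lambda>t. X (Suc (Suc k)) t - X (Suc k) t) has_vector_derivative
          F s (X (Suc k) s) - F s (X k s)) (at s within {-b..b})"
        using Xder s unfolding I_def by (intro derivative_intros) auto
      have "norm (F s (X (Suc k) s) - F s (X k s)) \<le> M * norm (X (Suc k) s - X k s)"
        using lip s by (simp add: I_def)
      also have "\<dots> \<le> M * ((A * (1/2) ^ k) * exp (2 * M * \<bar>s\<bar>))"
        using Suc.IH s \<open>M > 0\<close> by (intro mult_left_mono) (auto simp: I_def)
      finally show "norm (F s (X (Suc k) s) - F s (X k s)) \<le>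
          A * (1/2) ^ Suc k * (2 * M * exp (2 * M * \<bar>s\<bar>))" by (simp add: mult_ac)
    qed (use Suc A X0 in \<open>auto simp: I_def\<close>)
  qed
  define C where "C = A * exp (2 * M * b)"
  have diff': "norm (X (Suc k) t - X k t) \<le> C * (1/2) ^ k" if "t \<in> I" for k t
  proof -
    have "exp (2 * M * \<bar>t\<bar>) \<le> exp (2 * M * b)"
      using that \<open>M > 0\<close> by (auto simp: I_def)
    then have "(A * (1/2) ^ k) * exp (2 * M * \<bar>t\<bar>) \<le> (A * (1/2) ^ k) * exp (2 * M * b)"
      using A(1) by (intro mult_left_mono) auto
    with diff[OF that, of k] show ?thesis by (simp add: C_def algebra_simps)
  qed
  define Z where "Z t = x0 + (\<Sum>k. X (Suc k) t - X k t)" for t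
  have "uniform_limit I (\<lambda>m t. \<Sum>k<m. X (Suc k) t - X k t) (\<lambda>t. \<Sum>k. X (Suc k) t - X k t) sequentially"
    by (rule Weierstrass_m_test[OF diff']) (auto intro!: summable_mult summable_geometric)
  moreover have "(\<Sum>k<m. X (Suc k) t - X k t) = X m t - x0" for m t
    by (simp add: sum_lessThan_telescope[where f="\<lambda>k. X k t"]) (simp add: X_def)
  ultimately have unif: "uniform_limit I X Z sequentially"
    by (simp add: uniform_limit_iff Z_def dist_norm diff_diff_add)
  have Zlim: "(\<lambda>k. X k t) \<longlonglongrightarrow> Z t" if "t \<in> I" for t
    using tendsto_uniform_limitI[OF unif that] .
  \<comment> \<open>The derivatives \<open>F t (X k t)\<close> of the iterates converge uniformly to
    \<open>F t (Z t)\<close>, so the limit may be differentiated termwise.\<close>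
  have "\<exists>g. \<forall>t\<in>I. (\<lambda>k. X (Suc k) t) \<longlonglongrightarrow> g t \<and> (g has_derivative (\<lambda>h. h *\<^sub>R F t (Z t))) (at t within I)"
  proof (rule has_derivative_sequence)
    fix k t assume "t \<in> I"
    then show "(X (Suc k) has_derivative (\<lambda>h. h *\<^sub>R F t (X k t))) (at t within I)"
      using Xder by (simp add: has_vector_derivative_def)
  next
    fix e :: real assume "e > 0"
    then have "e / M > 0" using \<open>M > 0\<close> by simp
    have "\<forall>\<^sub>F k in sequentially. \<forall>t\<in>I. dist (X k t) (Z t) < e / M"
      using unif \<open>e / M > 0\<close> by (simp add: uniform_limit_iff)
    then show "\<forall>\<^sub>F k in sequentially. \<forall>t\<in>I. \<forall>h. norm (h *\<^sub>R F t (X k t) - h *\<^sub>R F t (Z t)) \<le> e * norm h"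
    proof (eventually_elim, intro ballI allI)
      fix k t h assume *: "\<forall>t\<in>I. dist (X k t) (Z t) < e / M" "t \<in> I"
      have "norm (F t (X k t) - F t (Z t)) \<le> M * dist (X k t) (Z t)"
        using lip[OF *(2)] by (simp add: dist_norm)
      also have "\<dots> \<le> M * (e / M)" using * \<open>M > 0\<close> by (intro mult_left_mono) (auto intro: less_imp_le)
      finally have "norm (F t (X k t) - F t (Z t)) \<le> e" using \<open>M > 0\<close> by simp
      then have "\<bar>h\<bar> * norm (F t (X k t) - F t (Z t)) \<le> \<bar>h\<bar> * e" by (intro mult_left_mono) auto
      then show "norm (h *\<^sub>R F t (X k t) - h *\<^sub>R F t (Z t)) \<le> e * norm h"
        by (simp flip: scaleR_diff_right add: mult.commute)
    qed
  next
    show "0 \<in> I" by fact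
    show "(\<lambda>k. X (Suc k) 0) \<longlonglongrightarrow> x0" by (simp add: X0)
  qed (simp add: I_def)
  then obtain g where g: "\<And>t. t \<in> I \<Longrightarrow> (\<lambda>k. X (Suc k) t) \<longlonglongrightarrow> g t"
    "\<And>t. t \<in> I \<Longrightarrow> (g has_vector_derivative F t (Z t)) (at t within I)"
    by (auto simp: has_vector_derivative_def)
  have "g t = Z t" if "t \<in> I" for t
    using LIMSEQ_unique[OF g(1)[OF that]] LIMSEQ_Suc[OF Zlim[OF that]] by auto
  moreover have "Z 0 = x0"
    using Zlim[OF \<open>0 \<in> I\<close>] by (simp add: X0 LIMSEQ_const_iff)
  ultimately show ?thesis
    using g(2) \<open>0 \<in> I\<close> unfolding I_def by (intro exI[of _ g]) auto
qed


text \<open>Composing \<open>F\<close> with the nearest-point projection onto the compact convex set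
  \<open>K\<close> gives a globally Lipschitz field, so solutions from every initial value exist on
  all of [-b, b]. They solve the original equation as long as they stay in \<open>K\<close>. Times
  of both signs are needed because a solution of \<open>profile_ivp\<close> lives on an open
  interval around its starting point.\<close>

locale c1_field =
  fixes F :: "'a::euclidean_space \<Rightarrow> 'a" and F' :: "'a \<Rightarrow> 'a \<Rightarrow>\<^sub>L 'a"
    and K :: "'a set" and b :: real
  assumes compact_K: "compact K" and convex_K: "convex K" and K_ne: "K \<noteq> {}"
    and b_nonneg: "0 \<le> b"
    and F_deriv: "\<And>x. x \<in> K \<Longrightarrow> (F has_derivative blinfun_apply (F' x)) (at x within K)"
    and F'_cont: "continuous_on K F'"
begin

abbreviation "P \<equiv> closest_point K"

lemma P_in: "P x \<in> K"
  using compact_K K_ne by (simp add: closest_point_in_set compact_imp_closed)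

lemma P_dist: "dist (P x) (P y) \<le> dist x y"
  using convex_K compact_K K_ne by (simp add: closest_point_lipschitz compact_imp_closed)

lemma P_cont: "continuous_on S P"
  using convex_K compact_K K_ne by (simp add: continuous_on_closest_point compact_imp_closed)

lemma F_cont: "continuous_on K F"
  using F_deriv has_derivative_continuous continuous_on_eq_continuous_within by blast

definition "L = (SOME L. L > 0 \<and> (\<forall>x\<in>K. norm (F' x) \<le> L))"

lemma L: "L > 0" "x \<in> K \<Longrightarrow> norm (F' x) \<le> L"
proof -
  have "bounded (F' ` K)"
    by (intro compact_imp_bounded compact_continuous_image F'_cont compact_K)
  then have "\<exists>L. L > 0 \<and> (\<forall>x\<in>K. norm (F' x) \<le> L)"
    unfolding bounded_pos by auto
  from someI_ex[OF this] have "L > 0 \<and> (\<forall>x\<in>K. norm (F' x) \<le> L)"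
    unfolding L_def .
  then show "L > 0" "x \<in> K \<Longrightarrow> norm (F' x) \<le> L" by auto
qed

definition "G x = F (P x)"

lemma G_eq: "x \<in> K \<Longrightarrow> G x = F x"
  by (simp add: G_def closest_point_self)

lemma F_lipschitz: "x \<in> K \<Longrightarrow> y \<in> K \<Longrightarrow> norm (F x - F y) \<le> L * norm (x - y)"
  by (rule differentiable_bound[OF convex_K F_deriv]) (use L in \<open>auto simp: norm_blinfun.rep_eq[symmetric]\<close>)

lemma G_lipschitz: "norm (G x - G y) \<le> L * norm (x - y)"
proof -
  have "norm (G x - G y) \<le> L * norm (P x - P y)"
    unfolding G_def by (intro F_lipschitz P_in)
  also have "\<dots> \<le> L * norm (x - y)"
    using P_dist[of x y] L(1) by (simp add: dist_norm)
  finally show ?thesis .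
qed

lemma G_cont: "continuous_on S G"
  unfolding G_def using P_in by (intro continuous_on_compose2[OF F_cont P_cont]) auto

definition "flow x = (SOME X. X 0 = x \<and> (\<forall>t\<in>{-b..b}. (X has_vector_derivative G (X t)) (at t within {-b..b})))"

lemma flow_ex: "flow x 0 = x \<and> (\<forall>t\<in>{-b..b}. (flow x has_vector_derivative G (flow x t)) (at t within {-b..b}))"
proof -
  have "\<exists>X. X 0 = x \<and> (\<forall>t\<in>{-b..b}. (X has_vector_derivative G (X t)) (at t within {-b..b}))"
    by (rule picard_existence[where F="\<lambda>_. G" and L=L])
       (use G_lipschitz b_nonneg in \<open>auto intro: continuous_on_compose2[OF G_cont]\<close>)
  from someI_ex[OF this] show ?thesis unfolding flow_def .
qed

lemma flow_0 [simp]: "flow x 0 = x"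
  and flow_deriv: "t \<in> {-b..b} \<Longrightarrow> (flow x has_vector_derivative G (flow x t)) (at t within {-b..b})"
  using flow_ex by auto

lemma flow_cont: "continuous_on {-b..b} (flow x)"
  using flow_deriv by (rule has_vector_derivative_continuous_on)

lemma segment_subset: "t \<in> {-b..b} \<Longrightarrow> closed_segment 0 t \<subseteq> {-b..b}"
  by (auto simp: closed_segment_eq_real_ivl)

definition "M = exp ((2 * L + 1) * b)"

lemma M_ge1: "M \<ge> 1"
  using L(1) b_nonneg by (simp add: M_def)

lemma gronwall:
  fixes f :: "real \<Rightarrow> 'a"
  assumes t: "t \<in> {-b..b}"
    and der: "\<And>s. s \<in> closed_segment 0 t \<Longrightarrow> (f has_vector_derivative f' s) (at s within closed_segment 0 t)"
    and bnd: "\<And>s. s \<in> closed_segment 0 t \<Longrightarrow> norm (f' s) \<le> L * norm (f s) + e"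
    and "0 \<le> e"
  shows "norm (f t) \<le> M * (norm (f 0) + e)"
proof (rule power2_le_imp_le)
  have "(norm (f t))\<^sup>2 \<le> ((norm (f 0))\<^sup>2 + e\<^sup>2) * exp ((2 * L + 1) * \<bar>t\<bar>)"
    using L(1) \<open>0 \<le> e\<close> by (intro gronwall_squared_sym[where f'=f'] der bnd) auto
  also have "\<dots> \<le> (norm (f 0) + e)\<^sup>2 * M\<^sup>2"
  proof (rule mult_mono)
    show "(norm (f 0))\<^sup>2 + e\<^sup>2 \<le> (norm (f 0) + e)\<^sup>2"
      using \<open>0 \<le> e\<close> by (simp add: power2_sum)
    have "exp ((2 * L + 1) * \<bar>t\<bar>) \<le> M"
      unfolding M_def using t L(1) by (auto intro!: mult_left_mono)
    also have "\<dots> \<le> M\<^sup>2" using M_ge1 by (simp add: power2_eq_square)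
    finally show "exp ((2 * L + 1) * \<bar>t\<bar>) \<le> M\<^sup>2" .
  qed auto
  finally show "(norm (f t))\<^sup>2 \<le> (M * (norm (f 0) + e))\<^sup>2"
    by (simp add: power_mult_distrib mult.commute)
  show "0 \<le> M * (norm (f 0) + e)" using M_ge1 \<open>0 \<le> e\<close> by simp
qed

lemma flow_lipschitz:
  assumes t: "t \<in> {-b..b}"
  shows "norm (flow x t - flow y t) \<le> M * norm (x - y)"
proof -
  have "norm (flow x t - flow y t) \<le> M * (norm (flow x 0 - flow y 0) + 0)"
  proof (rule gronwall[OF t])
    fix s assume s: "s \<in> closed_segment 0 t"
    show "((\<lambda>t. flow x t - flow y t) has_vector_derivative G (flow x s) - G (flow y s))
        (at s within closed_segment 0 t)"
      using s segment_subset[OF t]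
      by (intro derivative_intros has_vector_derivative_within_subset[OF flow_deriv]) auto
  qed (use G_lipschitz in auto)
  then show ?thesis by simp
qed

section \<open>The variational equation and differentiability in the initial value\<close>

definition "A x t = F' (P (flow x t))"

lemma A_bound: "norm (A x t) \<le> L"
  using L(2)[OF P_in] by (simp add: A_def)

lemma A_cont: "continuous_on {-b..b} (A x)"
  unfolding A_def
  by (intro continuous_on_compose2[OF F'_cont] continuous_on_compose2[OF P_cont] flow_cont) (use P_in in auto)

definition "vflow x v = (SOME V. V 0 = v \<and> (\<forall>t\<in>{-b..b}. (V has_vector_derivative A x t (V t)) (at t within {-b..b})))"

lemma A_apply_bound: "norm (A x t v) \<le> L * norm v"
  using norm_blinfun[of "A x t" v] mult_right_mono[OF A_bound, of "norm v"] by (rule order_trans) simp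

lemma vflow_ex: "vflow x v 0 = v \<and> (\<forall>t\<in>{-b..b}. (vflow x v has_vector_derivative A x t (vflow x v t)) (at t within {-b..b}))"
proof -
  have "norm (A x t y - A x t z) \<le> L * norm (y - z)" for t y z
    using A_apply_bound[of x t "y - z"] by (simp add: blinfun.diff_right)
  then have "\<exists>V. V 0 = v \<and> (\<forall>t\<in>{-b..b}. (V has_vector_derivative A x t (V t)) (at t within {-b..b}))"
    by (intro picard_existence[where F="\<lambda>t. A x t" and L=L])
       (use b_nonneg in \<open>auto intro!: continuous_intros A_cont\<close>)
  from someI_ex[OF this] show ?thesis unfolding vflow_def .
qed

lemma vflow_0 [simp]: "vflow x v 0 = v"
  and vflow_deriv: "t \<in> {-b..b} \<Longrightarrow> (vflow x v has_vector_derivative A x t (vflow x v t)) (at t within {-b..b})"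
  using vflow_ex by auto

lemma vflow_cont: "continuous_on {-b..b} (vflow x v)"
  using vflow_deriv by (rule has_vector_derivative_continuous_on)

text \<open>The truncated field \<open>G\<close> need not be differentiable, which is why
  \<open>A\<close> uses \<open>F'\<close> at the projected point. Along a curve in the interior of
  \<open>K\<close>, slightly perturbed curves also stay in \<open>K\<close>, and there
  \<open>A\<close> is the true derivative. The remainder is uniform in time, as needed later for
  evaluation at a moving time.\<close>

lemma flow_deriv_initial:
  assumes sub: "{\<alpha>..\<beta>} \<subseteq> {-b..b}" and "\<alpha> \<le> 0" "0 \<le> \<beta>"
    and inK: "\<And>t. t \<in> {\<alpha>..\<beta>} \<Longrightarrow> flow x t \<in> interior K"
    and "e > 0"
  shows "\<exists>d>0. \<forall>s t. \<bar>s\<bar> < d \<longrightarrow> t \<in> {\<alpha>..\<beta>} \<longrightarrow>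
           norm (flow (x + s *\<^sub>R v) t - flow x t - s *\<^sub>R vflow x v t) \<le> e * \<bar>s\<bar>"
proof -
  define S where "S = flow x ` {\<alpha>..\<beta>}"
  have "compact S"
    unfolding S_def using continuous_on_subset[OF flow_cont sub] by (intro compact_continuous_image) auto
  then obtain r where r: "r > 0" "(\<Union>y\<in>S. ball y r) \<subseteq> interior K"
    using compact_subset_open_imp_ball_epsilon_subset[of S "interior K"] inK unfolding S_def by blast
  \<comment> \<open>One factor \<open>M\<close> comes from the Lipschitz dependence of the flow on
    its initial value, the other from Gronwall.\<close>
  define e' where "e' = e / (M\<^sup>2 * (norm v + 1))"
  have nv: "0 < norm v + 1" by (smt (verit) norm_ge_zero)
  have M0: "M > 0" using M_ge1 by simp
  have "e' > 0" using \<open>e > 0\<close> M0 nv by (simp add: e'_def)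
  have "uniformly_continuous_on K F'"
    using F'_cont compact_K by (rule compact_uniformly_continuous)
  then obtain c where c: "c > 0" "\<And>y z. y \<in> K \<Longrightarrow> z \<in> K \<Longrightarrow> dist y z < c \<Longrightarrow> dist (F' y) (F' z) < e'"
    unfolding uniformly_continuous_on_def using \<open>e' > 0\<close> by (metis dist_commute)
  \<comment> \<open>\<open>r\<close> keeps the perturbed curve inside \<open>K\<close>;
    \<open>c\<close> keeps \<open>F'\<close> within \<open>e'\<close> of its value on the segment
    between the two curves.\<close>
  define d where "d = min r c / (M * (norm v + 1))"
  have "d > 0" using r(1) c(1) M0 nv by (simp add: d_def)
  show ?thesis
  proof (intro exI conjI allI impI)
    show "d > 0" by fact
    fix s t assume s: "\<bar>s\<bar> < d" and t: "t \<in> {\<alpha>..\<beta>}"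
    then have tb: "t \<in> {-b..b}" using sub by auto
    let ?y = "x + s *\<^sub>R v"
    have close: "norm (flow ?y u - flow x u) \<le> M * (\<bar>s\<bar> * norm v)" if "u \<in> {-b..b}" for u
      using flow_lipschitz[OF that, of ?y x] by simp
    have "M * (\<bar>s\<bar> * norm v) \<le> \<bar>s\<bar> * (M * (norm v + 1))"
      using M0 by (simp add: algebra_simps)
    also have "\<dots> < d * (M * (norm v + 1))" using s M0 nv by (intro mult_strict_right_mono) auto
    also have "\<dots> = min r c" using M0 nv by (simp add: d_def)
    finally have small: "M * (\<bar>s\<bar> * norm v) < min r c" .
    have seg: "closed_segment 0 t \<subseteq> {\<alpha>..\<beta>}"
      using t assms(2,3) by (auto simp: closed_segment_eq_real_ivl)
    have "norm (flow ?y t - flow x t - s *\<^sub>R vflow x v t) \<le>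
        M * (norm (flow ?y 0 - flow x 0 - s *\<^sub>R vflow x v 0) + e' * (M * (\<bar>s\<bar> * norm v)))"
    proof (rule gronwall[OF tb])
      fix u assume u: "u \<in> closed_segment 0 t"
      then have ub: "u \<in> {-b..b}" and uab: "u \<in> {\<alpha>..\<beta>}" using segment_subset[OF tb] seg by auto
      show "((\<lambda>t. flow ?y t - flow x t - s *\<^sub>R vflow x v t) has_vector_derivative
          G (flow ?y u) - G (flow x u) - s *\<^sub>R A x u (vflow x v u)) (at u within closed_segment 0 t)"
        using ub segment_subset[OF tb]
        by (auto intro!: derivative_eq_intros has_vector_derivative_within_subset[OF flow_deriv]
            has_vector_derivative_within_subset[OF vflow_deriv])
      have xK: "flow x u \<in> K" using inK[OF uab] interior_subset by auto
      have lt: "norm (flow ?y u - flow x u) < min r c" using close[OF ub] small by linarith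
      then have "flow ?y u \<in> ball (flow x u) r" by (simp add: dist_norm norm_minus_commute)
      then have yK: "flow ?y u \<in> K" using r(2) uab interior_subset unfolding S_def by blast
      have segK: "closed_segment (flow x u) (flow ?y u) \<subseteq> K"
        using xK yK convex_K by (simp add: closed_segment_subset)
      have "norm (F (flow ?y u) - F (flow x u) - F' (flow x u) (flow ?y u - flow x u)) \<le>
          norm (flow ?y u - flow x u) * e'"
      proof (rule differentiable_bound_linearization[where f=F and f'="\<lambda>z. blinfun_apply (F' z)" and S="closed_segment (flow x u) (flow ?y u)"])
        show "flow x u + t *\<^sub>R (flow ?y u - flow x u) \<in> closed_segment (flow x u) (flow ?y u)"
          if "t \<in> {0..1}" for t
          using that by (auto simp: in_segment algebra_simps intro!: exI[of _ t])
        fix z assume z: "z \<in> closed_segment (flow x u) (flow ?y u)"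
        show "(F has_derivative blinfun_apply (F' z)) (at z within closed_segment (flow x u) (flow ?y u))"
          using z segK by (intro has_derivative_subset[OF F_deriv]) auto
        have "dist z (flow x u) < c"
          using dist_in_closed_segment[OF z] lt by (simp add: dist_norm norm_minus_commute)
        then have "dist (F' z) (F' (flow x u)) < e'" using c(2) z segK xK by blast
        then show "onorm (blinfun_apply (F' z) - blinfun_apply (F' (flow x u))) \<le> e'"
          by (simp add: dist_norm norm_blinfun.rep_eq fun_diff_def minus_blinfun.rep_eq)
      qed simp
      also have "\<dots> \<le> (M * (\<bar>s\<bar> * norm v)) * e'"
        using close[OF ub] \<open>e' > 0\<close> by (intro mult_right_mono) auto
      finally have lin: "norm (F (flow ?y u) - F (flow x u) - F' (flow x u) (flow ?y u - flow x u)) \<le>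
          e' * (M * (\<bar>s\<bar> * norm v))" by (simp add: mult.commute)
      have Ax: "A x u = F' (flow x u)" using xK by (simp add: A_def closest_point_self)
      have "G (flow ?y u) - G (flow x u) - s *\<^sub>R A x u (vflow x v u) =
          (F (flow ?y u) - F (flow x u) - F' (flow x u) (flow ?y u - flow x u)) +
          A x u (flow ?y u - flow x u - s *\<^sub>R vflow x v u)"
        using xK yK by (simp add: G_eq Ax blinfun.diff_right blinfun.scaleR_right)
      then show "norm (G (flow ?y u) - G (flow x u) - s *\<^sub>R A x u (vflow x v u)) \<le>
          L * norm (flow ?y u - flow x u - s *\<^sub>R vflow x v u) + e' * (M * (\<bar>s\<bar> * norm v))"
        using lin A_apply_bound[of x u "flow ?y u - flow x u - s *\<^sub>R vflow x v u"]
        by (metis add.commute add_mono norm_triangle_mono)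
    qed (use \<open>e' > 0\<close> M0 in auto)
    also have "\<dots> = (e' * (M\<^sup>2 * norm v)) * \<bar>s\<bar>"
      by (simp add: power2_eq_square)
    also have "\<dots> \<le> (e' * (M\<^sup>2 * (norm v + 1))) * \<bar>s\<bar>"
      using \<open>e' > 0\<close> by (intro mult_right_mono mult_left_mono) auto
    also have "e' * (M\<^sup>2 * (norm v + 1)) = e" using M0 nv by (simp add: e'_def)
    finally show "norm (flow ?y t - flow x t - s *\<^sub>R vflow x v t) \<le> e * \<bar>s\<bar>" .
  qed
qed

text \<open>The coefficients of the two variational equations are close because \<open>F'\<close> is
  uniformly continuous on \<open>K\<close> and the flow is Lipschitz in its initial value; Gronwall
  does the rest. This gives the limit of the linearized functions as the slope tends to
  infinity.\<close>

lemma vflow_uniform_continuity: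
  assumes "e > 0"
  shows "\<exists>d>0. \<forall>y t. norm (y - x) < d \<longrightarrow> t \<in> {-b..b} \<longrightarrow> norm (vflow y v t - vflow x v t) \<le> e"
proof -
  have "bounded (vflow x v ` {-b..b})"
    by (intro compact_imp_bounded compact_continuous_image vflow_cont) auto
  then obtain B where B: "B > 0" "\<And>t. t \<in> {-b..b} \<Longrightarrow> norm (vflow x v t) \<le> B"
    unfolding bounded_pos by auto
  have M0: "M > 0" using M_ge1 by simp
  define e' where "e' = e / (M * B)"
  have "e' > 0" using \<open>e > 0\<close> M0 B by (simp add: e'_def)
  have "uniformly_continuous_on K F'"
    using F'_cont compact_K by (rule compact_uniformly_continuous)
  then obtain c where c: "c > 0" "\<And>y z. y \<in> K \<Longrightarrow> z \<in> K \<Longrightarrow> dist y z < c \<Longrightarrow> dist (F' y) (F' z) < e'"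
    unfolding uniformly_continuous_on_def using \<open>e' > 0\<close> by (metis dist_commute)
  show ?thesis
  proof (intro exI conjI allI impI)
    show "c / M > 0" using c(1) M0 by simp
    fix y t assume y: "norm (y - x) < c / M" and t: "t \<in> {-b..b}"
    have "norm (vflow y v t - vflow x v t) \<le> M * (norm (vflow y v 0 - vflow x v 0) + e' * B)"
    proof (rule gronwall[OF t])
      fix u assume u: "u \<in> closed_segment 0 t"
      then have ub: "u \<in> {-b..b}" using segment_subset[OF t] by auto
      show "((\<lambda>t. vflow y v t - vflow x v t) has_vector_derivative
          A y u (vflow y v u) - A x u (vflow x v u)) (at u within closed_segment 0 t)"
        using ub segment_subset[OF t]
        by (auto intro!: derivative_intros has_vector_derivative_within_subset[OF vflow_deriv])
      have "norm (flow y u - flow x u) \<le> M * norm (y - x)" by (rule flow_lipschitz[OF ub])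
      also have "\<dots> < c" using y M0 by (simp add: field_simps)
      finally have "dist (P (flow y u)) (P (flow x u)) < c"
        using P_dist[of "flow y u" "flow x u"] by (simp add: dist_norm)
      then have "norm (A y u - A x u) \<le> e'"
        unfolding A_def using c(2)[OF P_in P_in] by (simp add: dist_norm less_imp_le)
      then have "norm ((A y u - A x u) (vflow x v u)) \<le> e' * B"
        using norm_blinfun[of "A y u - A x u" "vflow x v u"] B(2)[OF ub] \<open>e' > 0\<close>
        by (smt (verit) mult_mono norm_ge_zero)
      moreover have "A y u (vflow y v u) - A x u (vflow x v u) =
          (A y u - A x u) (vflow x v u) + A y u (vflow y v u - vflow x v u)"
        by (simp add: blinfun.diff_left blinfun.diff_right)
      ultimately show "norm (A y u (vflow y v u) - A x u (vflow x v u)) \<le>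
          L * norm (vflow y v u - vflow x v u) + e' * B"
        using A_apply_bound[of y u "vflow y v u - vflow x v u"]
        by (metis add.commute add_mono norm_triangle_mono)
    qed (use \<open>e' > 0\<close> B in auto)
    also have "\<dots> = e" using M0 B by (simp add: e'_def)
    finally show "norm (vflow y v t - vflow x v t) \<le> e" .
  qed
qed

lemma tendsto_flow:
  assumes y: "(y \<longlongrightarrow> x) Fl" and \<tau>: "(\<tau> \<longlongrightarrow> t) Fl" and ev: "\<forall>\<^sub>F i in Fl. \<tau> i \<in> {-b..b}" and t: "t \<in> {-b..b}"
  shows "((\<lambda>i. flow (y i) (\<tau> i)) \<longlongrightarrow> flow x t) Fl"
proof -
  have 1: "((\<lambda>i. flow x (\<tau> i)) \<longlongrightarrow> flow x t) Fl"
    using flow_cont \<tau> t ev by (rule continuous_on_tendsto_compose)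
  have "((\<lambda>i. M * norm (y i - x)) \<longlongrightarrow> M * norm (x - x)) Fl"
    by (intro tendsto_intros y)
  then have "((\<lambda>i. flow (y i) (\<tau> i) - flow x (\<tau> i)) \<longlongrightarrow> 0) Fl"
    by (intro Lim_null_comparison[OF eventually_mono[OF ev flow_lipschitz]]) auto
  from tendsto_add[OF this 1] show ?thesis by simp
qed

lemma tendsto_vflow:
  assumes y: "(y \<longlongrightarrow> x) Fl" and \<tau>: "(\<tau> \<longlongrightarrow> t) Fl" and ev: "\<forall>\<^sub>F i in Fl. \<tau> i \<in> {-b..b}" and t: "t \<in> {-b..b}"
  shows "((\<lambda>i. vflow (y i) v (\<tau> i)) \<longlongrightarrow> vflow x v t) Fl"
proof -
  have 1: "((\<lambda>i. vflow x v (\<tau> i)) \<longlongrightarrow> vflow x v t) Fl"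
    using vflow_cont \<tau> t ev by (rule continuous_on_tendsto_compose)
  have "((\<lambda>i. vflow (y i) v (\<tau> i) - vflow x v (\<tau> i)) \<longlongrightarrow> 0) Fl"
  proof (rule tendstoI)
    fix e :: real assume "e > 0"
    then have "e / 2 > 0" by simp
    then obtain d where d: "d > 0" "\<And>y t. norm (y - x) < d \<Longrightarrow> t \<in> {-b..b} \<Longrightarrow> norm (vflow y v t - vflow x v t) \<le> e / 2"
      using vflow_uniform_continuity[of "e / 2" x v] by blast
    from tendstoD[OF y d(1)] ev
    show "\<forall>\<^sub>F i in Fl. dist (vflow (y i) v (\<tau> i) - vflow x v (\<tau> i)) 0 < e"
    proof eventually_elim
      case (elim i)
      then have "norm (vflow (y i) v (\<tau> i) - vflow x v (\<tau> i)) \<le> e / 2" by (intro d(2)) (auto simp: dist_norm)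
      with \<open>e > 0\<close> show ?case by simp
    qed
  qed
  from tendsto_add[OF this 1] show ?thesis by simp
qed

end

section \<open>The profile equation in the time \<open>r - a + g\<close>\<close>

definition dcoef :: "nat \<Rightarrow> real \<Rightarrow> real" where
  "dcoef n r = 1 / 2 + (real n - 1) / r\<^sup>2"

lemma coef_deriv: "r \<noteq> 0 \<Longrightarrow> (coef n has_real_derivative dcoef n r) (at r within S)"
  unfolding coef_def[abs_def] dcoef_def
  by (auto intro!: derivative_eq_intros simp: power2_eq_square field_simps)

lemma coef_cont: "0 \<notin> S \<Longrightarrow> continuous_on S (coef n)"
  by (rule DERIV_continuous_on[of _ _ "dcoef n"]) (auto intro!: coef_deriv)

lemma dcoef_cont: "0 \<notin> S \<Longrightarrow> continuous_on S (dcoef n)"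
  unfolding dcoef_def[abs_def] by (intro continuous_intros) auto

text \<open>For the slope p = q / (1 - q) this is (1 + p^2) (1 - q)^2, the factor 1 + p^2 of the
  profile equation cleared of its pole.\<close>

definition QQ :: "real \<Rightarrow> real" where "QQ q = 1 - 2 * q + 2 * q\<^sup>2"

lemma QQ_eq: "QQ q = (1 - q)\<^sup>2 + q\<^sup>2"
  by (simp add: QQ_def power2_eq_square algebra_simps)

lemma QQ_pos: "QQ q > 0"
  unfolding QQ_eq by (cases "q = 0") (auto intro: add_nonneg_pos)

text \<open>The right-hand side of the profile equation multiplied by 1 - q. It is also the time
  derivative of the angle: q has velocity \<open>QQ q * DD n r w q\<close>, and the angle has
  derivative \<open>1 / QQ q\<close> with respect to q.\<close>

definition DD :: "nat \<Rightarrow> real \<Rightarrow> real \<Rightarrow> real \<Rightarrow> real" where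
  "DD n r w q = coef n r * q - w * (1 - q) / 2"

text \<open>From the profile equation, dq/dr = QQ DD / (1 - q). Dividing by dt/dr = 1 + g' = 1 / (1
  - q) removes the pole at infinite slope. The first two components add up to 1, so r + w - t is
  conserved.\<close>

definition pfield :: "nat \<Rightarrow> real \<times> real \<times> real \<Rightarrow> real \<times> real \<times> real" where
  "pfield n = (\<lambda>(r, w, q). (1 - q, q, QQ q * DD n r w q))"

definition pfield_lin :: "nat \<Rightarrow> real \<times> real \<times> real \<Rightarrow> real \<times> real \<times> real \<Rightarrow> real \<times> real \<times> real" where
  "pfield_lin n = (\<lambda>(r, w, q) (R, W, S). (- S, S,
     (4 * q - 2) * S * DD n r w q +
     QQ q * (dcoef n r * R * q + coef n r * S - W * (1 - q) / 2 + w * S / 2)))"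

lemma has_derivative_real_compose:
  assumes "(f has_derivative f') (at x within S)" "(h has_real_derivative d) (at (f x))"
  shows "((\<lambda>x. h (f x)) has_derivative (\<lambda>v. f' v * d)) (at x within S)"
  using has_derivative_compose[OF assms(1) assms(2)[unfolded has_field_derivative_def]]
  by (simp add: mult.commute)

lemma QQ_deriv: "(QQ has_real_derivative 4 * q - 2) (at q within S)"
  unfolding QQ_def[abs_def] by (auto intro!: derivative_eq_intros)

lemma pfield_has_derivative:
  assumes "fst x \<noteq> 0"
  shows "(pfield n has_derivative pfield_lin n x) (at x within S)"
proof -
  obtain r w q where x: "x = (r, w, q)" by (cases x)
  have *: "pfield n = (\<lambda>x. (1 - snd (snd x), snd (snd x), QQ (snd (snd x)) *
      (coef n (fst x) * snd (snd x) - fst (snd x) * (1 - snd (snd x)) * (1 / 2))))"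
    by (auto simp: pfield_def DD_def)
  have fw: "((\<lambda>x. fst (snd x)) has_derivative (\<lambda>v. fst (snd v))) (at x within S)"
    and fq: "((\<lambda>x. snd (snd x)) has_derivative (\<lambda>v. snd (snd v))) (at x within S)"
    by (auto intro!: derivative_eq_intros)
  have fQ: "((\<lambda>x. QQ (snd (snd x))) has_derivative (\<lambda>v. snd (snd v) * (4 * q - 2))) (at x within S)"
    using has_derivative_real_compose[OF fq QQ_deriv] by (simp add: x)
  have fc: "((\<lambda>x. coef n (fst x)) has_derivative (\<lambda>v. fst v * dcoef n r)) (at x within S)"
    using has_derivative_real_compose[OF has_derivative_fst[OF has_derivative_ident] coef_deriv[OF assms]]
    by (simp add: x)
  have "(pfield n has_derivative (\<lambda>v. (0 - snd (snd v), snd (snd v),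
      QQ (snd (snd x)) * ((coef n (fst x) * snd (snd v) + fst v * dcoef n r * snd (snd x)) -
        (fst (snd x) * (0 - snd (snd v)) + fst (snd v) * (1 - snd (snd x))) * (1 / 2)) +
      snd (snd v) * (4 * q - 2) * (coef n (fst x) * snd (snd x) - fst (snd x) * (1 - snd (snd x)) * (1 / 2)))))
      (at x within S)"
    unfolding *
    by (intro has_derivative_Pair has_derivative_mult has_derivative_mult_left has_derivative_diff
        has_derivative_const fw fq fQ fc)
  also have "(\<lambda>v. (0 - snd (snd v), snd (snd v),
      QQ (snd (snd x)) * ((coef n (fst x) * snd (snd v) + fst v * dcoef n r * snd (snd x)) -
        (fst (snd x) * (0 - snd (snd v)) + fst (snd v) * (1 - snd (snd x))) * (1 / 2)) +
      snd (snd v) * (4 * q - 2) * (coef n (fst x) * snd (snd x) - fst (snd x) * (1 - snd (snd x)) * (1 / 2))))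
      = pfield_lin n x"
    by (simp add: fun_eq_iff pfield_lin_def x DD_def) (simp add: field_simps)
  finally show ?thesis .
qed

lemma pfield_lin_apply: "fst x \<noteq> 0 \<Longrightarrow> blinfun_apply (Blinfun (pfield_lin n x)) = pfield_lin n x"
  by (rule bounded_linear_Blinfun_apply, rule has_derivative_bounded_linear, rule pfield_has_derivative)

lemma pfield_lin_cont:
  assumes "\<And>x. x \<in> S \<Longrightarrow> fst x \<noteq> 0"
  shows "continuous_on S (\<lambda>x. Blinfun (pfield_lin n x))"
proof (rule continuous_on_blinfun_componentwise)
  fix i :: "real \<times> real \<times> real"
  obtain R W s where i: "i = (R, W, s)" by (cases i)
  have sub: "fst ` S \<subseteq> - {0}" using assms by auto
  have c: "continuous_on S (\<lambda>x. coef n (fst x))"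
    by (rule continuous_on_compose2[OF coef_cont continuous_on_fst[OF continuous_on_id] sub]) simp
  have d: "continuous_on S (\<lambda>x. dcoef n (fst x))"
    by (rule continuous_on_compose2[OF dcoef_cont continuous_on_fst[OF continuous_on_id] sub]) simp
  have "continuous_on S (\<lambda>x. pfield_lin n x i)"
    unfolding i pfield_lin_def split_beta DD_def QQ_def fst_conv snd_conv
    by (intro continuous_intros c d) auto
  then show "continuous_on S (\<lambda>x. blinfun_apply (Blinfun (pfield_lin n x)) i)"
    using assms continuous_on_cong[OF refl, of S] by (simp add: pfield_lin_apply)
qed

section \<open>Sturm comparison along a trajectory\<close>

lemma integrating_factor_nonneg:
  fixes y \<beta> :: "real \<Rightarrow> real"
  assumes "0 \<le> T" and y: "continuous_on {0..T} y" and \<beta>: "continuous_on {0..T} \<beta>"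
    and "0 \<le> y 0"
    and der: "\<And>t. 0 < t \<Longrightarrow> t < T \<Longrightarrow> (y has_real_derivative y' t) (at t)"
    and ge: "\<And>t. 0 < t \<Longrightarrow> t < T \<Longrightarrow> \<beta> t * y t \<le> y' t"
  shows "0 \<le> y T"
proof -
  obtain E where E: "\<And>t. t \<in> {0..T} \<Longrightarrow> (E has_vector_derivative \<beta> t) (at t within {0..T})"
    using antiderivative_continuous[OF \<beta>] by blast
  have "y 0 * exp (- E 0) \<le> y T * exp (- E T)"
  proof (rule DERIV_nonneg_imp_increasing_open[where f="\<lambda>t. y t * exp (- E t)" and a=0 and b=T])
    fix t assume t: "0 < t" "t < T"
    have "(E has_real_derivative \<beta> t) (at t)"
      using E[of t] t at_within_Icc_at[of 0 t T] by (simp add: has_real_derivative_iff_has_vector_derivative)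
    then have "((\<lambda>t. y t * exp (- E t)) has_real_derivative (y' t - \<beta> t * y t) * exp (- E t)) (at t)"
      by (auto intro!: derivative_eq_intros der t simp: algebra_simps)
    moreover have "0 \<le> (y' t - \<beta> t * y t) * exp (- E t)" using ge[OF t] by simp
    ultimately show "\<exists>z. ((\<lambda>t. y t * exp (- E t)) has_real_derivative z) (at t) \<and> 0 \<le> z" by blast
  next
    show "continuous_on {0..T} (\<lambda>t. y t * exp (- E t))"
      by (intro continuous_intros y has_vector_derivative_continuous_on[OF E])
  qed fact
  then have "0 \<le> y T * exp (- E T)" using \<open>0 \<le> y 0\<close> by (smt (verit) exp_ge_zero mult_nonneg_nonneg)
  then show ?thesis by (simp add: zero_le_mult_iff)
qed

text \<open>Up to the factor \<open>QQ q\<close>, the identity \<open>key\<close> is what remains of the claim once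
  \<open>(1 - q) * \<sigma>\<close> has been replaced by \<open>H + R * D\<close>.\<close>

lemma wronskian_derivative_identity:
  fixes c c0 d w q R \<sigma> Q D H H' N N' W W' P :: real
  assumes Q: "Q = 1 - 2 * q + 2 * q\<^sup>2" and D: "D = c * q - w * (1 - q) / 2"
    and H: "(1 - q) * \<sigma> = H + R * D" and N: "N = w * (1 - q) / 2 - c0 * q"
    and H': "H' = (c + w / 2) * Q * H - (1 - q) * (1 - q - R) / 2"
    and N': "N' = q * (1 - q) / 2 - w * (Q * D) / 2 - c0 * (Q * D)"
    and W: "W = (Q * H * (c - c0) * w - (1 - q) * (N * (1 - q - R) + q * H)) / 2"
    and P: "P = Q * d * (1 - q)\<^sup>2 + 2 * (c - c0) * q * Q * D"
    and W': "W' = ((4 * q - 2) * (Q * D) * H * (c - c0) * w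
      + Q * H' * (c - c0) * w + Q * H * (d * (1 - q)) * w + Q * H * (c - c0) * q
      + (Q * D) * (N * (1 - q - R) + q * H)
      - (1 - q) * (N' * (1 - q - R) + N * (Q * \<sigma> - Q * D) + (Q * D) * H + q * H')) / 2"
  shows "(1 - q) * W' = (c * Q * (1 - 3 * q) + 3 * Q * w * (1 - q) / 2) * W + H * w / 2 * P"
proof -
  have key: "(4 * q - 2) * D * H * (c - c0) * w * (1 - q)
      + ((c + w / 2) * Q * H - (1 - q) * (1 - q - R) / 2) * (c - c0) * w * (1 - q)
      + H * d * (1 - q) * w * (1 - q) + H * (c - c0) * q * (1 - q) + D * (N * (1 - q - R) + q * H) * (1 - q)
      - (1 - q) * (- (w * D / 2 + c0 * D) * (1 - q - R) * (1 - q) + N * (H + R * D) - N * D * (1 - q)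
          + D * H * (1 - q) + q * (c + w / 2) * H * (1 - q))
      = (c * (1 - 3 * q) + 3 * w * (1 - q) / 2) * (Q * H * (c - c0) * w - (1 - q) * (N * (1 - q - R) + q * H))
        + H * w * (d * (1 - q)\<^sup>2 + 2 * (c - c0) * q * D)"
    unfolding D N Q by (simp add: field_simps power2_eq_square)
  have "2 * ((1 - q) * W') = Q * ((4 * q - 2) * D * H * (c - c0) * w * (1 - q)
      + ((c + w / 2) * Q * H - (1 - q) * (1 - q - R) / 2) * (c - c0) * w * (1 - q)
      + H * d * (1 - q) * w * (1 - q) + H * (c - c0) * q * (1 - q) + D * (N * (1 - q - R) + q * H) * (1 - q)
      - (1 - q) * (- (w * D / 2 + c0 * D) * (1 - q - R) * (1 - q) + N * ((1 - q) * \<sigma>) - N * D * (1 - q)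
          + D * H * (1 - q) + q * (c + w / 2) * H * (1 - q)))"
    unfolding W' H' N' by (simp add: field_simps)
  also have "\<dots> = 2 * ((c * Q * (1 - 3 * q) + 3 * Q * w * (1 - q) / 2) * W + H * w / 2 * P)"
    unfolding H key W P by (simp add: field_simps)
  finally show ?thesis by simp
qed

text \<open>The factor (1 - q)^2 q has logarithmic derivative Q D (1 - 3 q) / (q (1 - q)). Its part
  containing \<open>c\<close> cancels the coefficient c Q (1 - 3 q) / (1 - q) of \<open>W\<close>,
  which is singular at q = 1; of the linear terms only w Q / (2 q) survives.\<close>

lemma quotient_derivative_identity:
  fixes c w q Q D H W W' P :: real
  assumes "0 < q" "q < 1" and D: "D = c * q - w * (1 - q) / 2"
    and W': "(1 - q) * W' = (c * Q * (1 - 3 * q) + 3 * Q * w * (1 - q) / 2) * W + H * w / 2 * P"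
  shows "(W' * ((1 - q)\<^sup>2 * q) - W * ((1 - q)\<^sup>2 * (Q * D) - 2 * (1 - q) * (Q * D) * q)) / ((1 - q)\<^sup>2 * q)\<^sup>2
    = (w * Q / (2 * q)) * (W / ((1 - q)\<^sup>2 * q)) + H * w * P / (2 * q * (1 - q) ^ 3)"
proof -
  have "W' * ((1 - q)\<^sup>2 * q) - W * ((1 - q)\<^sup>2 * (Q * D) - 2 * (1 - q) * (Q * D) * q)
      = (1 - q) * (((1 - q) * W') * q - W * (Q * D) * (1 - 3 * q))"
    by (simp add: algebra_simps power2_eq_square)
  also have "\<dots> = (1 - q) * (Q * w * (1 - q) * W + H * w * P * q) / 2"
    unfolding W' D by (simp add: field_simps)
  finally have num: "W' * ((1 - q)\<^sup>2 * q) - W * ((1 - q)\<^sup>2 * (Q * D) - 2 * (1 - q) * (Q * D) * q)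
      = (1 - q) * (Q * w * (1 - q) * W + H * w * P * q) / 2" .
  have frac: "u * (Q * w * u * W + H * w * P * q) / 2 / (u\<^sup>2 * q)\<^sup>2
      = (w * Q / (2 * q)) * (W / (u\<^sup>2 * q)) + H * w * P / (2 * q * u ^ 3)" if "0 < u" for u
    using that \<open>0 < q\<close> by (simp add: field_simps power2_eq_square power3_eq_cube)
  show ?thesis unfolding num by (rule frac) (use \<open>q < 1\<close> in simp)
qed

text \<open>\<open>R\<close> and \<open>\<sigma>\<close> are the derivatives of \<open>r\<close> and of the angle with respect to the starting
  point at fixed time. Below, \<open>H / (1 - q)\<close> is the linearized function and \<open>N / (1 - q)\<close> the
  comparison function \<open>g / 2 - coef n a * g'\<close>; clearing the denominators keeps everything regular
  where the curve is vertical (\<open>q = 1\<close>). Likewise \<open>eta_poly\<close> is \<open>(1 - q) ^ 4 * eta\<close>, and \<open>W\<close> is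
  the Wronskian of \<open>H\<close> and \<open>N\<close>, written so that its vanishing at time \<open>0\<close> can be read off.\<close>

locale trajectory =
  fixes n :: nat and T a \<kappa> :: real and r w q R \<sigma> :: "real \<Rightarrow> real"
  assumes T_nonneg: "0 \<le> T"
    and r_ne: "t \<in> {0..T} \<Longrightarrow> r t \<noteq> 0"
    and r_deriv: "t \<in> {0..T} \<Longrightarrow> (r has_real_derivative 1 - q t) (at t within {0..T})"
    and w_deriv: "t \<in> {0..T} \<Longrightarrow> (w has_real_derivative q t) (at t within {0..T})"
    and q_deriv: "t \<in> {0..T} \<Longrightarrow> (q has_real_derivative QQ (q t) * DD n (r t) (w t) (q t)) (at t within {0..T})"
    and R_deriv: "t \<in> {0..T} \<Longrightarrow> (R has_real_derivative - (QQ (q t) * \<sigma> t)) (at t within {0..T})"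
    and \<sigma>_deriv: "t \<in> {0..T} \<Longrightarrow> (\<sigma> has_real_derivative dcoef n (r t) * R t * q t +
        (coef n (r t) + w t / 2) * QQ (q t) * \<sigma> t - (1 - R t) * (1 - q t) / 2) (at t within {0..T})"
    and init: "r 0 = a" "w 0 = 0" "q 0 = \<kappa>" "R 0 = 1" "\<sigma> 0 = 0"
begin

definition "D t = DD n (r t) (w t) (q t)"
definition "H t = (1 - q t) * \<sigma> t - R t * D t"
definition "N t = w t * (1 - q t) / 2 - coef n a * q t"
definition "eta_poly t = QQ (q t) * dcoef n (r t) * (1 - q t)\<^sup>2 + 2 * (coef n (r t) - coef n a) * q t * QQ (q t) * D t"
definition "H' t = (coef n (r t) + w t / 2) * QQ (q t) * H t - (1 - q t) * (1 - q t - R t) / 2"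
definition "N' t = q t * (1 - q t) / 2 - w t * (QQ (q t) * D t) / 2 - coef n a * (QQ (q t) * D t)"

definition "W t = (QQ (q t) * H t * (coef n (r t) - coef n a) * w t - (1 - q t) * (N t * (1 - q t - R t) + q t * H t)) / 2"

definition "W' t = ((4 * q t - 2) * (QQ (q t) * D t) * H t * (coef n (r t) - coef n a) * w t
   + QQ (q t) * H' t * (coef n (r t) - coef n a) * w t + QQ (q t) * H t * (dcoef n (r t) * (1 - q t)) * w t
   + QQ (q t) * H t * (coef n (r t) - coef n a) * q t
   + (QQ (q t) * D t) * (N t * (1 - q t - R t) + q t * H t)
   - (1 - q t) * (N' t * (1 - q t - R t) + N t * (QQ (q t) * \<sigma> t - QQ (q t) * D t) + (QQ (q t) * D t) * H t + q t * H' t)) / 2"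

lemma c_deriv: "t \<in> {0..T} \<Longrightarrow> ((\<lambda>t. coef n (r t)) has_real_derivative dcoef n (r t) * (1 - q t)) (at t within {0..T})"
  using DERIV_chain2[OF coef_deriv[OF r_ne] r_deriv] by blast

lemma Q_deriv: "t \<in> {0..T} \<Longrightarrow> ((\<lambda>t. QQ (q t)) has_real_derivative (4 * q t - 2) * (QQ (q t) * D t)) (at t within {0..T})"
  using DERIV_chain2[OF QQ_deriv q_deriv] by (simp add: D_def)

lemma q_deriv': "t \<in> {0..T} \<Longrightarrow> (q has_real_derivative QQ (q t) * D t) (at t within {0..T})"
  using q_deriv by (simp add: D_def)

lemma D_deriv: "t \<in> {0..T} \<Longrightarrow> (D has_real_derivative
    dcoef n (r t) * (1 - q t) * q t + coef n (r t) * (QQ (q t) * D t) - q t * (1 - q t) / 2 + w t * (QQ (q t) * D t) / 2)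
    (at t within {0..T})"
  unfolding D_def[abs_def] DD_def
  by (auto intro!: derivative_eq_intros c_deriv w_deriv q_deriv' simp: D_def DD_def field_simps)

lemma H_deriv:
  assumes t: "t \<in> {0..T}"
  shows "(H has_real_derivative H' t) (at t within {0..T})"
  unfolding H_def[abs_def]
  by (rule DERIV_cong[OF DERIV_diff[OF DERIV_mult[OF DERIV_diff[OF DERIV_const q_deriv'[OF t]] \<sigma>_deriv[OF t]]
        DERIV_mult[OF R_deriv[OF t] D_deriv[OF t]]]])
     (simp add: H'_def H_def D_def DD_def field_simps)

lemma N_deriv: "t \<in> {0..T} \<Longrightarrow> (N has_real_derivative N' t) (at t within {0..T})"
  unfolding N_def[abs_def] N'_def
  by (auto intro!: derivative_eq_intros w_deriv q_deriv' simp: field_simps)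

lemma W_deriv: "t \<in> {0..T} \<Longrightarrow> (W has_real_derivative W' t) (at t within {0..T})"
  unfolding W_def[abs_def] W'_def
  by (auto intro!: derivative_eq_intros w_deriv q_deriv' Q_deriv c_deriv R_deriv H_deriv N_deriv simp: field_simps)

lemma wronskian: "H' t * N t - H t * N' t = W t"
  unfolding W_def H'_def N_def N'_def D_def DD_def by (simp add: field_simps)

lemma W_equation:
  "(1 - q t) * W' t = (coef n (r t) * QQ (q t) * (1 - 3 * q t) + 3 * QQ (q t) * w t * (1 - q t) / 2) * W t + H t * w t / 2 * eta_poly t"
proof (rule wronskian_derivative_identity[where c="coef n (r t)" and d="dcoef n (r t)"])
  show "QQ (q t) = 1 - 2 * q t + 2 * (q t)\<^sup>2" by (rule QQ_def)
  show "D t = coef n (r t) * q t - w t * (1 - q t) / 2" by (simp add: D_def DD_def)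
  show "(1 - q t) * \<sigma> t = H t + R t * D t" by (simp add: H_def)
qed (rule N_def H'_def N'_def W_def eta_poly_def W'_def)+

lemma within_at: "0 < t \<Longrightarrow> t < T \<Longrightarrow> at t within {0..T} = at t"
  by (simp add: at_within_Icc_at)

lemma continuous: "continuous_on {0..T} r" "continuous_on {0..T} w" "continuous_on {0..T} q"
    "continuous_on {0..T} R" "continuous_on {0..T} \<sigma>" "continuous_on {0..T} H" "continuous_on {0..T} N"
    "continuous_on {0..T} W" "continuous_on {0..T} (\<lambda>t. coef n (r t))" "continuous_on {0..T} (\<lambda>t. QQ (q t))"
  by (rule DERIV_continuous_on, erule r_deriv w_deriv q_deriv R_deriv \<sigma>_deriv H_deriv N_deriv W_deriv c_deriv Q_deriv)+

end

text \<open>\<open>\<kappa>\<close> = 1 is the vertical start, hence q < 1 is demanded for positive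
  times only. At the final time q may vanish, since the portion can end at a horizontal
  point.\<close>

locale nonneg_trajectory = trajectory +
  assumes \<kappa>: "0 < \<kappa>" "\<kappa> \<le> 1"
    and c0_neg: "coef n a < 0"
    and q_less_1: "0 < t \<Longrightarrow> t \<le> T \<Longrightarrow> q t < 1"
    and q_nonneg: "t \<in> {0..T} \<Longrightarrow> 0 \<le> q t"
begin

lemma w_mono:
  assumes "0 \<le> s" "s \<le> t" "t \<le> T"
  shows "w s \<le> w t"
proof (rule DERIV_nonneg_imp_increasing_open[where f=w and a=s and b=t])
  fix u assume "s < u" "u < t"
  then have u: "u \<in> {0..T}" "0 < u" "u < T" using assms by auto
  show "\<exists>y. (w has_real_derivative y) (at u) \<and> 0 \<le> y"
    using w_deriv[OF u(1)] q_nonneg[OF u(1)] unfolding within_at[OF u(2,3)] by blast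
next
  show "continuous_on {s..t} w"
    using assms by (intro continuous_on_subset[OF continuous(2)]) auto
qed fact

lemma w_pos: assumes "0 < t" "t \<le> T" shows "0 < w t"
proof -
  have "(w has_real_derivative \<kappa>) (at 0 within {0..T})"
    using w_deriv[of 0] init T_nonneg by simp
  from has_real_derivative_pos_inc_right[OF this \<kappa>(1)]
  obtain d where d: "d > 0" "\<And>h. 0 < h \<Longrightarrow> h \<in> {0..T} \<Longrightarrow> h < d \<Longrightarrow> w 0 < w h" by auto
  have "w 0 < w (min (d / 2) t)" using d(1) assms by (intro d(2)) auto
  also have "\<dots> \<le> w t" using d(1) assms by (intro w_mono) auto
  finally show ?thesis using init by simp
qed

text \<open>Where q = 0 the field reduces to q' = - w / 2 < 0, so q would be negative immediately
  afterwards. Only the final time escapes this argument.\<close>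

lemma q_pos: assumes "0 \<le> t" "t < T" shows "0 < q t"
proof (rule ccontr)
  assume "\<not> 0 < q t"
  then have q0: "q t = 0" using q_nonneg[of t] assms by simp
  with \<kappa> init have "0 < t" using assms by (cases "t = 0") auto
  have "(q has_real_derivative - (w t / 2)) (at t within {0..T})"
    using q_deriv[of t] assms q0 by (simp add: QQ_def DD_def)
  moreover have "- (w t / 2) < 0" using w_pos[of t] \<open>0 < t\<close> assms by simp
  ultimately obtain d where d: "d > 0" "\<And>h. 0 < h \<Longrightarrow> t + h \<in> {0..T} \<Longrightarrow> h < d \<Longrightarrow> q (t + h) < q t"
    using has_real_derivative_neg_dec_right by blast
  have "q (t + min (d / 2) (T - t)) < q t" using d(1) assms by (intro d(2)) auto
  moreover have "0 \<le> q (t + min (d / 2) (T - t))" using d(1) assms by (intro q_nonneg) auto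
  ultimately show False using q0 by simp
qed

text \<open>Both summands are nonnegative because \<open>coef n a\<close> is negative. They cannot
  vanish together: q = 0 occurs only at positive times, where w > 0.\<close>

lemma N_pos: assumes "0 \<le> t" "t \<le> T" shows "0 < N t"
proof (cases "q t = 0")
  case True
  then have "0 < t" using \<kappa> init assms by (cases "t = 0") auto
  with True show ?thesis using w_pos[of t] assms by (simp add: N_def)
next
  case False
  then have q: "0 < q t" using q_nonneg[of t] assms by simp
  have "q t \<le> 1" using q_less_1[of t] \<kappa> init assms by (cases "t = 0") auto
  moreover have "0 \<le> w t" using w_pos[of t] init assms by (cases "t = 0") auto
  ultimately have "0 \<le> w t * (1 - q t) / 2" by simp
  moreover have "0 < - coef n a * q t" using q c0_neg by (intro mult_pos_pos) auto
  ultimately show ?thesis by (simp add: N_def)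
qed

lemma tendsto_at_0: "0 < T \<Longrightarrow> continuous_on {0..T} f \<Longrightarrow> (f \<longlongrightarrow> f 0) (at 0 within {0..T})"
  by (auto simp: continuous_on_def)

text \<open>For \<open>\<kappa> = 1\<close> both \<open>1 - q\<close> and the numerators vanish at \<open>0\<close>; the quotients are
  limits of difference quotients.\<close>

lemma initial_quotients:
  assumes "0 < T"
  shows "((\<lambda>t. (coef n (r t) - coef n a) / (1 - q t)) \<longlongrightarrow> 0) (at 0 within {0..T})"
    and "\<exists>l. ((\<lambda>t. w t / (1 - q t)) \<longlongrightarrow> l) (at 0 within {0..T})"
proof -
  let ?F = "at 0 within {0..T}"
  have z: "(0::real) \<in> {0..T}" using assms by simp
  have "((\<lambda>t. (coef n (r t) - coef n a) / (1 - q t)) \<longlongrightarrow> 0) ?F \<and>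
        (\<exists>l. ((\<lambda>t. w t / (1 - q t)) \<longlongrightarrow> l) ?F)"
  proof (cases "\<kappa> = 1")
    case False
    have "((\<lambda>t. (coef n (r t) - coef n a) / (1 - q t)) \<longlongrightarrow> (coef n (r 0) - coef n a) / (1 - q 0)) ?F"
      "((\<lambda>t. w t / (1 - q t)) \<longlongrightarrow> w 0 / (1 - q 0)) ?F"
      by (intro tendsto_divide tendsto_diff tendsto_const tendsto_at_0[OF assms] continuous; use False init in simp)+
    then show ?thesis unfolding init by auto
  next
    case True
    have ev: "\<forall>\<^sub>F t in ?F. t \<noteq> 0" by (simp add: eventually_at_filter)
    have c: "((\<lambda>t. (coef n (r t) - coef n a) / t) \<longlongrightarrow> 0) ?F"
      using c_deriv[OF z] True init by (simp add: has_field_derivative_iff)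
    have w: "((\<lambda>t. w t / t) \<longlongrightarrow> 1) ?F"
      using w_deriv[OF z] True init by (simp add: has_field_derivative_iff)
    \<comment> \<open>At a vertical start q' = \<open>coef n a\<close>, which is negative, so 1 - q
      vanishes to exactly first order. The numerator of the first quotient vanishes to higher order
      because r' = 1 - q = 0 there.\<close>
    have "((\<lambda>t. (q t - 1) / t) \<longlongrightarrow> coef n a) ?F"
      using q_deriv[OF z] True init by (simp add: has_field_derivative_iff QQ_def DD_def)
    from tendsto_minus[OF this] have q: "((\<lambda>t. (1 - q t) / t) \<longlongrightarrow> - coef n a) ?F"
      by (simp add: minus_divide_left)
    have lim: "((\<lambda>t. ((coef n (r t) - coef n a) / t) / ((1 - q t) / t)) \<longlongrightarrow> 0 / - coef n a) ?F"
      "((\<lambda>t. (w t / t) / ((1 - q t) / t)) \<longlongrightarrow> 1 / - coef n a) ?F"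
      by (intro tendsto_divide c w q; use c0_neg in simp)+
    have eq: "\<forall>\<^sub>F t in ?F. ((coef n (r t) - coef n a) / t) / ((1 - q t) / t) = (coef n (r t) - coef n a) / (1 - q t)"
      "\<forall>\<^sub>F t in ?F. (w t / t) / ((1 - q t) / t) = w t / (1 - q t)"
      by (rule eventually_mono[OF ev], simp)+
    show ?thesis
      using Lim_transform_eventually[OF lim(1) eq(1)] Lim_transform_eventually[OF lim(2) eq(2)] by auto
  qed
  then show "((\<lambda>t. (coef n (r t) - coef n a) / (1 - q t)) \<longlongrightarrow> 0) ?F"
    "\<exists>l. ((\<lambda>t. w t / (1 - q t)) \<longlongrightarrow> l) ?F" by auto
qed

text \<open>With primes in \<open>r\<close> and \<open>v\<close> = N / (1 - q), this is (h' v - h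
  v') / g': passing from time to \<open>r\<close> accounts for one factor 1 - q in \<open>W\<close>,
  and the denominators of \<open>h\<close> and \<open>v\<close> for two more. The value at 0 is the
  limit found in \<open>y_tendsto_0\<close>.\<close>

definition "y t = (if t = 0 then 0 else W t / ((1 - q t)\<^sup>2 * q t))"

text \<open>Rearranged so that 1 - q occurs in a denominator only inside the two quotients of
  \<open>initial_quotients\<close>. The remaining terms tend to 0 at the start since
  \<open>R 0 = 1\<close> and \<open>\<sigma> 0 = 0\<close>.\<close>

lemma W_split:
  assumes "q t \<noteq> 1"
  shows "W t / (1 - q t)\<^sup>2 = (QQ (q t) * H t * (w t / (1 - q t)) * ((coef n (r t) - coef n a) / (1 - q t))
    - (N t * (1 - R t) + q t * \<sigma> t - (q t)\<^sup>2 * R t * ((coef n (r t) - coef n a) / (1 - q t)))) / 2"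
proof -
  have "N t * (1 - q t - R t) + q t * H t =
      (1 - q t) * (N t * (1 - R t) + q t * \<sigma> t) - (q t)\<^sup>2 * R t * (coef n (r t) - coef n a)"
    unfolding N_def H_def D_def DD_def by (simp add: field_simps power2_eq_square)
  then have Wt: "W t = (QQ (q t) * H t * w t * (coef n (r t) - coef n a)
      - (1 - q t) * ((1 - q t) * (N t * (1 - R t) + q t * \<sigma> t) - (q t)\<^sup>2 * R t * (coef n (r t) - coef n a))) / 2"
    unfolding W_def by (simp add: mult_ac)
  have gen: "(X * x * e - u * (u * A - B * e)) / 2 / u\<^sup>2 = (X * (x / u) * (e / u) - (A - B * (e / u))) / 2"
    if "u \<noteq> 0" for X x e u A B :: real
    using that by (simp add: field_simps power2_eq_square)
  show ?thesis unfolding Wt by (rule gen) (use assms in simp)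
qed

lemma y_tendsto_0:
  assumes "0 < T"
  shows "(y \<longlongrightarrow> 0) (at 0 within {0..T})"
proof -
  let ?F = "at 0 within {0..T}"
  obtain l where l: "((\<lambda>t. w t / (1 - q t)) \<longlongrightarrow> l) ?F" using initial_quotients(2)[OF assms] by blast
  note c = initial_quotients(1)[OF assms]
  have "((\<lambda>t. (QQ (q t) * H t * (w t / (1 - q t)) * ((coef n (r t) - coef n a) / (1 - q t))
    - (N t * (1 - R t) + q t * \<sigma> t - (q t)\<^sup>2 * R t * ((coef n (r t) - coef n a) / (1 - q t)))) / 2 / q t)
    \<longlongrightarrow> (QQ (q 0) * H 0 * l * 0 - (N 0 * (1 - R 0) + q 0 * \<sigma> 0 - (q 0)\<^sup>2 * R 0 * 0)) / 2 / q 0) ?F"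
    using \<kappa> init by (intro tendsto_intros l c tendsto_at_0[OF assms] continuous) auto
  then have "((\<lambda>t. (QQ (q t) * H t * (w t / (1 - q t)) * ((coef n (r t) - coef n a) / (1 - q t))
    - (N t * (1 - R t) + q t * \<sigma> t - (q t)\<^sup>2 * R t * ((coef n (r t) - coef n a) / (1 - q t)))) / 2 / q t)
    \<longlongrightarrow> 0) ?F" using init by simp
  then show ?thesis
  proof (rule Lim_transform_eventually)
    show "\<forall>\<^sub>F t in ?F. (QQ (q t) * H t * (w t / (1 - q t)) * ((coef n (r t) - coef n a) / (1 - q t))
      - (N t * (1 - R t) + q t * \<sigma> t - (q t)\<^sup>2 * R t * ((coef n (r t) - coef n a) / (1 - q t)))) / 2 / q t = y t"
      unfolding eventually_at_filter
    proof (intro always_eventually allI impI)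
      fix t assume "t \<noteq> 0" "t \<in> {0..T}"
      then have "q t \<noteq> 1" using q_less_1[of t] by auto
      then show "(QQ (q t) * H t * (w t / (1 - q t)) * ((coef n (r t) - coef n a) / (1 - q t))
        - (N t * (1 - R t) + q t * \<sigma> t - (q t)\<^sup>2 * R t * ((coef n (r t) - coef n a) / (1 - q t)))) / 2 / q t = y t"
        unfolding W_split[OF \<open>q t \<noteq> 1\<close>, symmetric] using \<open>t \<noteq> 0\<close> by (simp add: y_def)
    qed
  qed
qed

text \<open>By \<open>quotient_derivative_identity\<close>, \<open>y\<close> satisfies a linear
  equation with regular coefficient, initial value 0, and a source term nonnegative when
  \<open>H\<close> and \<open>eta_poly\<close> are. The time \<open>s\<close> stays before
  \<open>T\<close> because \<open>y\<close> divides by q, which may vanish at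
  \<open>T\<close>.\<close>

lemma W_nonneg:
  assumes s: "0 < s" "s < T"
    and H: "\<And>t. 0 < t \<Longrightarrow> t < s \<Longrightarrow> 0 \<le> H t"
    and eta: "\<And>t. 0 < t \<Longrightarrow> t < T \<Longrightarrow> 0 \<le> eta_poly t"
  shows "0 \<le> W s"
proof -
  have sub: "{0..s} \<subseteq> {0..T}" using s by auto
  define y' where "y' t = (W' t * ((1 - q t)\<^sup>2 * q t) -
      W t * ((1 - q t)\<^sup>2 * (QQ (q t) * D t) - 2 * (1 - q t) * (QQ (q t) * D t) * q t)) / ((1 - q t)\<^sup>2 * q t)\<^sup>2" for t
  have "0 \<le> y s"
  proof (rule integrating_factor_nonneg[where y=y and T=s and \<beta>="\<lambda>t. w t * QQ (q t) / (2 * q t)" and y'=y'])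
    show "continuous_on {0..s} y"
      unfolding continuous_on_def
    proof
      fix t assume t: "t \<in> {0..s}"
      show "(y \<longlongrightarrow> y t) (at t within {0..s})"
      proof (cases "t = 0")
        case True
        then have "y t = 0" by (simp add: y_def)
        have "0 < T" using s by simp
        from tendsto_within_subset[OF y_tendsto_0[OF this] sub] show ?thesis
          unfolding \<open>y t = 0\<close> unfolding True .
      next
        case False
        then have "q t \<noteq> 1" "q t \<noteq> 0" using q_less_1[of t] q_pos[of t] t s by auto
        then have "((\<lambda>t. W t / ((1 - q t)\<^sup>2 * q t)) \<longlongrightarrow> W t / ((1 - q t)\<^sup>2 * q t)) (at t within {0..s})"
          using t continuous_on_subset[OF continuous(8) sub] continuous_on_subset[OF continuous(3) sub]
          by (intro tendsto_intros) (auto simp: continuous_on_def)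
        moreover have "\<forall>\<^sub>F u in at t within {0..s}. u \<noteq> 0"
          using False by (intro eventually_at_topological[THEN iffD2] exI[of _ "- {0}"]) auto
        then have "\<forall>\<^sub>F u in at t within {0..s}. W u / ((1 - q u)\<^sup>2 * q u) = y u"
          by eventually_elim (simp add: y_def)
        ultimately have "(y \<longlongrightarrow> W t / ((1 - q t)\<^sup>2 * q t)) (at t within {0..s})"
          by (rule Lim_transform_eventually)
        moreover have "y t = W t / ((1 - q t)\<^sup>2 * q t)" using False by (simp add: y_def)
        ultimately show ?thesis by simp
      qed
    qed
    have "2 * q t \<noteq> 0" if "t \<in> {0..s}" for t
      using q_pos[of t] that s by auto
    then show "continuous_on {0..s} (\<lambda>t. w t * QQ (q t) / (2 * q t))"
      by (intro continuous_intros continuous_on_subset[OF continuous(2) sub]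
          continuous_on_subset[OF continuous(10) sub] continuous_on_subset[OF continuous(3) sub]) auto
  next
    fix t assume t: "0 < t" "t < s"
    then have tT: "t \<in> {0..T}" "0 < t" "t < T" using s by auto
    have q: "0 < q t" "q t < 1" using q_pos[of t] q_less_1[of t] tT by auto
    note dq = q_deriv'[OF tT(1), unfolded within_at[OF tT(2,3)]]
    have "((\<lambda>t. (1 - q t)\<^sup>2 * q t) has_real_derivative
        (1 - q t)\<^sup>2 * (QQ (q t) * D t) - 2 * (1 - q t) * (QQ (q t) * D t) * q t) (at t)"
      by (rule DERIV_cong[OF DERIV_mult[OF DERIV_power[OF DERIV_diff[OF DERIV_const dq]] dq]])
         (simp add: algebra_simps)
    from DERIV_divide[OF W_deriv[OF tT(1), unfolded within_at[OF tT(2,3)]] this]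
    have "((\<lambda>t. W t / ((1 - q t)\<^sup>2 * q t)) has_real_derivative y' t) (at t)"
      using q unfolding y'_def power2_eq_square[of "(1 - q t)\<^sup>2 * q t"] by simp
    then show "(y has_real_derivative y' t) (at t)"
    proof (rule has_field_derivative_transform_within_open[where S="{0<..}"])
      show "W x / ((1 - q x)\<^sup>2 * q x) = y x" if "x \<in> {0<..}" for x using that by (simp add: y_def)
    qed (use t in auto)
    have "y' t = w t * QQ (q t) / (2 * q t) * (W t / ((1 - q t)\<^sup>2 * q t)) +
        H t * w t * eta_poly t / (2 * q t * (1 - q t) ^ 3)"
      unfolding y'_def by (rule quotient_derivative_identity[OF q _ W_equation]) (simp add: D_def DD_def)
    moreover have "0 \<le> H t * w t * eta_poly t / (2 * q t * (1 - q t) ^ 3)"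
      using H[OF t] eta[OF tT(2,3)] w_pos[of t] tT q by simp
    ultimately show "w t * QQ (q t) / (2 * q t) * y t \<le> y' t" using t by (simp add: y_def)
  qed (use s in \<open>auto simp: y_def\<close>)
  moreover have "0 < (1 - q s)\<^sup>2 * q s" using q_pos[of s] q_less_1[of s] s by simp
  ultimately show ?thesis using s by (simp add: y_def zero_le_divide_iff)
qed

theorem H_pos:
  assumes eta: "\<And>t. 0 < t \<Longrightarrow> t < T \<Longrightarrow> 0 \<le> eta_poly t"
  shows "0 < H T"
proof (rule ccontr)
  assume H_T: "\<not> 0 < H T"
  have H0: "0 < H 0" using init c0_neg \<kappa> by (simp add: H_def D_def DD_def mult_less_0_iff)
  \<comment> \<open>The infimum of this closed set is the first time at which positivity fails.
    Before it \<open>H\<close> is positive, so \<open>W_nonneg\<close> is available exactly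
    there.\<close>
  define S where "S = {t \<in> {0..T}. H t \<le> 0}"
  have "closed S"
    using continuous_closed_preimage[OF continuous(6) closed_atLeastAtMost closed_atMost[of 0]]
    by (simp add: S_def vimage_def Int_def)
  have "T \<in> S" using H_T T_nonneg by (simp add: S_def)
  have bb: "bdd_below S" by (auto simp: S_def bdd_below_def)
  define s where "s = Inf S"
  have "s \<in> S" unfolding s_def using \<open>closed S\<close> \<open>T \<in> S\<close> bb by (intro closed_contains_Inf) auto
  have Hpos: "0 < H t" if "0 \<le> t" "t < s" for t
  proof (rule ccontr)
    assume "\<not> 0 < H t"
    then have "t \<in> S" using that \<open>s \<in> S\<close> by (auto simp: S_def)
    then have "s \<le> t" unfolding s_def using bb by (rule cInf_lower)
    with that show False by simp
  qed
  have s: "0 \<le> s" "s \<le> T" "H s \<le> 0" using \<open>s \<in> S\<close> by (auto simp: S_def)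
  have sub: "{0..s} \<subseteq> {0..T}" using s by auto
  have "H 0 / N 0 \<le> H s / N s"
  proof (rule DERIV_nonneg_imp_increasing_open[where f="\<lambda>t. H t / N t" and a=0 and b=s])
    fix t assume t: "0 < t" "t < s"
    then have tT: "t \<in> {0..T}" "0 < t" "t < T" using s by auto
    have N: "0 < N t" using N_pos[of t] tT by simp
    have "((\<lambda>t. H t / N t) has_real_derivative (H' t * N t - H t * N' t) / (N t * N t)) (at t)"
      using H_deriv[OF tT(1)] N_deriv[OF tT(1)] N unfolding within_at[OF tT(2,3)]
      by (intro DERIV_divide) auto
    moreover have "0 \<le> W t"
      using tT t eta Hpos by (intro W_nonneg) (auto intro: less_imp_le)
    ultimately show "\<exists>z. ((\<lambda>t. H t / N t) has_real_derivative z) (at t) \<and> 0 \<le> z"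
      using N unfolding wronskian by (intro exI[of _ "W t / (N t * N t)"]) simp
  next
    show "continuous_on {0..s} (\<lambda>t. H t / N t)"
      using N_pos s by (intro continuous_intros continuous_on_subset[OF continuous(6) sub]
          continuous_on_subset[OF continuous(7) sub]) force
  qed (use s in auto)
  moreover have "H s / N s \<le> 0" using s N_pos[of s] by (simp add: divide_nonpos_pos)
  moreover have "0 < H 0 / N 0" using H0 N_pos[of 0] T_nonneg by simp
  ultimately show False by simp
qed

end

section \<open>Trajectories and graphs\<close>

lemma profile_equationD:
  assumes "profile_equation n J g" "r \<in> J"
  shows "(g has_real_derivative deriv g r) (at r)"
    and "(deriv g has_real_derivative (1 + (deriv g r)\<^sup>2) * (coef n r * deriv g r - g r / 2)) (at r)"
    and "deriv (deriv g) r = (1 + (deriv g r)\<^sup>2) * (coef n r * deriv g r - g r / 2)"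
    and "r \<noteq> 0"
proof -
  have *: "g differentiable (at r)" "deriv g differentiable (at r)"
    and eq: "deriv (deriv g) r / (1 + (deriv g r)\<^sup>2) = coef n r * deriv g r - g r / 2"
    using assms by (auto simp: profile_equation_def)
  show "(g has_real_derivative deriv g r) (at r)"
    using *(1) by (metis DERIV_deriv_iff_real_differentiable)
  have "1 + (deriv g r)\<^sup>2 > 0" by (simp add: add_pos_nonneg)
  then show eq': "deriv (deriv g) r = (1 + (deriv g r)\<^sup>2) * (coef n r * deriv g r - g r / 2)"
    using eq by (simp add: field_simps)
  show "(deriv g has_real_derivative (1 + (deriv g r)\<^sup>2) * (coef n r * deriv g r - g r / 2)) (at r)"
    using *(2) unfolding eq'[symmetric] by (metis DERIV_deriv_iff_real_differentiable)
  show "r \<noteq> 0" using assms by (auto simp: profile_equation_def)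
qed

text \<open>The pair of differences of values and slopes solves a linear system: factoring the
  difference of the two right-hand sides gives the coefficients \<open>A\<close> and
  \<open>B\<close>, which are bounded on the compact segment between the two points. Gronwall then
  keeps the pair at 0.\<close>

lemma profile_equation_unique:
  assumes 1: "profile_equation n J1 g1" and 2: "profile_equation n J2 g2"
    and x: "x \<in> J1" "x \<in> J2" and y: "y \<in> J1" "y \<in> J2"
    and eq: "g1 x = g2 x" "deriv g1 x = deriv g2 x"
  shows "g1 y = g2 y"
proof -
  define S where "S = closed_segment 0 (y - x)"
  have Sx: "x + s \<in> closed_segment x y" if "s \<in> S" for s
    using that unfolding S_def closed_segment_eq_real_ivl by (auto split: if_splits)
  have "closed_segment x y \<subseteq> J1" "closed_segment x y \<subseteq> J2"
    using 1 2 x y by (auto simp: profile_equation_def is_interval_convex closed_segment_subset)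
  then have S: "x + s \<in> J1" "x + s \<in> J2" if "s \<in> S" for s using Sx[OF that] by auto
  define A where "A s = coef n (x + s) * (1 + (deriv g1 (x + s))\<^sup>2 + deriv g1 (x + s) * deriv g2 (x + s) + (deriv g2 (x + s))\<^sup>2)
      - (deriv g1 (x + s) + deriv g2 (x + s)) * g2 (x + s) / 2" for s
  define B where "B s = - (1 + (deriv g1 (x + s))\<^sup>2) / 2" for s
  have shift: "((\<lambda>s. f (x + s)) has_real_derivative f') (at s within S)"
    if "(f has_real_derivative f') (at (x + s))" for f :: "real \<Rightarrow> real" and f' s
    using that by (simp add: DERIV_shift add.commute DERIV_subset[OF _ subset_UNIV])
  note d1 = shift[OF profile_equationD(1)[OF 1 S(1)]] shift[OF profile_equationD(2)[OF 1 S(1)]]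
  note d2 = shift[OF profile_equationD(1)[OF 2 S(2)]] shift[OF profile_equationD(2)[OF 2 S(2)]]
  have cont: "continuous_on S (\<lambda>s. g1 (x + s))" "continuous_on S (\<lambda>s. g2 (x + s))"
    "continuous_on S (\<lambda>s. deriv g1 (x + s))" "continuous_on S (\<lambda>s. deriv g2 (x + s))"
    using DERIV_continuous_on[OF d1(1)] DERIV_continuous_on[OF d1(2)]
      DERIV_continuous_on[OF d2(1)] DERIV_continuous_on[OF d2(2)] by auto
  have cc: "continuous_on S (\<lambda>s. coef n (x + s))"
    using profile_equationD(4)[OF 1 S(1)] by (intro continuous_on_compose2[OF coef_cont[of "- {0}"]] continuous_intros) auto
  have "compact S" by (simp add: S_def)
  have "continuous_on S A" "continuous_on S B"
    unfolding A_def B_def by (intro continuous_intros cont cc; simp)+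
  then have "bounded (A ` S)" "bounded (B ` S)"
    using \<open>compact S\<close> by (auto intro: compact_imp_bounded compact_continuous_image)
  then obtain MA MB where MA: "\<And>s. s \<in> S \<Longrightarrow> \<bar>A s\<bar> \<le> MA" and MB: "\<And>s. s \<in> S \<Longrightarrow> \<bar>B s\<bar> \<le> MB"
    unfolding bounded_iff by auto
  have MA0: "0 \<le> MA" "0 \<le> MB" using MA[of 0] MB[of 0] by (auto simp: S_def)
  define f where "f s = (g1 (x + s) - g2 (x + s), deriv g1 (x + s) - deriv g2 (x + s))" for s
  define f' where "f' s = (snd (f s), A s * snd (f s) + B s * fst (f s))" for s
  have "(norm (f (y - x)))\<^sup>2 \<le> ((norm (f 0))\<^sup>2 + 0\<^sup>2) * exp ((2 * (1 + MA + MB) + 1) * \<bar>y - x\<bar>)"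
  proof (rule gronwall_squared_sym)
    fix s assume "s \<in> closed_segment 0 (y - x)"
    then have s: "s \<in> S" by (simp add: S_def)
    have "(1 + (deriv g1 (x + s))\<^sup>2) * (coef n (x + s) * deriv g1 (x + s) - g1 (x + s) / 2)
        - (1 + (deriv g2 (x + s))\<^sup>2) * (coef n (x + s) * deriv g2 (x + s) - g2 (x + s) / 2)
        = A s * snd (f s) + B s * fst (f s)"
      unfolding A_def B_def f_def by (simp add: field_simps power2_eq_square)
    then show "(f has_vector_derivative f' s) (at s within closed_segment 0 (y - x))"
      using DERIV_diff[OF d1(1)[OF s] d2(1)[OF s]] DERIV_diff[OF d1(2)[OF s] d2(2)[OF s]]
      unfolding f'_def f_def[abs_def] S_def has_real_derivative_iff_has_vector_derivative
      by (intro has_vector_derivative_Pair) auto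
    have "norm (f' s) \<le> \<bar>snd (f s)\<bar> + \<bar>A s * snd (f s) + B s * fst (f s)\<bar>"
      unfolding f'_def using norm_Pair_le[of "snd (f s)" "A s * snd (f s) + B s * fst (f s)"] by simp
    also have "\<dots> \<le> \<bar>snd (f s)\<bar> + (\<bar>A s\<bar> * \<bar>snd (f s)\<bar> + \<bar>B s\<bar> * \<bar>fst (f s)\<bar>)"
      by (auto simp flip: abs_mult)
    also have "\<dots> \<le> norm (f s) + (MA * norm (f s) + MB * norm (f s))"
      using MA[OF s] MB[OF s] MA0 norm_snd_le[of "snd (f s)" "fst (f s)"] norm_fst_le[of "fst (f s)" "snd (f s)"]
      by (intro add_mono mult_mono) auto
    finally show "norm (f' s) \<le> (1 + MA + MB) * norm (f s) + 0" by (simp add: algebra_simps)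
  qed (use MA0 in auto)
  moreover have "f 0 = 0" by (simp add: f_def eq zero_prod_def)
  ultimately have "f (y - x) = 0" by simp
  then show ?thesis by (simp add: f_def zero_prod_def)
qed

lemma max_solution_eq:
  assumes uniq: "\<And>J1 g1 J2 g2 r. P J1 g1 \<Longrightarrow> P J2 g2 \<Longrightarrow> r \<in> J1 \<Longrightarrow> r \<in> J2 \<Longrightarrow> g1 r = g2 r"
    and "P J g" "r \<in> J"
  shows "max_solution P r = g r"
  unfolding max_solution_def
proof (rule the_equality)
  show "\<exists>J' g'. P J' g' \<and> r \<in> J' \<and> g r = g' r" using assms(2,3) by blast
  fix y assume "\<exists>J' g'. P J' g' \<and> r \<in> J' \<and> y = g' r"
  then obtain J' g' where "P J' g'" "r \<in> J'" "y = g' r" by blast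
  then show "y = g r" using uniq[OF \<open>P J' g'\<close> assms(2) _ assms(3)] by simp
qed

lemma deriv_eq_on_open:
  assumes "open J" "r \<in> J" "\<And>s. s \<in> J \<Longrightarrow> f s = g s"
  shows "deriv f r = deriv g r"
  using eventually_mono[OF eventually_nhds_in_open[OF assms(1,2)] assms(3)] by (intro deriv_cong_ev) auto

lemma profile_ivp_unique:
  assumes "profile_ivp n a C J1 g1" "profile_ivp n a C J2 g2" "r \<in> J1" "r \<in> J2"
  shows "g1 r = g2 r"
  by (rule profile_equation_unique[of n J1 g1 J2 g2 a r]) (use assms in \<open>simp_all add: profile_ivp_def\<close>)

lemma max_solution_profile:
  assumes "profile_ivp n a C J g" "r \<in> J"
  shows "max_solution (profile_ivp n a C) r = g r"
    and "deriv (max_solution (profile_ivp n a C)) r = deriv g r"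
    and "deriv (deriv (max_solution (profile_ivp n a C))) r = deriv (deriv g) r"
proof -
  have J: "open J" using assms by (auto simp: profile_ivp_def profile_equation_def)
  have 1: "max_solution (profile_ivp n a C) s = g s" if "s \<in> J" for s
    by (rule max_solution_eq[where P="profile_ivp n a C", OF _ assms(1) that]) (rule profile_ivp_unique)
  have 2: "deriv (max_solution (profile_ivp n a C)) s = deriv g s" if "s \<in> J" for s
    using J that 1 by (rule deriv_eq_on_open)
  show "max_solution (profile_ivp n a C) r = g r" using 1 assms by simp
  show "deriv (max_solution (profile_ivp n a C)) r = deriv g r" using 2 assms by simp
  show "deriv (deriv (max_solution (profile_ivp n a C))) r = deriv (deriv g) r"
    using J assms(2) 2 by (rule deriv_eq_on_open)
qed

text \<open>Since r' = 1 - q is positive, position can be inverted to a time \<open>\<tau>\<close>,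
  and w composed with \<open>\<tau>\<close> is the graph. The opposite passage, from graph to curve,
  is made in \<open>profile_piece\<close>.\<close>

lemma profile_ivp_of_curve:
  fixes r w q :: "real \<Rightarrow> real"
  assumes "\<alpha> < 0" "0 < \<beta>"
    and r: "\<And>t. t \<in> {\<alpha><..<\<beta>} \<Longrightarrow> (r has_real_derivative 1 - q t) (at t)"
    and w: "\<And>t. t \<in> {\<alpha><..<\<beta>} \<Longrightarrow> (w has_real_derivative q t) (at t)"
    and q: "\<And>t. t \<in> {\<alpha><..<\<beta>} \<Longrightarrow> (q has_real_derivative QQ (q t) * DD n (r t) (w t) (q t)) (at t)"
    and lt: "\<And>t. t \<in> {\<alpha><..<\<beta>} \<Longrightarrow> q t < 1"
    and ne: "\<And>t. t \<in> {\<alpha><..<\<beta>} \<Longrightarrow> r t \<noteq> 0"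
    and "w 0 = 0"
  shows "\<exists>g. profile_ivp n (r 0) (q 0 / (1 - q 0)) (r ` {\<alpha><..<\<beta>}) g \<and>
     (\<forall>t\<in>{\<alpha><..<\<beta>}. g (r t) = w t \<and> deriv g (r t) = q t / (1 - q t))"
proof -
  let ?I = "{\<alpha><..<\<beta>}"
  have mono: "r s < r t" if "s \<in> ?I" "t \<in> ?I" "s < t" for s t
  proof (rule DERIV_pos_imp_increasing[OF \<open>s < t\<close>])
    fix x assume "s \<le> x" "x \<le> t"
    then have "x \<in> ?I" using that by auto
    then show "\<exists>y. (r has_real_derivative y) (at x) \<and> 0 < y" using r lt by force
  qed
  have inj: "inj_on r ?I" by (rule inj_onI) (metis mono less_irrefl linorder_less_linear)
  have cont: "continuous_on ?I r"
    using r by (intro DERIV_continuous_on) (auto intro: has_field_derivative_at_within)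
  define J where "J = r ` ?I"
  have "open J" unfolding J_def using cont inj by (intro invariance_of_domain) auto
  have "is_interval J" unfolding J_def is_interval_connected_1
    using cont by (intro connected_continuous_image) auto
  define \<tau> where "\<tau> = the_inv_into ?I r"
  have \<tau>: "\<tau> (r t) = t" if "t \<in> ?I" for t
    unfolding \<tau>_def using inj that by (rule the_inv_into_f_f)
  have \<tau>_deriv: "(\<tau> has_real_derivative inverse (1 - q t)) (at (r t))" if t: "t \<in> ?I" for t
    unfolding has_field_derivative_def
  proof (rule has_derivative_inverse_strong[where f=r and x=t and S="?I" and f'="(*) (1 - q t)"])
    show "(r has_derivative (*) (1 - q t)) (at t)" using r[OF t] by (simp add: has_field_derivative_def)
    show "(*) (1 - q t) \<circ> (*) (inverse (1 - q t)) = id" using lt[OF t] by (auto simp: fun_eq_iff)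
  qed (use t cont \<tau> in auto)
  define g where "g s = w (\<tau> s)" for s
  have g_deriv: "(g has_real_derivative q t / (1 - q t)) (at (r t))" if t: "t \<in> ?I" for t
    unfolding g_def using DERIV_chain2[of w "q t" \<tau> "r t" "inverse (1 - q t)"] w[OF t] \<tau>_deriv[OF t] \<tau>[OF t]
    by (simp add: divide_inverse)
  have dg: "deriv g (r t) = q t / (1 - q t)" if "t \<in> ?I" for t
    using g_deriv[OF that] by (rule DERIV_imp_deriv)
  have dg_deriv: "(deriv g has_real_derivative QQ (q t) * DD n (r t) (w t) (q t) / (1 - q t) ^ 3) (at (r t))"
    if t: "t \<in> ?I" for t
  proof -
    have "((\<lambda>t. q t / (1 - q t)) has_real_derivative QQ (q t) * DD n (r t) (w t) (q t) / (1 - q t)\<^sup>2) (at t)"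
      using lt[OF t] by (auto intro!: derivative_eq_intros q[OF t] simp: field_simps power2_eq_square)
    then have "((\<lambda>t. q t / (1 - q t)) has_real_derivative QQ (q t) * DD n (r t) (w t) (q t) / (1 - q t)\<^sup>2) (at (\<tau> (r t)))"
      by (simp add: \<tau>[OF t])
    from DERIV_chain2[OF this \<tau>_deriv[OF t]]
    have "((\<lambda>s. q (\<tau> s) / (1 - q (\<tau> s))) has_real_derivative
        QQ (q t) * DD n (r t) (w t) (q t) / (1 - q t)\<^sup>2 * inverse (1 - q t)) (at (r t))" .
    then have "(deriv g has_real_derivative
        QQ (q t) * DD n (r t) (w t) (q t) / (1 - q t)\<^sup>2 * inverse (1 - q t)) (at (r t))"
    proof (rule has_field_derivative_transform_within_open[OF _ \<open>open J\<close>])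
      show "r t \<in> J" using t by (auto simp: J_def)
      show "q (\<tau> s) / (1 - q (\<tau> s)) = deriv g s" if "s \<in> J" for s
        using that dg \<tau> by (auto simp: J_def)
    qed
    then show ?thesis by (simp add: divide_inverse power2_eq_square power3_eq_cube mult_ac)
  qed
  have "profile_equation n J g"
    unfolding profile_equation_def
  proof (intro conjI ballI)
    show "0 \<notin> J" using ne by (auto simp: J_def)
    fix s assume "s \<in> J"
    then obtain t where t: "t \<in> ?I" and s: "s = r t" by (auto simp: J_def)
    show "g differentiable at s" using g_deriv[OF t] s by (auto simp: real_differentiable_def)
    show "deriv g differentiable at s" using dg_deriv[OF t] s by (auto simp: real_differentiable_def)
    have u: "0 < 1 - q t" using lt[OF t] by simp
    have "1 + (q t / (1 - q t))\<^sup>2 = QQ (q t) / (1 - q t)\<^sup>2"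
      using u by (simp add: QQ_eq add_divide_distrib power_divide)
    then have "deriv (deriv g) s / (1 + (deriv g s)\<^sup>2) = DD n (r t) (w t) (q t) / (1 - q t)"
      using u QQ_pos[of "q t"]
      by (simp add: s dg[OF t] DERIV_imp_deriv[OF dg_deriv[OF t]] power2_eq_square power3_eq_cube)
    also have "\<dots> = coef n s * deriv g s - g s / 2"
      using u by (simp add: DD_def s dg[OF t] g_def \<tau>[OF t] field_simps)
    finally show "deriv (deriv g) s / (1 + (deriv g s)\<^sup>2) = coef n s * deriv g s - g s / 2" .
  qed fact+
  moreover have "0 \<in> ?I" using assms by auto
  ultimately have "profile_ivp n (r 0) (q 0 / (1 - q 0)) J g"
    using dg \<tau> \<open>w 0 = 0\<close> by (auto simp: profile_ivp_def g_def J_def)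
  then show ?thesis
    using dg \<tau> by (intro exI[of _ g]) (auto simp: g_def J_def)
qed

text \<open>Differentiability of \<open>f\<close> at the single point is enough because continuity
  of \<open>m\<close> is known beforehand.\<close>

lemma implicit_derivative:
  fixes f :: "real \<times> real \<Rightarrow> real" and m :: "real \<Rightarrow> real"
  assumes f: "(f has_derivative (\<lambda>(\<alpha>, s). A * \<alpha> + B * s)) (at (a, m a))"
    and "B \<noteq> 0" and m: "isCont m a"
    and ev: "\<forall>\<^sub>F x in at a. f (x, m x) = f (a, m a)"
  shows "(m has_real_derivative - A / B) (at a)"
  unfolding has_field_derivative_def has_derivative_at_alt
proof (intro conjI allI impI)
  show "bounded_linear ((*) (- A / B))" by (rule bounded_linear_mult_right)
  fix \<epsilon> :: real assume "\<epsilon> > 0"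
  \<comment> \<open>With \<open>e\<close> at most half of |B|, the terms in \<open>s\<close> can be
    absorbed, giving |s| <= k |\<alpha>|. The second bound in \<open>e\<close> then makes the total
    error at most \<epsilon> |\<alpha>| after division by |B|.\<close>
  define k where "k = 2 * \<bar>A\<bar> / \<bar>B\<bar> + 1"
  have "k \<ge> 1" by (simp add: k_def)
  define e where "e = min (\<bar>B\<bar> / 2) (\<epsilon> * \<bar>B\<bar> / (1 + k))"
  have "e > 0" using \<open>\<epsilon> > 0\<close> \<open>B \<noteq> 0\<close> \<open>k \<ge> 1\<close> by (simp add: e_def)
  obtain d where d: "d > 0" "\<And>y. norm (y - (a, m a)) < d \<Longrightarrow>
      norm (f y - f (a, m a) - (case y - (a, m a) of (\<alpha>, s) \<Rightarrow> A * \<alpha> + B * s)) \<le> e * norm (y - (a, m a))"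
    using f \<open>e > 0\<close> unfolding has_derivative_at_alt by blast
  have "\<forall>\<^sub>F x in at a. dist (m x) (m a) < d / 2"
    using tendstoD[OF m[unfolded isCont_def], of "d / 2"] d(1) by simp
  moreover have "\<forall>\<^sub>F x in at a. dist x a < d / 2"
    using d(1) by (intro tendstoD[OF tendsto_ident_at]) simp
  ultimately have "\<forall>\<^sub>F x in at a. norm (m x - m a - (- A / B) * (x - a)) \<le> \<epsilon> * norm (x - a)"
    using ev
  proof eventually_elim
    case (elim x)
    define \<alpha> where "\<alpha> = x - a"
    define s where "s = m x - m a"
    have n: "norm ((x, m x) - (a, m a)) \<le> \<bar>\<alpha>\<bar> + \<bar>s\<bar>"
      using norm_Pair_le[of \<alpha> s] by (simp add: \<alpha>_def s_def)
    then have "norm ((x, m x) - (a, m a)) < d"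
      using elim by (simp add: \<alpha>_def s_def dist_real_def)
    from d(2)[OF this] elim(3) have "\<bar>A * \<alpha> + B * s\<bar> \<le> e * norm ((x, m x) - (a, m a))"
      by (simp add: \<alpha>_def s_def)
    also have "\<dots> \<le> e * (\<bar>\<alpha>\<bar> + \<bar>s\<bar>)" using n \<open>e > 0\<close> by (intro mult_left_mono) auto
    finally have *: "\<bar>A * \<alpha> + B * s\<bar> \<le> e * (\<bar>\<alpha>\<bar> + \<bar>s\<bar>)" .
    have "\<bar>B\<bar> * \<bar>s\<bar> \<le> \<bar>A * \<alpha> + B * s\<bar> + \<bar>A\<bar> * \<bar>\<alpha>\<bar>" by (simp flip: abs_mult)
    moreover have "e \<le> \<bar>B\<bar> / 2" unfolding e_def by (rule min.cobounded1)
    then have "e * \<bar>s\<bar> \<le> \<bar>B\<bar> / 2 * \<bar>s\<bar>" "e * \<bar>\<alpha>\<bar> \<le> \<bar>B\<bar> / 2 * \<bar>\<alpha>\<bar>"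
      by (intro mult_right_mono; simp)+
    moreover have "\<bar>B\<bar> * (k * \<bar>\<alpha>\<bar>) = 2 * (\<bar>A\<bar> * \<bar>\<alpha>\<bar>) + \<bar>B\<bar> * \<bar>\<alpha>\<bar>"
      using \<open>B \<noteq> 0\<close> by (simp add: k_def field_simps)
    ultimately have "\<bar>B\<bar> * \<bar>s\<bar> \<le> \<bar>B\<bar> * (k * \<bar>\<alpha>\<bar>)"
      using *[unfolded distrib_left] by linarith
    then have "\<bar>s\<bar> \<le> k * \<bar>\<alpha>\<bar>" using \<open>B \<noteq> 0\<close> by simp
    then have "e * (\<bar>\<alpha>\<bar> + \<bar>s\<bar>) \<le> e * ((1 + k) * \<bar>\<alpha>\<bar>)"
      using \<open>e > 0\<close> by (intro mult_left_mono) (auto simp: algebra_simps)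
    also have "\<dots> \<le> (\<epsilon> * \<bar>B\<bar> / (1 + k)) * ((1 + k) * \<bar>\<alpha>\<bar>)"
      using \<open>k \<ge> 1\<close> by (intro mult_right_mono) (auto simp: e_def)
    also have "\<dots> = \<bar>B\<bar> * (\<epsilon> * \<bar>\<alpha>\<bar>)" using \<open>k \<ge> 1\<close> by (simp add: field_simps)
    finally have "\<bar>A * \<alpha> + B * s\<bar> \<le> \<bar>B\<bar> * (\<epsilon> * \<bar>\<alpha>\<bar>)" using * by linarith
    moreover have "A * \<alpha> + B * s = B * (s - (- A / B) * \<alpha>)" using \<open>B \<noteq> 0\<close> by (simp add: field_simps)
    ultimately have "\<bar>B\<bar> * \<bar>s - (- A / B) * \<alpha>\<bar> \<le> \<bar>B\<bar> * (\<epsilon> * \<bar>\<alpha>\<bar>)" by (simp only: abs_mult)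
    then show ?case using \<open>B \<noteq> 0\<close> by (simp add: \<alpha>_def s_def)
  qed
  then obtain \<delta> where "\<delta> > 0" and \<delta>: "\<And>x. x \<noteq> a \<Longrightarrow> dist x a < \<delta> \<Longrightarrow>
      norm (m x - m a - (- A / B) * (x - a)) \<le> \<epsilon> * norm (x - a)"
    unfolding eventually_at by auto
  show "\<exists>\<delta>>0. \<forall>x. norm (x - a) < \<delta> \<longrightarrow> norm (m x - m a - (- A / B) * (x - a)) \<le> \<epsilon> * norm (x - a)"
  proof (intro exI[of _ \<delta>] conjI allI impI)
    fix x assume "norm (x - a) < \<delta>"
    then show "norm (m x - m a - (- A / B) * (x - a)) \<le> \<epsilon> * norm (x - a)"
      using \<delta>[of x] by (cases "x = a") (simp_all add: dist_norm)
  qed fact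
qed

lemma flow_coordinates:
  assumes "(X has_vector_derivative (u, v, z)) (at t within S)"
  shows "((\<lambda>t. fst (X t)) has_real_derivative u) (at t within S)"
    and "((\<lambda>t. fst (snd (X t))) has_real_derivative v) (at t within S)"
    and "((\<lambda>t. snd (snd (X t))) has_real_derivative z) (at t within S)"
  unfolding has_real_derivative_iff_has_vector_derivative
  using bounded_linear.has_vector_derivative[OF bounded_linear_fst assms]
    bounded_linear.has_vector_derivative[OF bounded_linear_fst bounded_linear.has_vector_derivative[OF bounded_linear_snd assms]]
    bounded_linear.has_vector_derivative[OF bounded_linear_snd bounded_linear.has_vector_derivative[OF bounded_linear_snd assms]]
  by simp_all

lemma open_interval_around:
  fixes T b :: real
  assumes "0 \<le> T" "T < b" and f: "continuous_on {-b..b} f" and "open U"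
    and U: "\<And>t. t \<in> {0..T} \<Longrightarrow> f t \<in> U"
  shows "\<exists>d>0. {-d..T+d} \<subseteq> {-b<..<b} \<and> (\<forall>t\<in>{-d..T+d}. f t \<in> U)"
proof -
  have "continuous_on {-b<..<b} f" using f by (rule continuous_on_subset) auto
  then have op: "open (f -` U \<inter> {-b<..<b})"
    using \<open>open U\<close> by (simp add: continuous_on_open_vimage)
  have mem: "0 \<in> f -` U \<inter> {-b<..<b}" "T \<in> f -` U \<inter> {-b<..<b}" using assms by auto
  obtain d1 where d1: "d1 > 0" "cball 0 d1 \<subseteq> f -` U \<inter> {-b<..<b}"
    using op mem(1) open_contains_cball by blast
  obtain d2 where d2: "d2 > 0" "cball T d2 \<subseteq> f -` U \<inter> {-b<..<b}"
    using op mem(2) open_contains_cball by blast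
  have *: "t \<in> f -` U \<inter> {-b<..<b}" if "t \<in> {- min d1 d2..T + min d1 d2}" for t
  proof -
    have "\<bar>t\<bar> \<le> d1 \<or> \<bar>t - T\<bar> \<le> d2 \<or> 0 \<le> t \<and> t \<le> T"
      using that min.cobounded1[of d1 d2] min.cobounded2[of d1 d2] by auto
    then have "t \<in> cball 0 d1 \<or> t \<in> cball T d2 \<or> t \<in> {0..T}"
      by (auto simp: dist_real_def abs_minus_commute)
    then show ?thesis
      using d1(2) d2(2) U assms(1,2) by auto
  qed
  show ?thesis using * d1(1) d2(1) by (intro exI[of _ "min d1 d2"]) auto
qed

section \<open>The truncated flow of the profile system\<close>

locale profile_box =
  fixes n :: nat and lo hi m b :: real
  assumes box: "lo < hi" "0 \<notin> {lo..hi}" "0 < m" "0 \<le> b"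
begin

text \<open>The first factor stays away from r = 0, where the field is singular. Pieces of solutions
  are later placed in boxes with \<open>m\<close> larger than 1, so that the vertical value q = 1 is
  interior.\<close>

definition "B = {lo..hi} \<times> {-m..m} \<times> {-m..m}"

lemma interior_B: "interior B = {lo<..<hi} \<times> {-m<..<m} \<times> {-m<..<m}"
  by (simp add: B_def interior_Times interior_atLeastAtMost_real)

lemma B_fst: "x \<in> B \<Longrightarrow> fst x \<noteq> 0"
  using box by (auto simp: B_def)

sublocale c1_field "pfield n" "\<lambda>x. Blinfun (pfield_lin n x)" B b
proof
  show "compact B" "convex B" unfolding B_def by (auto intro: compact_Times convex_Times)
  show "B \<noteq> {}" using box by (auto simp: B_def)
  show "(pfield n has_derivative blinfun_apply (Blinfun (pfield_lin n x))) (at x within B)" if "x \<in> B" for x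
    using pfield_has_derivative B_fst[OF that] by (simp add: pfield_lin_apply)
  show "continuous_on B (\<lambda>x. Blinfun (pfield_lin n x))" using B_fst by (rule pfield_lin_cont)
qed (use box in auto)

definition "st a \<kappa> = (a, 0::real, \<kappa>::real)"
definition "fr a \<kappa> t = fst (flow (st a \<kappa>) t)"
definition "fw a \<kappa> t = fst (snd (flow (st a \<kappa>) t))"
definition "fq a \<kappa> t = snd (snd (flow (st a \<kappa>) t))"
text \<open>Direction (1, 0, 0) moves the starting point while height 0 and initial slope are kept,
  as in the definition of the linearized function.\<close>

definition "fv a \<kappa> t = vflow (st a \<kappa>) (1, 0, 0) t"
definition "fR a \<kappa> t = fst (fv a \<kappa> t)"
definition "fW a \<kappa> t = fst (snd (fv a \<kappa> t))"
definition "fS a \<kappa> t = snd (snd (fv a \<kappa> t))"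

lemma flow_eq: "flow (st a \<kappa>) t = (fr a \<kappa> t, fw a \<kappa> t, fq a \<kappa> t)"
  by (simp add: fr_def fw_def fq_def)

lemma fv_eq: "fv a \<kappa> t = (fR a \<kappa> t, fW a \<kappa> t, fS a \<kappa> t)"
  by (simp add: fR_def fW_def fS_def)

lemma init_f: "fr a \<kappa> 0 = a" "fw a \<kappa> 0 = 0" "fq a \<kappa> 0 = \<kappa>" "fR a \<kappa> 0 = 1" "fW a \<kappa> 0 = 0" "fS a \<kappa> 0 = 0"
  by (simp_all add: fr_def fw_def fq_def fR_def fW_def fS_def fv_def st_def)

lemma flow_components:
  assumes "S \<subseteq> {-b..b}" "t \<in> S" "flow (st a \<kappa>) t \<in> B"
  shows "(fr a \<kappa> has_real_derivative 1 - fq a \<kappa> t) (at t within S)"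
    and "(fw a \<kappa> has_real_derivative fq a \<kappa> t) (at t within S)"
    and "(fq a \<kappa> has_real_derivative QQ (fq a \<kappa> t) * DD n (fr a \<kappa> t) (fw a \<kappa> t) (fq a \<kappa> t)) (at t within S)"
proof -
  have "(flow (st a \<kappa>) has_vector_derivative pfield n (flow (st a \<kappa>) t)) (at t within S)"
    using assms has_vector_derivative_within_subset[OF flow_deriv[of t "st a \<kappa>"] assms(1)]
    by (auto simp: G_eq)
  moreover have "pfield n (flow (st a \<kappa>) t) = (1 - fq a \<kappa> t, fq a \<kappa> t,
      QQ (fq a \<kappa> t) * DD n (fr a \<kappa> t) (fw a \<kappa> t) (fq a \<kappa> t))"
    unfolding flow_eq by (simp add: pfield_def)
  ultimately have "(flow (st a \<kappa>) has_vector_derivative (1 - fq a \<kappa> t, fq a \<kappa> t,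
      QQ (fq a \<kappa> t) * DD n (fr a \<kappa> t) (fw a \<kappa> t) (fq a \<kappa> t))) (at t within S)"
    by simp
  from flow_coordinates[OF this] show
    "(fr a \<kappa> has_real_derivative 1 - fq a \<kappa> t) (at t within S)"
    "(fw a \<kappa> has_real_derivative fq a \<kappa> t) (at t within S)"
    "(fq a \<kappa> has_real_derivative QQ (fq a \<kappa> t) * DD n (fr a \<kappa> t) (fw a \<kappa> t) (fq a \<kappa> t)) (at t within S)"
    unfolding fr_def[abs_def] fw_def[abs_def] fq_def[abs_def] by auto
qed

lemma vflow_components:
  assumes "S \<subseteq> {-b..b}" "t \<in> S" "flow (st a \<kappa>) t \<in> B"
  shows "(fR a \<kappa> has_real_derivative - fS a \<kappa> t) (at t within S)"
    and "(fW a \<kappa> has_real_derivative fS a \<kappa> t) (at t within S)"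
    and "(fS a \<kappa> has_real_derivative
      (4 * fq a \<kappa> t - 2) * fS a \<kappa> t * DD n (fr a \<kappa> t) (fw a \<kappa> t) (fq a \<kappa> t) +
      QQ (fq a \<kappa> t) * (dcoef n (fr a \<kappa> t) * fR a \<kappa> t * fq a \<kappa> t + coef n (fr a \<kappa> t) * fS a \<kappa> t
        - fW a \<kappa> t * (1 - fq a \<kappa> t) / 2 + fw a \<kappa> t * fS a \<kappa> t / 2)) (at t within S)"
proof -
  have "A (st a \<kappa>) t = Blinfun (pfield_lin n (flow (st a \<kappa>) t))"
    using assms(3) by (simp add: A_def closest_point_self)
  then have A: "blinfun_apply (A (st a \<kappa>) t) = pfield_lin n (flow (st a \<kappa>) t)"
    using B_fst[OF assms(3)] by (simp add: pfield_lin_apply)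
  have "(fv a \<kappa> has_vector_derivative pfield_lin n (flow (st a \<kappa>) t) (fv a \<kappa> t)) (at t within S)"
    unfolding A[symmetric] fv_def[abs_def]
    using assms(1,2) by (intro has_vector_derivative_within_subset[OF vflow_deriv assms(1)]) auto
  then have "(fv a \<kappa> has_vector_derivative (- fS a \<kappa> t, fS a \<kappa> t,
      (4 * fq a \<kappa> t - 2) * fS a \<kappa> t * DD n (fr a \<kappa> t) (fw a \<kappa> t) (fq a \<kappa> t) +
      QQ (fq a \<kappa> t) * (dcoef n (fr a \<kappa> t) * fR a \<kappa> t * fq a \<kappa> t + coef n (fr a \<kappa> t) * fS a \<kappa> t
        - fW a \<kappa> t * (1 - fq a \<kappa> t) / 2 + fw a \<kappa> t * fS a \<kappa> t / 2))) (at t within S)"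
    unfolding flow_eq fv_eq by (simp add: pfield_lin_def)
  from flow_coordinates[OF this] show
    "(fR a \<kappa> has_real_derivative - fS a \<kappa> t) (at t within S)"
    "(fW a \<kappa> has_real_derivative fS a \<kappa> t) (at t within S)"
    "(fS a \<kappa> has_real_derivative
      (4 * fq a \<kappa> t - 2) * fS a \<kappa> t * DD n (fr a \<kappa> t) (fw a \<kappa> t) (fq a \<kappa> t) +
      QQ (fq a \<kappa> t) * (dcoef n (fr a \<kappa> t) * fR a \<kappa> t * fq a \<kappa> t + coef n (fr a \<kappa> t) * fS a \<kappa> t
        - fW a \<kappa> t * (1 - fq a \<kappa> t) / 2 + fw a \<kappa> t * fS a \<kappa> t / 2)) (at t within S)"
    unfolding fR_def[abs_def] fW_def[abs_def] fS_def[abs_def] by auto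
qed

text \<open>Dividing the variation of q by \<open>QQ\<close> gives the variation
  \<open>\<sigma>\<close> of the angle; the terms coming from the derivative of \<open>QQ\<close>
  then cancel.\<close>

lemma trajectory:
  assumes T: "0 \<le> T" "T \<le> b" and B: "\<And>t. t \<in> {0..T} \<Longrightarrow> flow (st a \<kappa>) t \<in> B"
  shows "trajectory n T a \<kappa> (fr a \<kappa>) (fw a \<kappa>) (fq a \<kappa>) (fR a \<kappa>) (\<lambda>t. fS a \<kappa> t / QQ (fq a \<kappa> t))"
proof
  have sub: "{0..T} \<subseteq> {-b..b}" using T box by auto
  \<comment> \<open>Linearization of the conserved quantity r + w - t = a. It eliminates the
    variation of w from the equation for the angle.\<close>
  have RW: "fR a \<kappa> t + fW a \<kappa> t = 1" if t: "t \<in> {0..T}" for t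
  proof -
    have "((\<lambda>t. fR a \<kappa> t + fW a \<kappa> t) has_real_derivative 0) (at s within {0..T})" if "s \<in> {0..T}" for s
      using DERIV_add[OF vflow_components(1,2)[OF sub that B[OF that]]] by simp
    then obtain c where "\<And>s. s \<in> {0..T} \<Longrightarrow> fR a \<kappa> s + fW a \<kappa> s = c"
      using has_field_derivative_zero_constant[of "{0..T}" "\<lambda>t. fR a \<kappa> t + fW a \<kappa> t"] by auto
    then have "fR a \<kappa> 0 + fW a \<kappa> 0 = fR a \<kappa> t + fW a \<kappa> t" using t T by simp
    then show ?thesis by (simp add: init_f)
  qed
  fix t assume t: "t \<in> {0..T}"
  note d = flow_components[OF sub t B[OF t]] vflow_components[OF sub t B[OF t]]
  show "fr a \<kappa> t \<noteq> 0" using B_fst[OF B[OF t]] by (simp add: fr_def)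
  show "(fr a \<kappa> has_real_derivative 1 - fq a \<kappa> t) (at t within {0..T})"
    "(fw a \<kappa> has_real_derivative fq a \<kappa> t) (at t within {0..T})"
    "(fq a \<kappa> has_real_derivative QQ (fq a \<kappa> t) * DD n (fr a \<kappa> t) (fw a \<kappa> t) (fq a \<kappa> t)) (at t within {0..T})"
    by (fact d)+
  have Q: "QQ (fq a \<kappa> t) \<noteq> 0" using QQ_pos[of "fq a \<kappa> t"] by simp
  show "(fR a \<kappa> has_real_derivative - (QQ (fq a \<kappa> t) * (fS a \<kappa> t / QQ (fq a \<kappa> t)))) (at t within {0..T})"
    using d(4) Q by simp
  have dQ: "((\<lambda>t. QQ (fq a \<kappa> t)) has_real_derivative (4 * fq a \<kappa> t - 2) *
      (QQ (fq a \<kappa> t) * DD n (fr a \<kappa> t) (fw a \<kappa> t) (fq a \<kappa> t))) (at t within {0..T})"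
    using DERIV_chain2[OF QQ_deriv d(3)] .
  have W: "fW a \<kappa> t = 1 - fR a \<kappa> t" using RW[OF t] by simp
  have alg: "(((4 * q - 2) * S * D + Q * (c' * R * q + c * S - (1 - R) * (1 - q) / 2 + w * S / 2)) * Q -
      S * ((4 * q - 2) * (Q * D))) / (Q * Q) = c' * R * q + (c + w / 2) * Q * (S / Q) - (1 - R) * (1 - q) / 2"
    if "Q \<noteq> 0" for q S D Q c' R c w :: real
    using that by (simp add: field_simps)
  show "((\<lambda>t. fS a \<kappa> t / QQ (fq a \<kappa> t)) has_real_derivative
      dcoef n (fr a \<kappa> t) * fR a \<kappa> t * fq a \<kappa> t +
      (coef n (fr a \<kappa> t) + fw a \<kappa> t / 2) * QQ (fq a \<kappa> t) * (fS a \<kappa> t / QQ (fq a \<kappa> t)) -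
      (1 - fR a \<kappa> t) * (1 - fq a \<kappa> t) / 2) (at t within {0..T})"
    using DERIV_divide[OF d(6) dQ Q] unfolding W alg[OF Q] .
qed (use T in \<open>simp_all add: init_f\<close>)

lemma angle_fun_curve:
  assumes d: "0 < d" "0 \<le> T" "{-d..T+d} \<subseteq> {-b<..<b}"
    and inB: "\<And>t. t \<in> {-d..T+d} \<Longrightarrow> flow (st a \<kappa>) t \<in> B \<and> fq a \<kappa> t < 1"
  shows "\<exists>g. profile_ivp n a (\<kappa> / (1 - \<kappa>)) (fr a \<kappa> ` {-d<..<T+d}) g \<and>
     (\<forall>t\<in>{-d<..<T+d}. g (fr a \<kappa> t) = fw a \<kappa> t \<and> deriv g (fr a \<kappa> t) = fq a \<kappa> t / (1 - fq a \<kappa> t))"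
proof -
  have "{-d<..<T+d} \<subseteq> {-d..T+d}" by auto
  also note d(3)
  also have "{-b<..<b} \<subseteq> {-b..b}" by auto
  finally have sub: "{-d<..<T+d} \<subseteq> {-b..b}" .
  have at: "at t within {-d<..<T+d} = at t" if "t \<in> {-d<..<T+d}" for t
    using that by (intro at_within_open) auto
  have "\<exists>g. profile_ivp n (fr a \<kappa> 0) (fq a \<kappa> 0 / (1 - fq a \<kappa> 0)) (fr a \<kappa> ` {-d<..<T+d}) g \<and>
     (\<forall>t\<in>{-d<..<T+d}. g (fr a \<kappa> t) = fw a \<kappa> t \<and> deriv g (fr a \<kappa> t) = fq a \<kappa> t / (1 - fq a \<kappa> t))"
  proof (rule profile_ivp_of_curve)
    fix t assume t: "t \<in> {-d<..<T+d}"
    then have "t \<in> {-d..T+d}" by auto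
    from inB[OF this] have inB: "flow (st a \<kappa>) t \<in> B" "fq a \<kappa> t < 1" by auto
    note D = flow_components[OF sub t inB(1), unfolded at[OF t]]
    show "(fr a \<kappa> has_real_derivative 1 - fq a \<kappa> t) (at t)" by (rule D(1))
    show "(fw a \<kappa> has_real_derivative fq a \<kappa> t) (at t)" by (rule D(2))
    show "(fq a \<kappa> has_real_derivative QQ (fq a \<kappa> t) * DD n (fr a \<kappa> t) (fw a \<kappa> t) (fq a \<kappa> t)) (at t)"
      by (rule D(3))
    show "fq a \<kappa> t < 1" by fact
    show "fr a \<kappa> t \<noteq> 0" using B_fst[OF inB(1)] by (simp add: fr_def)
  qed (use d in \<open>simp_all add: init_f\<close>)
  then show ?thesis by (simp add: init_f)
qed

end

section \<open>The linearized function along the flow\<close>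

context c1_field
begin

text \<open>The remainder splits into the one in the initial value, which is uniform in time, the
  change of \<open>vflow\<close> between the two times, and the remainder in time along the
  unperturbed curve. Joint differentiability is required because the crossing time over a fixed
  \<open>r\<close> depends on the starting point.\<close>

lemma flow_joint_derivative:
  assumes sub: "{\<alpha>..\<beta>} \<subseteq> {-b..b}" and "\<alpha> \<le> 0" "0 \<le> \<beta>" and T: "\<alpha> < T" "T < \<beta>"
    and inK: "\<And>t. t \<in> {\<alpha>..\<beta>} \<Longrightarrow> flow x t \<in> interior K"
  shows "((\<lambda>p. flow (x + fst p *\<^sub>R v) (snd p)) has_derivative
      (\<lambda>p. fst p *\<^sub>R vflow x v T + snd p *\<^sub>R G (flow x T))) (at (0, T))"
  unfolding has_derivative_at_alt
proof (intro conjI allI impI)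
  show "bounded_linear (\<lambda>p. fst p *\<^sub>R vflow x v T + snd p *\<^sub>R G (flow x T))"
    by (intro bounded_linear_intros)
  fix e :: real assume "e > 0"
  then have e3: "e / 3 > 0" by simp
  have Tb: "T \<in> {-b..b}" and Ti: "T \<in> {\<alpha>..\<beta>}" using T sub by auto
  have at: "at T within {-b..b} = at T"
  proof (rule at_within_interior)
    have "T \<in> interior {\<alpha>..\<beta>}" using T by simp
    then show "T \<in> interior {-b..b}" using interior_mono[OF sub] by blast
  qed
  obtain d1 where d1: "d1 > 0" "\<And>s t. \<bar>s\<bar> < d1 \<Longrightarrow> t \<in> {\<alpha>..\<beta>} \<Longrightarrow>
      norm (flow (x + s *\<^sub>R v) t - flow x t - s *\<^sub>R vflow x v t) \<le> e / 3 * \<bar>s\<bar>"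
    using flow_deriv_initial[OF sub assms(2,3) inK e3] by blast
  have "isCont (vflow x v) T"
    using vflow_cont Tb at by (metis continuous_on_eq_continuous_within)
  then obtain d2 where d2: "d2 > 0" "\<And>t. \<bar>t - T\<bar> < d2 \<Longrightarrow> norm (vflow x v t - vflow x v T) \<le> e / 3"
    using e3 unfolding continuous_at_eps_delta dist_norm real_norm_def by (meson less_imp_le)
  have "(flow x has_derivative (\<lambda>h. h *\<^sub>R G (flow x T))) (at T)"
    using flow_deriv[OF Tb] unfolding at has_vector_derivative_def .
  then obtain d3 where d3: "d3 > 0" "\<And>t. \<bar>t - T\<bar> < d3 \<Longrightarrow>
      norm (flow x t - flow x T - (t - T) *\<^sub>R G (flow x T)) \<le> e / 3 * \<bar>t - T\<bar>"
    using e3 unfolding has_derivative_at_alt real_norm_def by blast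
  define d where "d = min (min d1 d2) (min d3 (min (T - \<alpha>) (\<beta> - T)))"
  have "d > 0" using d1 d2 d3 T by (simp add: d_def)
  show "\<exists>d>0. \<forall>p. norm (p - (0, T)) < d \<longrightarrow>
      norm (flow (x + fst p *\<^sub>R v) (snd p) - flow (x + fst (0, T) *\<^sub>R v) (snd (0, T)) -
        (fst (p - (0, T)) *\<^sub>R vflow x v T + snd (p - (0, T)) *\<^sub>R G (flow x T))) \<le> e * norm (p - (0, T))"
  proof (intro exI[of _ d] conjI allI impI)
    fix p :: "real \<times> real" assume p: "norm (p - (0, T)) < d"
    obtain s t where st: "p = (s, t)" by (cases p)
    have ns: "\<bar>s\<bar> \<le> norm (p - (0, T))" and nt: "\<bar>t - T\<bar> \<le> norm (p - (0, T))"
      using norm_fst_le[of s "t - T"] norm_snd_le[of "t - T" s] by (simp_all add: st)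
    have s: "\<bar>s\<bar> < d1" and t: "\<bar>t - T\<bar> < d2" "\<bar>t - T\<bar> < d3" "t \<in> {\<alpha>..\<beta>}"
      using ns nt p by (auto simp: d_def)
    have "flow (x + s *\<^sub>R v) t - flow x T - (s *\<^sub>R vflow x v T + (t - T) *\<^sub>R G (flow x T)) =
        (flow (x + s *\<^sub>R v) t - flow x t - s *\<^sub>R vflow x v t) +
        s *\<^sub>R (vflow x v t - vflow x v T) +
        (flow x t - flow x T - (t - T) *\<^sub>R G (flow x T))"
      by (simp add: algebra_simps)
    also have "norm \<dots> \<le> e / 3 * \<bar>s\<bar> + \<bar>s\<bar> * (e / 3) + e / 3 * \<bar>t - T\<bar>"
    proof (intro norm_triangle_le add_mono)
      show "norm (s *\<^sub>R (vflow x v t - vflow x v T)) \<le> \<bar>s\<bar> * (e / 3)"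
        using mult_left_mono[OF d2(2)[OF t(1)], of "\<bar>s\<bar>"] by simp
    qed (use d1(2)[OF s t(3)] d3(2)[OF t(2)] in auto)
    also have "\<dots> \<le> e / 3 * norm (p - (0, T)) + e / 3 * norm (p - (0, T)) + e / 3 * norm (p - (0, T))"
      using ns nt e3 by (intro add_mono; simp add: mult_left_mono mult.commute)
    finally show "norm (flow (x + fst p *\<^sub>R v) (snd p) - flow (x + fst (0, T) *\<^sub>R v) (snd (0, T)) -
        (fst (p - (0, T)) *\<^sub>R vflow x v T + snd (p - (0, T)) *\<^sub>R G (flow x T))) \<le> e * norm (p - (0, T))"
      by (simp add: st)
  qed fact
qed

lemma flow_stays:
  assumes Y: "(Y \<longlongrightarrow> x) Fl" and S: "compact S" "S \<subseteq> {-b..b}" and "open U"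
    and U: "\<And>t. t \<in> S \<Longrightarrow> flow x t \<in> U"
  shows "\<forall>\<^sub>F i in Fl. \<forall>t\<in>S. flow (Y i) t \<in> U"
proof -
  have "compact (flow x ` S)"
    using S continuous_on_subset[OF flow_cont S(2)] by (intro compact_continuous_image) auto
  then obtain e where e: "e > 0" "(\<Union>y\<in>flow x ` S. ball y e) \<subseteq> U"
    using compact_subset_open_imp_ball_epsilon_subset[of "flow x ` S" U] \<open>open U\<close> U by blast
  have M0: "M > 0" using M_ge1 by simp
  then have "e / M > 0" using e(1) by simp
  from tendstoD[OF Y this] show ?thesis
  proof eventually_elim
    case (elim i)
    show ?case
    proof
      fix t assume t: "t \<in> S"
      have "norm (flow (Y i) t - flow x t) \<le> M * norm (Y i - x)"
        using t S by (intro flow_lipschitz) auto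
      also have "\<dots> < e" using elim M0 by (simp add: field_simps dist_norm)
      finally have "flow (Y i) t \<in> ball (flow x t) e" by (simp add: dist_norm norm_minus_commute)
      then show "flow (Y i) t \<in> U" using e(2) t by blast
    qed
  qed
qed

end

lemma angle_derivative:
  "q < 1 \<Longrightarrow> ((\<lambda>q. arctan (q / (1 - q))) has_real_derivative 1 / QQ q) (at q)"
proof -
  assume q: "q < 1"
  have "1 + (q / (1 - q))\<^sup>2 = QQ q / (1 - q)\<^sup>2"
    using q by (simp add: QQ_eq add_divide_distrib power_divide)
  moreover have "((\<lambda>q. q / (1 - q)) has_real_derivative 1 / (1 - q)\<^sup>2) (at q)"
    using q by (auto intro!: derivative_eq_intros simp: power2_eq_square)
  from DERIV_chain2[OF DERIV_arctan this]
  have "((\<lambda>q. arctan (q / (1 - q))) has_real_derivative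
      inverse (1 + (q / (1 - q))\<^sup>2) * (1 / (1 - q)\<^sup>2)) (at q)" .
  moreover have "inverse (QQ q / (1 - q)\<^sup>2) * (1 / (1 - q)\<^sup>2) = 1 / QQ q"
    using q QQ_pos[of q] by simp
  ultimately show ?thesis by simp
qed

context profile_box
begin

lemma fr_strict_mono:
  assumes sub: "{\<alpha>..\<beta>} \<subseteq> {-b..b}"
    and inB: "\<And>t. t \<in> {\<alpha>..\<beta>} \<Longrightarrow> flow (st a \<kappa>) t \<in> B \<and> fq a \<kappa> t < 1"
  shows "strict_mono_on {\<alpha>..\<beta>} (fr a \<kappa>)"
proof (rule strict_mono_onI)
  fix s t assume st: "s \<in> {\<alpha>..\<beta>}" "t \<in> {\<alpha>..\<beta>}" "s < t"
  show "fr a \<kappa> s < fr a \<kappa> t"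
  proof (rule DERIV_pos_imp_increasing_open[OF \<open>s < t\<close>])
    fix x assume x: "s < x" "x < t"
    then have xI: "x \<in> {\<alpha>..\<beta>}" using st by auto
    have at: "at x within {\<alpha>..\<beta>} = at x" using x st by (intro at_within_Icc_at) auto
    have "flow (st a \<kappa>) x \<in> B" "0 < 1 - fq a \<kappa> x" using inB[OF xI] by auto
    with flow_components(1)[OF sub xI this(1), unfolded at]
    show "\<exists>y. (fr a \<kappa> has_real_derivative y) (at x) \<and> 0 < y" by blast
  next
    have "continuous_on {\<alpha>..\<beta>} (fr a \<kappa>)"
      unfolding fr_def[abs_def] by (intro continuous_on_fst continuous_on_subset[OF flow_cont sub])
    then show "continuous_on {s..t} (fr a \<kappa>)" using st by (elim continuous_on_subset) auto
  qed
qed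

text \<open>The intermediate value theorem on [T - \<epsilon>, T + \<epsilon>] yields a time at
  which the nearby curve is over the position of the limit curve at \<open>T\<close>; monotonicity
  makes it unique, so one choice of \<open>\<tau>\<close> serves all \<epsilon>. The filter is
  arbitrary: the lemma is applied to moving starting points and to slopes tending to
  infinity.\<close>

lemma crossing_time:
  assumes Y: "(Y \<longlongrightarrow> x) Fl" and d: "0 < d" and sub: "{T-d..T+d} \<subseteq> {-b..b}"
    and mono: "strict_mono_on {T-d..T+d} (\<lambda>t. fst (flow x t))"
    and ev_mono: "\<forall>\<^sub>F i in Fl. strict_mono_on {T-d..T+d} (\<lambda>t. fst (flow (Y i) t))"
  obtains \<tau> where "(\<tau> \<longlongrightarrow> T) Fl"
    "\<forall>\<^sub>F i in Fl. \<tau> i \<in> {T-d<..<T+d} \<and> fst (flow (Y i) (\<tau> i)) = fst (flow x T)"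
proof -
  define r where "r = fst (flow x T)"
  define \<tau> where "\<tau> i = (SOME t. t \<in> {T-d<..<T+d} \<and> fst (flow (Y i) t) = r)" for i
  have near: "\<forall>\<^sub>F i in Fl. \<bar>\<tau> i - T\<bar> \<le> \<epsilon> \<and> \<tau> i \<in> {T-d<..<T+d} \<and> fst (flow (Y i) (\<tau> i)) = r"
    if \<epsilon>: "0 < \<epsilon>" "\<epsilon> < d" for \<epsilon>
  proof -
    have I: "T - \<epsilon> \<in> {T-d..T+d}" "T + \<epsilon> \<in> {T-d..T+d}" "T \<in> {T-d..T+d}" using \<epsilon> by auto
    have lim: "((\<lambda>i. fst (flow (Y i) t)) \<longlongrightarrow> fst (flow x t)) Fl" if "t \<in> {T-d..T+d}" for t
    proof (intro tendsto_fst tendsto_flow Y tendsto_const)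
      show "t \<in> {-b..b}" using that sub by blast
      then show "\<forall>\<^sub>F i in Fl. t \<in> {-b..b}" by simp
    qed
    have "fst (flow x (T - \<epsilon>)) < r" "r < fst (flow x (T + \<epsilon>))"
      using strict_mono_onD[OF mono I(1) I(3)] strict_mono_onD[OF mono I(3) I(2)] \<epsilon> by (auto simp: r_def)
    then have "\<forall>\<^sub>F i in Fl. fst (flow (Y i) (T - \<epsilon>)) < r" "\<forall>\<^sub>F i in Fl. r < fst (flow (Y i) (T + \<epsilon>))"
      using order_tendstoD(2)[OF lim[OF I(1)]] order_tendstoD(1)[OF lim[OF I(2)]] by auto
    with ev_mono show ?thesis
    proof eventually_elim
      case (elim i)
      have "{T - \<epsilon>..T + \<epsilon>} \<subseteq> {T-d..T+d}" using \<epsilon> by auto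
      then have "continuous_on {T - \<epsilon>..T + \<epsilon>} (\<lambda>t. fst (flow (Y i) t))"
        using sub by (intro continuous_on_fst continuous_on_subset[OF flow_cont]) auto
      from IVT'[of "\<lambda>t. fst (flow (Y i) t)" "T - \<epsilon>" r "T + \<epsilon>", OF _ _ _ this] elim(2,3) \<epsilon>
      obtain t where t: "T - \<epsilon> \<le> t" "t \<le> T + \<epsilon>" "fst (flow (Y i) t) = r" by auto
      then have tI: "t \<in> {T-d<..<T+d}" using \<epsilon> by auto
      have \<tau>: "\<tau> i \<in> {T-d<..<T+d} \<and> fst (flow (Y i) (\<tau> i)) = r"
        unfolding \<tau>_def by (rule someI[of _ t]) (use t tI in auto)
      have "\<tau> i = t"
      proof (rule strict_mono_on_eqD[OF elim(1)])
        show "fst (flow (Y i) t) = fst (flow (Y i) (\<tau> i))" using t(3) \<tau> by simp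
      qed (use \<tau> tI in auto)
      then show ?case using t tI by auto
    qed
  qed
  have "(\<tau> \<longlongrightarrow> T) Fl"
  proof (rule tendstoI)
    fix \<epsilon> :: real assume "\<epsilon> > 0"
    then have "\<forall>\<^sub>F i in Fl. \<bar>\<tau> i - T\<bar> \<le> min (\<epsilon> / 2) (d / 2) \<and> \<tau> i \<in> {T-d<..<T+d} \<and> fst (flow (Y i) (\<tau> i)) = r"
      using d by (intro near) auto
    then show "\<forall>\<^sub>F i in Fl. dist (\<tau> i) T < \<epsilon>"
      by eventually_elim (use \<open>\<epsilon> > 0\<close> in \<open>auto simp: dist_real_def\<close>)
  qed
  moreover have "\<forall>\<^sub>F i in Fl. \<tau> i \<in> {T-d<..<T+d} \<and> fst (flow (Y i) (\<tau> i)) = fst (flow x T)"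
    using near[of "d / 2"] d unfolding r_def by (auto elim: eventually_mono)
  ultimately show thesis by (rule that)
qed

lemma tendsto_st: "((\<lambda>i. st (f i) (g i)) \<longlongrightarrow> st a \<kappa>) Fl" if "(f \<longlongrightarrow> a) Fl" "(g \<longlongrightarrow> \<kappa>) Fl"
  unfolding st_def by (intro tendsto_Pair tendsto_const that)

text \<open>At fixed \<open>r\<close> the crossing time varies with the starting point at rate - R /
  (1 - q), by implicit differentiation, and the angle varies in time at rate \<open>DD\<close>.
  Their product is the correction to the variation of the angle at fixed time.\<close>

lemma linearized_formula:
  assumes T: "0 \<le> T" "T < b" and "\<kappa> < 1"
    and inB: "\<And>t. t \<in> {0..T} \<Longrightarrow> flow (st a \<kappa>) t \<in> interior B \<and> fq a \<kappa> t < 1"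
  shows "linearized n a (\<kappa> / (1 - \<kappa>)) (fr a \<kappa> T) =
    fS a \<kappa> T / QQ (fq a \<kappa> T) - fR a \<kappa> T * DD n (fr a \<kappa> T) (fw a \<kappa> T) (fq a \<kappa> T) / (1 - fq a \<kappa> T)"
proof -
  define C where "C = \<kappa> / (1 - \<kappa>)"
  define U where "U = interior B \<inter> {x. snd (snd x) < 1}"
  have "open U"
    unfolding U_def by (intro open_Int open_interior open_Collect_less continuous_intros)
  have "flow (st a \<kappa>) t \<in> U" if "t \<in> {0..T}" for t
    using inB[OF that] by (auto simp: U_def fq_def)
  from open_interval_around[OF T flow_cont \<open>open U\<close> this]
  obtain d where d: "d > 0" "{-d..T+d} \<subseteq> {-b<..<b}" "\<And>t. t \<in> {-d..T+d} \<Longrightarrow> flow (st a \<kappa>) t \<in> U"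
    by blast
  have sub: "{-d..T+d} \<subseteq> {-b..b}" using d(2) by (rule subset_trans) auto
  have lim: "((\<lambda>a'. st a' \<kappa>) \<longlongrightarrow> st a \<kappa>) (at a)" by (intro tendsto_st tendsto_intros)
  have U: "flow (st a' \<kappa>) t \<in> B \<and> fq a' \<kappa> t < 1" if "flow (st a' \<kappa>) t \<in> U" for a' t
    using that interior_subset by (auto simp: U_def fq_def)
  have near: "\<forall>\<^sub>F a' in at a. \<forall>t\<in>{-d..T+d}. flow (st a' \<kappa>) t \<in> U"
    using lim _ sub \<open>open U\<close> d(3) by (rule flow_stays) simp
  have angle: "angle_fun n a' C (fr a' \<kappa> t) = arctan (fq a' \<kappa> t / (1 - fq a' \<kappa> t))"
    if a': "\<forall>t\<in>{-d..T+d}. flow (st a' \<kappa>) t \<in> U" and t: "t \<in> {-d<..<T+d}" for a' t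
  proof -
    obtain g where g: "profile_ivp n a' C (fr a' \<kappa> ` {-d<..<T+d}) g"
      "deriv g (fr a' \<kappa> t) = fq a' \<kappa> t / (1 - fq a' \<kappa> t)"
      using angle_fun_curve[OF d(1) T(1) d(2) U[OF bspec[OF a']]] t unfolding C_def by blast
    show ?thesis
      unfolding angle_fun_def using max_solution_profile(2)[OF g(1)] g(2) t by simp
  qed
  have subT: "{T-d..T+d} \<subseteq> {-d..T+d}" using T by auto
  have mono: "strict_mono_on {T-d..T+d} (\<lambda>t. fst (flow (st a' \<kappa>) t))"
    if a': "\<forall>t\<in>{-d..T+d}. flow (st a' \<kappa>) t \<in> U" for a'
    using fr_strict_mono[of "T-d" "T+d" a' \<kappa>] U[OF bspec[OF a']] subT sub unfolding fr_def by blast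
  obtain m0 where m0: "(m0 \<longlongrightarrow> T) (at a)"
    "\<forall>\<^sub>F a' in at a. m0 a' \<in> {T-d<..<T+d} \<and> fst (flow (st a' \<kappa>) (m0 a')) = fst (flow (st a \<kappa>) T)"
  proof (rule crossing_time[OF lim d(1)])
    show "\<forall>\<^sub>F a' in at a. strict_mono_on {T-d..T+d} (\<lambda>t. fst (flow (st a' \<kappa>) t))"
      using near mono by (rule eventually_mono)
  qed (use subT sub mono d(3) in auto)
  define r where "r = fr a \<kappa> T"
  \<comment> \<open>\<open>crossing_time\<close> only describes a punctured neighbourhood of
    \<open>a\<close>; setting the value there makes \<open>m\<close> continuous at
    \<open>a\<close>.\<close>
  define m where "m = m0(a := T)"
  have m_a: "m a = T" by (simp add: m_def)
  have off: "\<forall>\<^sub>F a' in at a. m0 a' = m a'"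
    unfolding eventually_at_filter by (simp add: m_def)
  have m_cont: "isCont m a"
    unfolding isCont_def m_a using m0(1) off by (rule Lim_transform_eventually)
  have m_ev: "\<forall>\<^sub>F a' in at a. m a' \<in> {-d<..<T+d} \<and> fr a' \<kappa> (m a') = r"
    using m0(2) off by eventually_elim (use T in \<open>auto simp: fr_def r_def\<close>)
  have xK: "flow (st a \<kappa>) T \<in> B" and q1: "fq a \<kappa> T < 1" using inB[of T] T interior_subset by auto
  have "((\<lambda>p. flow (st a \<kappa> + fst p *\<^sub>R (1, 0, 0)) (snd p)) has_derivative
      (\<lambda>p. fst p *\<^sub>R vflow (st a \<kappa>) (1, 0, 0) T + snd p *\<^sub>R G (flow (st a \<kappa>) T))) (at (0, T))"
  proof (rule flow_joint_derivative[OF sub])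
    show "flow (st a \<kappa>) t \<in> interior B" if "t \<in> {-d..T+d}" for t using d(3)[OF that] by (simp add: U_def)
  qed (use d(1) T in auto)
  then have "((\<lambda>p. flow (st a \<kappa> + fst p *\<^sub>R (1, 0, 0)) (snd p)) has_derivative
      (\<lambda>p. fst p *\<^sub>R fv a \<kappa> T + snd p *\<^sub>R pfield n (flow (st a \<kappa>) T))) (at ((a, T) - (a, 0)))"
    using xK by (simp add: fv_def G_eq)
  moreover have "((\<lambda>p. p - (a, 0)) has_derivative (\<lambda>p. p)) (at (a, T))"
    using has_derivative_diff[OF has_derivative_ident has_derivative_const[of "(a, 0::real)"]] by simp
  ultimately have "((\<lambda>p. flow (st a \<kappa> + fst (p - (a, 0)) *\<^sub>R (1, 0, 0)) (snd (p - (a, 0)))) has_derivative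
      (\<lambda>p. fst p *\<^sub>R fv a \<kappa> T + snd p *\<^sub>R pfield n (flow (st a \<kappa>) T))) (at (a, T))"
    by (rule has_derivative_compose[rotated])
  then have joint: "((\<lambda>p. flow (st (fst p) \<kappa>) (snd p)) has_derivative
      (\<lambda>p. fst p *\<^sub>R fv a \<kappa> T + snd p *\<^sub>R pfield n (flow (st a \<kappa>) T))) (at (a, T))"
    by (simp add: st_def)
  let ?D = "DD n (fr a \<kappa> T) (fw a \<kappa> T) (fq a \<kappa> T)"
  have pf: "pfield n (flow (st a \<kappa>) T) = (1 - fq a \<kappa> T, fq a \<kappa> T, QQ (fq a \<kappa> T) * ?D)"
    unfolding flow_eq by (simp add: pfield_def)
  have jr: "((\<lambda>p. fr (fst p) \<kappa> (snd p)) has_derivative (\<lambda>(\<alpha>, s). fR a \<kappa> T * \<alpha> + (1 - fq a \<kappa> T) * s)) (at (a, m a))"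
    using has_derivative_fst[OF joint]
    unfolding pf fv_eq m_a fr_def[symmetric] by (simp add: case_prod_unfold mult.commute)
  have jq: "((\<lambda>p. fq (fst p) \<kappa> (snd p)) has_derivative
      (\<lambda>(\<alpha>, s). fS a \<kappa> T * \<alpha> + QQ (fq a \<kappa> T) * ?D * s)) (at (a, m a))"
    using has_derivative_snd[OF has_derivative_snd[OF joint]]
    unfolding pf fv_eq m_a fq_def[symmetric] by (simp add: case_prod_unfold mult.commute)
  have "\<forall>\<^sub>F a' in at a. fr a' \<kappa> (m a') = r" using m_ev by (rule eventually_mono) simp
  then have "(m has_real_derivative - fR a \<kappa> T / (1 - fq a \<kappa> T)) (at a)"
    using m_cont q1 by (intro implicit_derivative[where m=m and a=a and f="\<lambda>p. fr (fst p) \<kappa> (snd p)", OF jr])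
      (auto simp: m_a r_def)
  then have "((\<lambda>a'. (a', m a')) has_derivative (\<lambda>h. (h, (- fR a \<kappa> T / (1 - fq a \<kappa> T)) * h))) (at a)"
    unfolding has_field_derivative_def by (intro has_derivative_Pair has_derivative_ident)
  from has_derivative_compose[OF this jq]
  have "((\<lambda>a'. fq a' \<kappa> (m a')) has_real_derivative
      fS a \<kappa> T + QQ (fq a \<kappa> T) * ?D * (- fR a \<kappa> T / (1 - fq a \<kappa> T))) (at a)"
    by (intro has_derivative_imp_has_field_derivative[where D="\<lambda>h. fS a \<kappa> T * h +
        QQ (fq a \<kappa> T) * ?D * ((- fR a \<kappa> T / (1 - fq a \<kappa> T)) * h)"]) (simp_all add: algebra_simps)
  from DERIV_chain2[where f="\<lambda>q. arctan (q / (1 - q))", OF _ this, of "1 / QQ (fq a \<kappa> T)"]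
  have der: "((\<lambda>a'. arctan (fq a' \<kappa> (m a') / (1 - fq a' \<kappa> (m a')))) has_real_derivative
      1 / QQ (fq a \<kappa> T) * (fS a \<kappa> T + QQ (fq a \<kappa> T) * ?D * (- fR a \<kappa> T / (1 - fq a \<kappa> T)))) (at a)"
    using angle_derivative[OF q1] by (simp add: m_a)
  have "\<forall>\<^sub>F a' in at a. angle_fun n a' C r = arctan (fq a' \<kappa> (m a') / (1 - fq a' \<kappa> (m a')))"
    using near m_ev
  proof eventually_elim
    case (elim a')
    then show ?case using angle[OF elim(1), of "m a'"] by auto
  qed
  moreover have "angle_fun n a C r = arctan (fq a \<kappa> (m a) / (1 - fq a \<kappa> (m a)))"
    using angle[of a T] d(1,3) T by (simp add: m_a r_def)
  ultimately have "\<forall>\<^sub>F a' in nhds a. angle_fun n a' C r = arctan (fq a' \<kappa> (m a') / (1 - fq a' \<kappa> (m a')))"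
    by (simp add: eventually_nhds_conv_at)
  then have "((\<lambda>a'. angle_fun n a' C r) has_real_derivative
      1 / QQ (fq a \<kappa> T) * (fS a \<kappa> T + QQ (fq a \<kappa> T) * ?D * (- fR a \<kappa> T / (1 - fq a \<kappa> T)))) (at a)"
    using der by (simp only: DERIV_cong_ev[OF refl _ refl])
  then have "linearized n a C r = 1 / QQ (fq a \<kappa> T) * (fS a \<kappa> T + QQ (fq a \<kappa> T) * ?D * (- fR a \<kappa> T / (1 - fq a \<kappa> T)))"
    unfolding linearized_def by (rule DERIV_imp_deriv)
  also have "\<dots> = fS a \<kappa> T / QQ (fq a \<kappa> T) - fR a \<kappa> T * ?D / (1 - fq a \<kappa> T)"
    using QQ_pos[of "fq a \<kappa> T"] by (simp add: field_simps)
  finally show ?thesis by (simp add: C_def r_def)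
qed

end

section \<open>The sign of eta along the flow\<close>

lemma eta_alt:
  "eta n a g r = (1 + (deriv g r)\<^sup>2) * dcoef n r + 2 * (coef n r - coef n a) * deriv g r * deriv (deriv g) r"
  unfolding eta_def dcoef_def by (simp only: add.commute)

text \<open>The fourth power clears the second summand: two factors 1 - q from 1 + p^2, one from p
  and one from c p - w / 2.\<close>

lemma eta_identity:
  fixes c c0 d w q :: real
  assumes "q < 1"
  defines "p \<equiv> q / (1 - q)"
  shows "(1 - q) ^ 4 * ((1 + p\<^sup>2) * d + 2 * (c - c0) * p * ((1 + p\<^sup>2) * (c * p - w / 2))) =
    QQ q * d * (1 - q)\<^sup>2 + 2 * (c - c0) * q * QQ q * (c * q - w * (1 - q) / 2)"
proof -
  define u where "u = 1 - q"
  have u: "u > 0" using assms by (simp add: u_def)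
  have p: "p = q / u" by (simp add: p_def u_def)
  have "1 + p\<^sup>2 = QQ q / u\<^sup>2"
    using u by (simp add: p QQ_eq u_def[symmetric] add_divide_distrib power_divide)
  moreover have "c * p - w / 2 = (c * q - w * u / 2) / u" using u by (simp add: p field_simps)
  ultimately show ?thesis
    using u unfolding u_def[symmetric] p by (simp add: field_simps power2_eq_square power4_eq_xxxx)
qed

context profile_box
begin

definition "fD a \<kappa> t = DD n (fr a \<kappa> t) (fw a \<kappa> t) (fq a \<kappa> t)"

definition "fE a \<kappa> t = QQ (fq a \<kappa> t) * dcoef n (fr a \<kappa> t) * (1 - fq a \<kappa> t)\<^sup>2 +
  2 * (coef n (fr a \<kappa> t) - coef n a) * fq a \<kappa> t * QQ (fq a \<kappa> t) * fD a \<kappa> t"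

lemma nonneg_trajectory:
  assumes "0 \<le> T" "T \<le> b" "0 < \<kappa>" "\<kappa> \<le> 1" "coef n a < 0"
    and "\<And>t. t \<in> {0..T} \<Longrightarrow> flow (st a \<kappa>) t \<in> B \<and> 0 \<le> fq a \<kappa> t"
    and "\<And>t. 0 < t \<Longrightarrow> t \<le> T \<Longrightarrow> fq a \<kappa> t < 1"
  shows "nonneg_trajectory n T a \<kappa> (fr a \<kappa>) (fw a \<kappa>) (fq a \<kappa>) (fR a \<kappa>) (\<lambda>t. fS a \<kappa> t / QQ (fq a \<kappa> t))"
proof -
  interpret trajectory n T a \<kappa> "fr a \<kappa>" "fw a \<kappa>" "fq a \<kappa>" "fR a \<kappa>" "\<lambda>t. fS a \<kappa> t / QQ (fq a \<kappa> t)"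
    by (rule trajectory) (use assms in auto)
  show ?thesis by unfold_locales (use assms in auto)
qed

lemma linearized_value_pos:
  assumes "nonneg_trajectory n T a \<kappa> (fr a \<kappa>) (fw a \<kappa>) (fq a \<kappa>) (fR a \<kappa>) (\<lambda>t. fS a \<kappa> t / QQ (fq a \<kappa> t))"
    and "fq a \<kappa> T < 1" and eta: "\<And>t. 0 < t \<Longrightarrow> t < T \<Longrightarrow> 0 \<le> fE a \<kappa> t"
  shows "0 < fS a \<kappa> T / QQ (fq a \<kappa> T) - fR a \<kappa> T * fD a \<kappa> T / (1 - fq a \<kappa> T)"
proof -
  interpret nonneg_trajectory n T a \<kappa> "fr a \<kappa>" "fw a \<kappa>" "fq a \<kappa>" "fR a \<kappa>" "\<lambda>t. fS a \<kappa> t / QQ (fq a \<kappa> t)"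
    by fact
  have "0 < H T"
    using eta by (intro H_pos) (simp add: eta_poly_def fE_def D_def fD_def)
  then have "0 < H T / (1 - fq a \<kappa> T)" using assms(2) by simp
  also have "H T / (1 - fq a \<kappa> T) = fS a \<kappa> T / QQ (fq a \<kappa> T) - fR a \<kappa> T * fD a \<kappa> T / (1 - fq a \<kappa> T)"
    using assms(2) by (simp add: H_def D_def fD_def diff_divide_distrib)
  finally show ?thesis .
qed

lemma fw_mono:
  assumes "0 \<le> t" "t \<le> b" and inB: "\<And>u. u \<in> {0..t} \<Longrightarrow> flow (st a \<kappa>) u \<in> B \<and> 0 \<le> fq a \<kappa> u"
  shows "0 \<le> fw a \<kappa> t"
proof -
  have sub: "{0..t} \<subseteq> {-b..b}" using assms box by auto
  have "fw a \<kappa> 0 \<le> fw a \<kappa> t"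
  proof (rule DERIV_nonneg_imp_increasing_open[where f="fw a \<kappa>" and a=0 and b=t])
    fix u assume u: "0 < u" "u < t"
    then have uI: "u \<in> {0..t}" by auto
    have at: "at u within {0..t} = at u" using u by (simp add: at_within_Icc_at)
    show "\<exists>y. (fw a \<kappa> has_real_derivative y) (at u) \<and> 0 \<le> y"
      using flow_components(2)[OF sub uI, of a \<kappa>, unfolded at] inB[OF uI] by blast
  next
    show "continuous_on {0..t} (fw a \<kappa>)"
      unfolding fw_def[abs_def] by (intro continuous_on_fst continuous_on_snd continuous_on_subset[OF flow_cont sub])
  qed fact
  then show ?thesis by (simp add: init_f)
qed

text \<open>Here the curve is given and the graph is derived from it. This lets a hypothesis on eta
  for finite slopes be evaluated at a prescribed time on curves with \<kappa> close to 1.\<close>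

lemma curve_in_portion:
  assumes t: "0 \<le> t" "t < b" and "\<kappa> < 1"
    and inB: "\<And>u. u \<in> {0..t} \<Longrightarrow> flow (st a \<kappa>) u \<in> interior B \<and> fq a \<kappa> u < 1 \<and> 0 \<le> fq a \<kappa> u"
  defines "ivp \<equiv> profile_ivp n a (\<kappa> / (1 - \<kappa>))"
  shows "fr a \<kappa> t \<in> portion a ivp"
    and "fE a \<kappa> t = (1 - fq a \<kappa> t) ^ 4 * eta n a (max_solution ivp) (fr a \<kappa> t)"
proof -
  define U where "U = interior B \<inter> {x. snd (snd x) < 1}"
  have "open U"
    unfolding U_def by (intro open_Int open_interior open_Collect_less continuous_intros)
  have "flow (st a \<kappa>) u \<in> U" if "u \<in> {0..t}" for u
    using inB[OF that] by (auto simp: U_def fq_def)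
  from open_interval_around[OF t flow_cont \<open>open U\<close> this]
  obtain d where d: "d > 0" "{-d..t+d} \<subseteq> {-b<..<b}" "\<And>u. u \<in> {-d..t+d} \<Longrightarrow> flow (st a \<kappa>) u \<in> U"
    by blast
  have U: "flow (st a \<kappa>) u \<in> B \<and> fq a \<kappa> u < 1" if "u \<in> {-d..t+d}" for u
    using d(3)[OF that] interior_subset by (auto simp: U_def fq_def)
  obtain g where g: "ivp (fr a \<kappa> ` {-d<..<t+d}) g"
    "\<And>u. u \<in> {-d<..<t+d} \<Longrightarrow> g (fr a \<kappa> u) = fw a \<kappa> u \<and> deriv g (fr a \<kappa> u) = fq a \<kappa> u / (1 - fq a \<kappa> u)"
    using angle_fun_curve[OF d(1) t(1) d(2) U] unfolding ivp_def by blast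
  have sol: "max_solution ivp (fr a \<kappa> u) = fw a \<kappa> u" "deriv (max_solution ivp) (fr a \<kappa> u) = fq a \<kappa> u / (1 - fq a \<kappa> u)"
    "deriv (deriv (max_solution ivp)) (fr a \<kappa> u) = deriv (deriv g) (fr a \<kappa> u)" if u: "u \<in> {-d<..<t+d}" for u
    using max_solution_profile[OF g(1)[unfolded ivp_def], of "fr a \<kappa> u"] g(2)[OF u] u unfolding ivp_def by auto
  have sub: "{0..t} \<subseteq> {-b..b}" using t box by auto
  have tI: "t \<in> {-d<..<t+d}" using t d(1) by auto
  have cont: "continuous_on {0..t} (fr a \<kappa>)"
    unfolding fr_def[abs_def] by (intro continuous_on_fst continuous_on_subset[OF flow_cont sub])
  have inB': "flow (st a \<kappa>) u \<in> B \<and> fq a \<kappa> u < 1" "flow (st a \<kappa>) u \<in> B \<and> 0 \<le> fq a \<kappa> u"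
    if "u \<in> {0..t}" for u
    using inB[OF that] interior_subset[of B] by auto
  have "strict_mono_on {0..t} (fr a \<kappa>)"
    by (rule fr_strict_mono[OF sub inB'(1)])
  then have "fr a \<kappa> 0 \<le> fr a \<kappa> t"
    by (rule strict_mono_on_leD) (use t in simp_all)
  then have "a \<le> fr a \<kappa> t" by (simp add: init_f)
  show "fr a \<kappa> t \<in> portion a ivp"
    unfolding portion_def
  proof (intro CollectI conjI ballI impI)
    show "fr a \<kappa> t \<in> max_domain ivp" 
      unfolding max_domain_def
      by (rule UnionI[of "fr a \<kappa> ` {-d<..<t+d}"]) (use g(1) tI in \<open>auto simp del: greaterThanLessThan_iff\<close>)
    fix s assume "a \<le> s \<and> s \<le> fr a \<kappa> t"
    then have "fr a \<kappa> 0 \<le> s" "s \<le> fr a \<kappa> t" by (simp_all add: init_f)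
    from IVT'[OF this t(1) cont]
    obtain u where u: "0 \<le> u" "u \<le> t" "fr a \<kappa> u = s" by blast
    then have uI: "u \<in> {-d<..<t+d}" using d(1) by auto
    have "0 \<le> fw a \<kappa> u"
      by (rule fw_mono) (use u t inB'(2) in auto)
    then show "0 \<le> max_solution ivp s" using sol(1)[OF uI] u(3) by simp
    have "0 \<le> fq a \<kappa> u / (1 - fq a \<kappa> u)" using inB[of u] u by simp
    then show "0 \<le> deriv (max_solution ivp) s" using sol(2)[OF uI] u(3) by simp
  qed fact
  have pe: "profile_equation n (fr a \<kappa> ` {-d<..<t+d}) g" using g(1) by (simp add: ivp_def profile_ivp_def)
  have "fr a \<kappa> t \<in> fr a \<kappa> ` {-d<..<t+d}" using tI by blast
  note g2 = profile_equationD(3)[OF pe this]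
  have q: "fq a \<kappa> t < 1" using inB[of t] t by simp
  have "eta n a (max_solution ivp) (fr a \<kappa> t) =
      (1 + (fq a \<kappa> t / (1 - fq a \<kappa> t))\<^sup>2) * dcoef n (fr a \<kappa> t) +
      2 * (coef n (fr a \<kappa> t) - coef n a) * (fq a \<kappa> t / (1 - fq a \<kappa> t)) *
      ((1 + (fq a \<kappa> t / (1 - fq a \<kappa> t))\<^sup>2) * (coef n (fr a \<kappa> t) * (fq a \<kappa> t / (1 - fq a \<kappa> t)) - fw a \<kappa> t / 2))"
    unfolding eta_alt sol[OF tI] g2 g(2)[OF tI, THEN conjunct1] g(2)[OF tI, THEN conjunct2] ..
  then show "fE a \<kappa> t = (1 - fq a \<kappa> t) ^ 4 * eta n a (max_solution ivp) (fr a \<kappa> t)"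
    by (simp only: eta_identity[OF q] fE_def fD_def DD_def)
qed

end

text \<open>The interval is open at \<open>a\<close>, and the start is described only by the limits
  of g and of g' / (1 + g'); thus finite and infinite initial slopes are treated alike. The bounds
  \<open>in_box\<close> place the whole piece with its starting point inside the box and its final
  time before \<open>b\<close>, so truncation is invisible.\<close>

locale profile_piece = profile_box +
  fixes J :: "real set" and g :: "real \<Rightarrow> real" and a r \<kappa> :: real
  assumes pe: "profile_equation n J g" and J: "{a<..r} \<subseteq> J" and a_less_r: "a < r"
    and nonneg: "\<And>s. s \<in> {a<..r} \<Longrightarrow> 0 \<le> g s \<and> 0 \<le> deriv g s"
    and lim_g: "(g \<longlongrightarrow> 0) (at_right a)"
    and lim_q: "((\<lambda>s. deriv g s / (1 + deriv g s)) \<longlongrightarrow> \<kappa>) (at_right a)"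
    and \<kappa>: "0 < \<kappa>" "\<kappa> \<le> 1"
    and in_box: "lo < a" "r < hi" "g r < m" "1 < m" "r - a + g r < b"
begin

definition "T = r - a + g r"
definition "\<tau> s = s - a + g s"
definition "p s = deriv g s / (1 + deriv g s)"
definition "\<Gamma> s = (s, g s, p s)"

lemma g_deriv: "s \<in> {a<..r} \<Longrightarrow> (g has_real_derivative deriv g s) (at s)"
  using profile_equationD(1)[OF pe] J by auto

lemma g_cont: "a < s \<Longrightarrow> s' \<le> r \<Longrightarrow> continuous_on {s..s'} g"
  using g_deriv by (intro DERIV_continuous_on[of _ _ "deriv g"]) (auto intro: has_field_derivative_at_within)

lemma g_mono: assumes "a < s" "s \<le> s'" "s' \<le> r" shows "g s \<le> g s'"
proof (rule DERIV_nonneg_imp_increasing_open[where f=g and a=s and b=s'])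
  fix x assume "s < x" "x < s'"
  then have "x \<in> {a<..r}" using assms by auto
  then show "\<exists>y. (g has_real_derivative y) (at x) \<and> 0 \<le> y" using g_deriv nonneg by blast
qed (use assms g_cont in auto)

lemma \<tau>_bounds: "s \<in> {a<..r} \<Longrightarrow> 0 < \<tau> s \<and> \<tau> s \<le> T"
  using nonneg[of s] g_mono[of s r] by (auto simp: \<tau>_def T_def)

lemma T_pos: "0 < T" and T_less: "T < b"
  using a_less_r nonneg[of r] in_box by (auto simp: T_def)

lemma \<Gamma>_in: "s \<in> {a<..r} \<Longrightarrow> \<Gamma> s \<in> interior B \<and> 0 \<le> p s \<and> p s < 1"
proof -
  assume s: "s \<in> {a<..r}"
  then have "0 \<le> p s" "p s < 1" using nonneg[OF s] by (simp_all add: p_def)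
  then show ?thesis
    using s nonneg[OF s] g_mono[of s r] in_box by (auto simp: \<Gamma>_def interior_B)
qed

lemma \<Gamma>_deriv:
  assumes s: "s \<in> {a<..r}"
  shows "(\<Gamma> has_vector_derivative (1 + deriv g s) *\<^sub>R pfield n (\<Gamma> s)) (at s)"
proof -
  have sJ: "s \<in> J" using s J by auto
  define g' where "g' = deriv g s"
  have g': "0 < 1 + g'" using nonneg[OF s] by (simp add: g'_def)
  note d1 = profile_equationD(1)[OF pe sJ] and d2 = profile_equationD(2)[OF pe sJ]
  have quot: "(x * (1 + y) - y * (0 + x)) / ((1 + y) * (1 + y)) = x / (1 + y)\<^sup>2" for x y :: real
    by (simp add: power2_eq_square algebra_simps)
  have "(p has_real_derivative (1 + g'\<^sup>2) * (coef n s * g' - g s / 2) / (1 + g')\<^sup>2) (at s)"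
    using DERIV_divide[OF d2 DERIV_add[OF DERIV_const[of 1] d2]] g'
    unfolding p_def[abs_def] quot unfolding g'_def by simp
  moreover have "(1 + g'\<^sup>2) * (coef n s * g' - g s / 2) / (1 + g')\<^sup>2 = (1 + g') * (QQ (p s) * DD n s (g s) (p s))"
  proof -
    define u where "u = 1 + g'"
    have "1 - p s = 1 / u" "p s = g' / u" using g' by (simp_all add: p_def g'_def u_def field_simps)
    then have "QQ (p s) = (1 + g'\<^sup>2) / u\<^sup>2" "DD n s (g s) (p s) = (coef n s * g' - g s / 2) / u"
      by (simp_all add: QQ_eq DD_def power_divide add_divide_distrib diff_divide_distrib)
    then show ?thesis using g' unfolding u_def[symmetric] by (simp add: power2_eq_square)
  qed
  moreover have "1 + g' \<noteq> 0" "(1 + g') * (1 - p s) = 1" "(1 + g') * p s = g'"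
    using g' by (simp_all add: p_def g'_def field_simps)
  ultimately show ?thesis
    using d1 unfolding \<Gamma>_def[abs_def] pfield_def has_real_derivative_iff_has_vector_derivative g'_def[symmetric]
    by (auto intro!: has_vector_derivative_Pair)
qed

lemma \<tau>_deriv: "s \<in> {a<..r} \<Longrightarrow> (\<tau> has_real_derivative 1 + deriv g s) (at s)"
  unfolding \<tau>_def[abs_def] by (auto intro!: derivative_eq_intros g_deriv)

lemma \<tau>_lim: "(\<tau> \<longlongrightarrow> 0) (at_right a)"
proof -
  have "((\<lambda>s. s - a + g s) \<longlongrightarrow> a - a + 0) (at_right a)" by (intro tendsto_intros lim_g)
  then show ?thesis by (simp add: \<tau>_def[abs_def])
qed

lemma eventually_right: "c \<in> {a<..r} \<Longrightarrow> \<forall>\<^sub>F s in at_right a. s \<in> {a<..c}"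
  using eventually_at_right_real[of a c] by (auto elim: eventually_mono)

text \<open>Gronwall in the variable \<open>s\<close> with the weight \<open>exp (-2 L \<tau> s)\<close>, so that the blow-up
  of \<open>deriv g\<close> at a vertical starting point is harmless.\<close>

lemma curve:
  assumes s: "s \<in> {a<..r}"
  shows "flow (st a \<kappa>) (\<tau> s) = \<Gamma> s"
proof -
  define Z where "Z s = flow (st a \<kappa>) (\<tau> s) - \<Gamma> s" for s
  define u where "u s = (Z s \<bullet> Z s) * exp (- (2 * L * \<tau> s))" for s
  have Tb: "\<tau> x \<in> {-b..b}" "\<tau> x \<in> {-b<..<b}" if "x \<in> {a<..r}" for x
    using \<tau>_bounds[OF that] T_less box by auto
  have Zd: "(Z has_vector_derivative (1 + deriv g x) *\<^sub>R (G (flow (st a \<kappa>) (\<tau> x)) - G (\<Gamma> x))) (at x)"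
    if x: "x \<in> {a<..r}" for x
  proof -
    have "at (\<tau> x) within {-b..b} = at (\<tau> x)"
      using Tb(2)[OF x] by (intro at_within_Icc_at) auto
    then have "(flow (st a \<kappa>) has_vector_derivative G (flow (st a \<kappa>) (\<tau> x))) (at (\<tau> x))"
      using flow_deriv[OF Tb(1)[OF x], of "st a \<kappa>"] by simp
    from vector_diff_chain_at[OF \<tau>_deriv[OF x, unfolded has_real_derivative_iff_has_vector_derivative] this]
    have "((\<lambda>s. flow (st a \<kappa>) (\<tau> s)) has_vector_derivative (1 + deriv g x) *\<^sub>R G (flow (st a \<kappa>) (\<tau> x))) (at x)"
      by (simp add: o_def)
    moreover have "G (\<Gamma> x) = pfield n (\<Gamma> x)" using \<Gamma>_in[OF x] interior_subset by (intro G_eq) auto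
    ultimately show ?thesis
      unfolding Z_def[abs_def] scaleR_diff_right
      using has_vector_derivative_diff[OF _ \<Gamma>_deriv[OF x]] by simp
  qed
  have u_mono: "u s \<le> u x" if "x \<in> {a<..s}" for x
  proof (rule DERIV_nonpos_imp_decreasing_open[where f=u and a=x and b=s])
    fix y assume "x < y" "y < s"
    then have y: "y \<in> {a<..r}" using that s by auto
    define W where "W = G (flow (st a \<kappa>) (\<tau> y)) - G (\<Gamma> y)"
    have d: "(Z has_derivative (\<lambda>h. h *\<^sub>R ((1 + deriv g y) *\<^sub>R W))) (at y)"
      using Zd[OF y] by (simp add: has_vector_derivative_def W_def)
    have "((\<lambda>s. Z s \<bullet> Z s) has_real_derivative 2 * (1 + deriv g y) * (Z y \<bullet> W)) (at y)"
      using has_derivative_inner[OF d d]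
      by (rule has_derivative_imp_has_field_derivative) (simp add: inner_commute algebra_simps)
    then have der: "(u has_real_derivative
        2 * (1 + deriv g y) * (Z y \<bullet> W - L * (Z y \<bullet> Z y)) * exp (- (2 * L * \<tau> y))) (at y)"
      unfolding u_def[abs_def] by (auto intro!: derivative_eq_intros \<tau>_deriv[OF y] simp: algebra_simps)
    have "Z y \<bullet> W \<le> norm (Z y) * norm W" by (rule norm_cauchy_schwarz)
    also have "\<dots> \<le> norm (Z y) * (L * norm (Z y))"
      unfolding W_def Z_def by (intro mult_left_mono G_lipschitz) auto
    also have "\<dots> = L * (Z y \<bullet> Z y)" by (simp add: power2_norm_eq_inner[symmetric] power2_eq_square)
    finally have "2 * (1 + deriv g y) * (Z y \<bullet> W - L * (Z y \<bullet> Z y)) * exp (- (2 * L * \<tau> y)) \<le> 0"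
      using nonneg[OF y] by (intro mult_nonpos_nonneg mult_nonneg_nonpos) auto
    with der show "\<exists>z. (u has_real_derivative z) (at y) \<and> z \<le> 0" by blast
  next
    have "continuous_on {x..s} Z"
      by (rule has_vector_derivative_continuous_on[OF has_vector_derivative_at_within[OF Zd]]) (use that s in auto)
    moreover have "continuous_on {x..s} \<tau>"
      by (rule DERIV_continuous_on[OF has_field_derivative_at_within[OF \<tau>_deriv]]) (use that s in auto)
    ultimately show "continuous_on {x..s} u"
      unfolding u_def[abs_def] by (intro continuous_intros)
  qed (use that in auto)
  have "(\<Gamma> \<longlongrightarrow> st a \<kappa>) (at_right a)"
    unfolding \<Gamma>_def[abs_def] st_def p_def by (intro tendsto_Pair tendsto_ident_at lim_g lim_q)
  moreover have "((\<lambda>x. flow (st a \<kappa>) (\<tau> x)) \<longlongrightarrow> flow (st a \<kappa>) 0) (at_right a)"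
  proof (rule tendsto_flow[OF tendsto_const \<tau>_lim])
    show "\<forall>\<^sub>F i in at_right a. \<tau> i \<in> {- b..b}"
      by (rule eventually_mono[OF eventually_right[OF s]]) (use s Tb in auto)
  qed (use box in auto)
  ultimately have "(Z \<longlongrightarrow> flow (st a \<kappa>) 0 - st a \<kappa>) (at_right a)"
    unfolding Z_def[abs_def] by (intro tendsto_diff)
  then have "(u \<longlongrightarrow> (0 \<bullet> (0 :: real \<times> real \<times> real)) * exp (- (2 * L * 0))) (at_right a)"
    unfolding u_def[abs_def] by (intro tendsto_intros \<tau>_lim) auto
  then have "(u \<longlongrightarrow> 0) (at_right a)" by simp
  moreover have "\<forall>\<^sub>F x in at_right a. u s \<le> u x"
    by (rule eventually_mono[OF eventually_right[OF s] u_mono])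
  ultimately have "u s \<le> 0" by (intro tendsto_lowerbound) auto
  then have "Z s \<bullet> Z s \<le> 0" by (simp add: u_def mult_le_0_iff)
  then have "Z s = 0" by (metis antisym inner_eq_zero_iff inner_ge_zero)
  then show ?thesis by (simp add: Z_def)
qed

lemma time_surj:
  assumes t: "0 < t" "t \<le> T"
  shows "\<exists>s\<in>{a<..r}. \<tau> s = t"
proof -
  have "\<forall>\<^sub>F s in at_right a. \<tau> s < t" using order_tendstoD(2)[OF \<tau>_lim t(1)] .
  then have "\<forall>\<^sub>F s in at_right a. \<tau> s < t \<and> s \<in> {a<..r}"
    using eventually_right[of r] a_less_r by (auto intro: eventually_conj)
  then obtain s1 where s1: "\<tau> s1 < t" "s1 \<in> {a<..r}"
    using eventually_happens'[OF trivial_limit_at_right_real] by blast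
  have "continuous_on {s1..r} \<tau>"
    by (rule DERIV_continuous_on[OF has_field_derivative_at_within[OF \<tau>_deriv]]) (use s1 in auto)
  then obtain s where "s1 \<le> s" "s \<le> r" "\<tau> s = t"
    using IVT'[of \<tau> s1 t r] s1 t by (auto simp: T_def \<tau>_def)
  with s1 show ?thesis by auto
qed

lemma curve_at: "t \<in> {0<..T} \<Longrightarrow> \<exists>s\<in>{a<..r}. \<tau> s = t \<and> flow (st a \<kappa>) t = \<Gamma> s"
  using time_surj[of t] curve by auto

lemma start_in: "st a \<kappa> \<in> interior B"
  using in_box a_less_r \<kappa> by (simp add: st_def interior_B)

lemma curve_props: "t \<in> {0..T} \<Longrightarrow> flow (st a \<kappa>) t \<in> interior B \<and> 0 \<le> fq a \<kappa> t"
proof (cases "t = 0")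
  case True
  then show ?thesis using start_in \<kappa> by (simp add: init_f)
next
  case False
  assume "t \<in> {0..T}"
  with False obtain s where "s \<in> {a<..r}" "flow (st a \<kappa>) t = \<Gamma> s" using curve_at[of t] by auto
  then show ?thesis using \<Gamma>_in[of s] by (simp add: fq_def) (simp add: \<Gamma>_def)
qed

lemma curve_lt: "0 < t \<Longrightarrow> t \<le> T \<Longrightarrow> fq a \<kappa> t < 1"
proof -
  assume "0 < t" "t \<le> T"
  then obtain s where "s \<in> {a<..r}" "flow (st a \<kappa>) t = \<Gamma> s" using curve_at[of t] by auto
  then show ?thesis using \<Gamma>_in[of s] by (simp add: fq_def) (simp add: \<Gamma>_def)
qed

lemma curve_end: "fr a \<kappa> T = r"
  using curve[of r] a_less_r by (simp add: fr_def T_def \<tau>_def \<Gamma>_def)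

lemma trajectory_piece:
  "coef n a < 0 \<Longrightarrow> nonneg_trajectory n T a \<kappa> (fr a \<kappa>) (fw a \<kappa>) (fq a \<kappa>) (fR a \<kappa>) (\<lambda>t. fS a \<kappa> t / QQ (fq a \<kappa> t))"
  using curve_props curve_lt T_pos T_less \<kappa> interior_subset by (intro nonneg_trajectory) auto

lemma fE_eta:
  assumes eta: "\<And>s. s \<in> {a<..r} \<Longrightarrow> 0 \<le> eta n a g s" and t: "0 < t" "t \<le> T"
  shows "0 \<le> fE a \<kappa> t"
proof -
  obtain s where s: "s \<in> {a<..r}" "flow (st a \<kappa>) t = \<Gamma> s" using curve_at[of t] t by auto
  then have f: "fr a \<kappa> t = s" "fw a \<kappa> t = g s" "fq a \<kappa> t = p s"
    by (simp_all add: fr_def fw_def fq_def \<Gamma>_def)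
  have "deriv g s = p s / (1 - p s)"
    using nonneg[OF s(1)] by (simp add: p_def field_simps)
  moreover have "p s < 1" using \<Gamma>_in[OF s(1)] by simp
  ultimately have "fE a \<kappa> t = (1 - p s) ^ 4 * eta n a g s"
    using eta_identity[of "p s" "dcoef n s" "coef n s" "coef n a" "g s"]
      profile_equationD(3)[OF pe, of s] s(1) J
    by (auto simp: eta_def fE_def fD_def f DD_def dcoef_def add.commute)
  also have "0 \<le> \<dots>" using eta[OF s(1)] \<open>p s < 1\<close> by simp
  finally show ?thesis .
qed

end

section \<open>Vertical starting points\<close>

lemma coef_mono:
  assumes "1 \<le> n" "x \<le> y" "0 \<notin> {x..y}"
  shows "coef n x \<le> coef n y"
proof (rule DERIV_nonneg_imp_increasing_open[OF assms(2)])
  fix z assume "x < z" "z < y"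
  then have "z \<noteq> 0" using assms(3) by auto
  moreover have "0 \<le> dcoef n z" using assms(1) by (simp add: dcoef_def)
  ultimately show "\<exists>d. (coef n has_real_derivative d) (at z) \<and> 0 \<le> d" using coef_deriv by blast
qed (rule coef_cont[OF assms(3)])

locale vertical_piece = profile_piece n lo hi m b J g a r 1 for n lo hi m b J g a r +
  assumes n_pos: "1 \<le> n"
begin

text \<open>Otherwise \<open>coef\<close> is nonnegative on all of [a, r], being increasing there.
  Then y = q - 1 starts at 0 and satisfies y' >= (QQ w / 2) y, so q is still at least 1 at time
  \<open>T\<close>, contradicting that the curve is a graph there.\<close>

lemma c0_neg: "coef n a < 0"
proof (rule ccontr)
  assume "\<not> coef n a < 0"
  then have c0: "0 \<le> coef n a" by simp
  have sub: "{0..T} \<subseteq> {-b..b}" using T_pos T_less box by auto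
  have inB: "flow (st a 1) t \<in> B" if "t \<in> {0..T}" for t
    using curve_props[OF that] interior_subset by auto
  note d = flow_components[OF sub _ inB]
  have "0 \<le> fq a 1 T - 1"
  proof (rule integrating_factor_nonneg[where y="\<lambda>t. fq a 1 t - 1" and T=T and \<beta>="\<lambda>t. QQ (fq a 1 t) * fw a 1 t / 2"
        and y'="\<lambda>t. QQ (fq a 1 t) * fD a 1 t"])
    have c: "continuous_on {0..T} (fq a 1)" "continuous_on {0..T} (fw a 1)"
      using DERIV_continuous_on[OF d(3)] DERIV_continuous_on[OF d(2)] by blast+
    have "continuous_on {0..T} (\<lambda>t. QQ (fq a 1 t))" unfolding QQ_def by (intro continuous_intros c)
    with c show "continuous_on {0..T} (\<lambda>t. fq a 1 t - 1)" "continuous_on {0..T} (\<lambda>t. QQ (fq a 1 t) * fw a 1 t / 2)"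
      by (auto intro!: continuous_intros)
  next
    fix t assume t: "0 < t" "t < T"
    then have tT: "t \<in> {0..T}" by auto
    have at: "at t within {0..T} = at t" using t by (simp add: at_within_Icc_at)
    show "((\<lambda>t. fq a 1 t - 1) has_real_derivative QQ (fq a 1 t) * fD a 1 t) (at t)"
      using DERIV_diff[OF d(3)[OF tT tT, unfolded at] DERIV_const[of 1]] by (simp add: fD_def)
    obtain s where s: "s \<in> {a<..r}" "flow (st a 1) t = \<Gamma> s" using curve_at[of t] t by auto
    have "0 \<notin> {a..s}" using box in_box s by auto
    then have "0 \<le> coef n s" using coef_mono[OF n_pos, of a s] c0 s by auto
    then have "0 \<le> coef n (fr a 1 t) * fq a 1 t"
      using s curve_props[OF tT] by (simp add: fr_def \<Gamma>_def)
    then have "0 \<le> QQ (fq a 1 t) * (coef n (fr a 1 t) * fq a 1 t)" using QQ_pos[of "fq a 1 t"] by simp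
    moreover have "QQ (fq a 1 t) * fD a 1 t = QQ (fq a 1 t) * (coef n (fr a 1 t) * fq a 1 t) +
        QQ (fq a 1 t) * fw a 1 t / 2 * (fq a 1 t - 1)"
      by (simp add: fD_def DD_def field_simps)
    ultimately show "QQ (fq a 1 t) * fw a 1 t / 2 * (fq a 1 t - 1) \<le> QQ (fq a 1 t) * fD a 1 t" by linarith
  qed (use T_pos in \<open>simp_all add: init_f\<close>)
  then show False using curve_lt[of T] T_pos by simp
qed

lemma tendsto_start: "((\<lambda>\<kappa>. st a \<kappa>) \<longlongrightarrow> st a 1) (at_left 1)"
  by (intro tendsto_st tendsto_intros)

lemma DD_cont: "continuous_on (interior B) (\<lambda>x. DD n (fst x) (fst (snd x)) (snd (snd x)))"
proof -
  have sub: "fst ` interior B \<subseteq> - {0}" using B_fst interior_subset[of B] by auto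
  have "continuous_on (interior B) (\<lambda>x. coef n (fst x))"
    by (rule continuous_on_compose2[OF coef_cont continuous_on_fst[OF continuous_on_id] sub]) simp
  then show ?thesis unfolding DD_def by (intro continuous_intros) auto
qed

text \<open>Near time \<open>0\<close> the bound \<open>q < 1\<close> is not an open condition on the limit curve; there
  it follows from \<open>q' < 0\<close>.\<close>

lemma nearby_curves:
  "\<exists>d>0. T + d < b \<and> (\<forall>t\<in>{0<..T+d}. flow (st a 1) t \<in> interior B \<and> fq a 1 t < 1) \<and>
     (\<forall>\<^sub>F \<kappa> in at_left 1. \<forall>t\<in>{0..T+d}. flow (st a \<kappa>) t \<in> interior B \<and> fq a \<kappa> t < 1)"
proof -
  \<comment> \<open>At the vertical start \<open>DD\<close> equals \<open>coef n a\<close>, so the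
    start lies in this open set. Nearby curves remain in it for a short time, during which q
    decreases from \<kappa> < 1.\<close>
  define V where "V = (\<lambda>x. DD n (fst x) (fst (snd x)) (snd (snd x))) -` {..<0} \<inter> interior B"
  have "open V"
    unfolding V_def
    by (rule DD_cont[unfolded continuous_on_open_vimage[OF open_interior], rule_format, OF open_lessThan])
  define U where "U = interior B \<inter> {x. snd (snd x) < 1}"
  have "open U"
    unfolding U_def by (intro open_Int open_interior open_Collect_less continuous_intros)
  have U: "flow (st a \<kappa>) t \<in> U \<longleftrightarrow> flow (st a \<kappa>) t \<in> interior B \<and> fq a \<kappa> t < 1" for \<kappa> t
    by (simp add: U_def fq_def)
  have V0: "flow (st a 1) 0 \<in> V"
    using start_in c0_neg by (simp add: V_def) (simp add: st_def DD_def)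
  have "\<exists>d>0. {-d..0+d} \<subseteq> {-b<..<b} \<and> (\<forall>t\<in>{-d..0+d}. flow (st a 1) t \<in> V)"
  proof (rule open_interval_around[OF _ _ flow_cont \<open>open V\<close>])
    show "flow (st a 1) t \<in> V" if "t \<in> {0..0}" for t
      using that V0 by (simp only: atLeastAtMost_singleton singleton_iff)
  qed (use T_pos T_less in auto)
  then obtain d1 where d1: "d1 > 0" "\<And>t. t \<in> {-d1..0 + d1} \<Longrightarrow> flow (st a 1) t \<in> V" by blast
  define t1 where "t1 = min d1 T"
  have t1: "0 < t1" "t1 \<le> T" using d1 T_pos by (auto simp: t1_def)
  have "continuous_on {-b<..<b} (flow (st a 1))" using flow_cont by (rule continuous_on_subset) auto
  then have "open (flow (st a 1) -` U \<inter> {-b<..<b})"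
    using \<open>open U\<close> by (simp add: continuous_on_open_vimage)
  moreover have "T \<in> flow (st a 1) -` U \<inter> {-b<..<b}"
    using curve_props[of T] curve_lt[of T] T_pos T_less by (simp add: U)
  ultimately obtain d where d: "d > 0" "cball T d \<subseteq> flow (st a 1) -` U \<inter> {-b<..<b}"
    using open_contains_cball by blast
  have Td: "T + d < b" using subsetD[OF d(2), of "T + d"] d(1) by (simp add: dist_real_def)
  have base: "flow (st a 1) t \<in> U" if "t \<in> {0<..T+d}" for t
  proof (cases "t \<le> T")
    case True
    then show ?thesis using curve_props[of t] curve_lt[of t] that by (simp add: U)
  next
    case False
    then have "t \<in> cball T d" using that by (simp add: dist_real_def)
    then show ?thesis using d(2) by auto
  qed
  have "\<forall>\<^sub>F \<kappa> in at_left 1. \<forall>t\<in>{0..t1}. flow (st a \<kappa>) t \<in> V"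
  proof (rule flow_stays[OF tendsto_start])
    show "flow (st a 1) t \<in> V" if "t \<in> {0..t1}" for t
      using that d1 by (intro d1(2)) (auto simp: t1_def)
  qed (use \<open>open V\<close> t1 T_less box in auto)
  moreover have "\<forall>\<^sub>F \<kappa> in at_left 1. \<forall>t\<in>{t1..T+d}. flow (st a \<kappa>) t \<in> U"
  proof (rule flow_stays[OF tendsto_start])
    show "flow (st a 1) t \<in> U" if "t \<in> {t1..T+d}" for t
      using that t1 by (intro base) auto
  qed (use \<open>open U\<close> t1 Td box in auto)
  moreover have "\<forall>\<^sub>F \<kappa> in at_left 1. \<kappa> \<in> {0<..<1::real}" by (rule eventually_at_left_real) simp
  ultimately have "\<forall>\<^sub>F \<kappa> in at_left 1. \<forall>t\<in>{0..T+d}. flow (st a \<kappa>) t \<in> interior B \<and> fq a \<kappa> t < 1"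
  proof eventually_elim
    case (elim \<kappa>)
    have sub: "{0..t1} \<subseteq> {-b..b}" using t1 T_less box by auto
    have V: "flow (st a \<kappa>) u \<in> B \<and> fD a \<kappa> u < 0" if "u \<in> {0..t1}" for u
    proof -
      have "flow (st a \<kappa>) u \<in> V" using elim(1) that by blast
      then show ?thesis
        using interior_subset[of B] by (auto simp: V_def fD_def fr_def fw_def fq_def)
    qed
    have "fq a \<kappa> t < 1" if t: "t \<in> {0..t1}" for t
    proof -
      have "fq a \<kappa> t \<le> fq a \<kappa> 0"
      proof (rule DERIV_nonpos_imp_decreasing_open[where f="fq a \<kappa>" and a=0 and b=t])
        fix u assume u: "0 < u" "u < t"
        then have uI: "u \<in> {0..t1}" using t by auto
        have at: "at u within {0..t1} = at u" using u t by (intro at_within_Icc_at) auto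
        have "QQ (fq a \<kappa> u) * fD a \<kappa> u \<le> 0"
          using V[OF uI] QQ_pos[of "fq a \<kappa> u"] by (simp add: mult_le_0_iff)
        then show "\<exists>y. (fq a \<kappa> has_real_derivative y) (at u) \<and> y \<le> 0"
          using flow_components(3)[OF sub uI, of a \<kappa>, unfolded at] V[OF uI] unfolding fD_def by blast
      next
        show "continuous_on {0..t} (fq a \<kappa>)"
          unfolding fq_def[abs_def] using t sub
          by (intro continuous_on_snd continuous_on_subset[OF flow_cont]) auto
      qed (use t in auto)
      then show ?thesis using elim(3) by (simp add: init_f)
    qed
    then have early: "flow (st a \<kappa>) t \<in> interior B \<and> fq a \<kappa> t < 1" if "t \<in> {0..t1}" for t
      using bspec[OF elim(1) that] that by (simp add: V_def)
    show ?case
    proof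
      fix t assume t: "t \<in> {0..T+d}"
      show "flow (st a \<kappa>) t \<in> interior B \<and> fq a \<kappa> t < 1"
      proof (cases "t \<le> t1")
        case True
        with t show ?thesis by (intro early) simp
      next
        case False
        then have "t \<in> {t1..T+d}" using t by simp
        from bspec[OF elim(2) this] show ?thesis unfolding U .
      qed
    qed
  qed
  then show ?thesis
    using d(1) Td base unfolding U by (intro exI[of _ d] conjI ballI) simp_all
qed

text \<open>For each \<kappa> < 1 the formula for the linearized function at \<open>r\<close> is
  evaluated at that curve's own crossing time \<open>\<theta> \<kappa>\<close>. These times tend to
  \<open>T\<close>, and the flow and its variation converge along moving times.\<close>

lemma tendsto_linearized:
  "((\<lambda>\<kappa>. linearized n a (\<kappa> / (1 - \<kappa>)) r) \<longlongrightarrow>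
     fS a 1 T / QQ (fq a 1 T) - fR a 1 T * fD a 1 T / (1 - fq a 1 T)) (at_left 1)"
proof -
  obtain d0 where d0: "d0 > 0" "T + d0 < b"
    "\<And>t. t \<in> {0<..T+d0} \<Longrightarrow> flow (st a 1) t \<in> interior B \<and> fq a 1 t < 1"
    and ev: "\<forall>\<^sub>F \<kappa> in at_left 1. \<forall>t\<in>{0..T+d0}. flow (st a \<kappa>) t \<in> interior B \<and> fq a \<kappa> t < 1"
    using nearby_curves by blast
  define d where "d = min d0 (T / 2)"
  have d: "0 < d" "d < T" using d0(1) T_pos by (auto simp: d_def)
  have dI: "{T-d..T+d} \<subseteq> {0<..T+d0}" using d by (auto simp: d_def)
  have sub: "{T-d..T+d} \<subseteq> {-b..b}"
  proof
    fix t assume "t \<in> {T-d..T+d}"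
    then have "t \<in> {0<..T+d0}" using dI by blast
    then show "t \<in> {-b..b}" using d0(2) by auto
  qed
  have mono: "strict_mono_on {T-d..T+d} (\<lambda>t. fst (flow (st a \<kappa>) t))"
    if "\<And>t. t \<in> {0<..T+d0} \<Longrightarrow> flow (st a \<kappa>) t \<in> interior B \<and> fq a \<kappa> t < 1" for \<kappa>
  proof -
    have "strict_mono_on {T-d..T+d} (fr a \<kappa>)"
    proof (rule fr_strict_mono[OF sub])
      fix t assume "t \<in> {T-d..T+d}"
      then show "flow (st a \<kappa>) t \<in> B \<and> fq a \<kappa> t < 1"
        using that[of t] dI interior_subset[of B] by blast
    qed
    then show ?thesis by (simp add: fr_def[abs_def])
  qed
  obtain \<theta> where \<theta>: "(\<theta> \<longlongrightarrow> T) (at_left 1)"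
    "\<forall>\<^sub>F \<kappa> in at_left 1. \<theta> \<kappa> \<in> {T-d<..<T+d} \<and> fst (flow (st a \<kappa>) (\<theta> \<kappa>)) = fst (flow (st a 1) T)"
  proof (rule crossing_time[OF tendsto_start d(1) sub])
    show "strict_mono_on {T-d..T+d} (\<lambda>t. fst (flow (st a 1) t))" using d0(3) by (rule mono)
    show "\<forall>\<^sub>F \<kappa> in at_left 1. strict_mono_on {T-d..T+d} (\<lambda>t. fst (flow (st a \<kappa>) t))"
      using ev by (rule eventually_mono) (rule mono, auto)
  qed
  have \<theta>b: "\<forall>\<^sub>F \<kappa> in at_left 1. \<theta> \<kappa> \<in> {-b..b}"
    using \<theta>(2) by (rule eventually_mono) (use sub in \<open>auto simp: subset_iff\<close>)
  have Tb: "T \<in> {-b..b}" using T_pos T_less by auto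
  note lim = tendsto_flow[OF tendsto_start \<theta>(1) \<theta>b Tb] tendsto_vflow[OF tendsto_start \<theta>(1) \<theta>b Tb, of "(1,0,0)"]
  have lr: "((\<lambda>\<kappa>. fr a \<kappa> (\<theta> \<kappa>)) \<longlongrightarrow> fr a 1 T) (at_left 1)"
    and lw: "((\<lambda>\<kappa>. fw a \<kappa> (\<theta> \<kappa>)) \<longlongrightarrow> fw a 1 T) (at_left 1)"
    and lq: "((\<lambda>\<kappa>. fq a \<kappa> (\<theta> \<kappa>)) \<longlongrightarrow> fq a 1 T) (at_left 1)"
    and lR: "((\<lambda>\<kappa>. fR a \<kappa> (\<theta> \<kappa>)) \<longlongrightarrow> fR a 1 T) (at_left 1)"
    and lS: "((\<lambda>\<kappa>. fS a \<kappa> (\<theta> \<kappa>)) \<longlongrightarrow> fS a 1 T) (at_left 1)"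
    unfolding fr_def fw_def fq_def fR_def fS_def fv_def by (intro tendsto_fst tendsto_snd lim)+
  have "r \<noteq> 0" using box in_box a_less_r by auto
  then have "isCont (coef n) (fr a 1 T)" unfolding curve_end using coef_deriv DERIV_isCont by blast
  then have lc: "((\<lambda>\<kappa>. coef n (fr a \<kappa> (\<theta> \<kappa>))) \<longlongrightarrow> coef n (fr a 1 T)) (at_left 1)"
    using lr by (rule isCont_tendsto_compose)
  have q1: "1 - fq a 1 T \<noteq> 0" using curve_lt[of T] T_pos by simp
  have Q1: "QQ (fq a 1 T) \<noteq> 0" using QQ_pos[of "fq a 1 T"] by simp
  have lQ: "((\<lambda>\<kappa>. QQ (fq a \<kappa> (\<theta> \<kappa>))) \<longlongrightarrow> QQ (fq a 1 T)) (at_left 1)"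
    unfolding QQ_def by (intro tendsto_intros lq)
  have lD: "((\<lambda>\<kappa>. fD a \<kappa> (\<theta> \<kappa>)) \<longlongrightarrow> fD a 1 T) (at_left 1)"
    unfolding fD_def DD_def by (intro tendsto_intros lc lq lw) simp
  have "((\<lambda>\<kappa>. fS a \<kappa> (\<theta> \<kappa>) / QQ (fq a \<kappa> (\<theta> \<kappa>)) - fR a \<kappa> (\<theta> \<kappa>) * fD a \<kappa> (\<theta> \<kappa>) / (1 - fq a \<kappa> (\<theta> \<kappa>)))
      \<longlongrightarrow> fS a 1 T / QQ (fq a 1 T) - fR a 1 T * fD a 1 T / (1 - fq a 1 T)) (at_left 1)"
    by (intro tendsto_intros lS lQ lR lD lq q1 Q1)
  moreover have "\<forall>\<^sub>F \<kappa> in at_left 1. \<kappa> \<in> {0<..<1::real}" by (rule eventually_at_left_real) simp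
  with ev \<theta>(2) have "\<forall>\<^sub>F \<kappa> in at_left 1. fS a \<kappa> (\<theta> \<kappa>) / QQ (fq a \<kappa> (\<theta> \<kappa>)) -
      fR a \<kappa> (\<theta> \<kappa>) * fD a \<kappa> (\<theta> \<kappa>) / (1 - fq a \<kappa> (\<theta> \<kappa>)) = linearized n a (\<kappa> / (1 - \<kappa>)) r"
  proof eventually_elim
    case (elim \<kappa>)
    have "\<theta> \<kappa> \<in> {T-d..T+d}" using elim(2) by auto
    then have "\<theta> \<kappa> \<in> {0<..T+d0}" using dI by blast
    moreover have "fr a \<kappa> (\<theta> \<kappa>) = r" using elim(2) curve_end by (simp add: fr_def)
    ultimately show ?case
      using linearized_formula[of "\<theta> \<kappa>" \<kappa> a] elim(1,3) d0(2) by (simp add: fD_def)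
  qed
  ultimately show ?thesis by (rule Lim_transform_eventually)
qed

text \<open>If \<open>fE\<close> were negative at time \<open>t\<close> on the vertical curve, it
  would be negative for all \<kappa> close to 1, against the frequent sign hypothesis. To apply that
  hypothesis, the nearby curves must still be in their portions at \<open>t\<close>: before
  \<open>T\<close> the limit curve has q > 0, an open condition on the compact interval
  [0, t].\<close>

lemma fE_nonneg_limit:
  assumes freq: "\<exists>\<^sub>F \<kappa> in at_left 1. \<forall>s\<in>portion a (profile_ivp n a (\<kappa> / (1 - \<kappa>))).
      0 \<le> eta n a (max_solution (profile_ivp n a (\<kappa> / (1 - \<kappa>)))) s"
    and t: "0 < t" "t < T"
  shows "0 \<le> fE a 1 t"
proof (rule ccontr)
  assume neg: "\<not> 0 \<le> fE a 1 t"
  interpret nonneg_trajectory n T a 1 "fr a 1" "fw a 1" "fq a 1" "fR a 1" "\<lambda>t. fS a 1 t / QQ (fq a 1 t)"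
    using c0_neg by (rule trajectory_piece)
  have sub: "{0..t} \<subseteq> {-b..b}" using t T_less box by auto
  have ev1: "\<forall>\<^sub>F \<kappa> in at_left 1. \<forall>u\<in>{0..t}. flow (st a \<kappa>) u \<in> interior B \<and> fq a \<kappa> u < 1"
  proof -
    obtain d where "d > 0" "\<forall>\<^sub>F \<kappa> in at_left 1. \<forall>t\<in>{0..T+d}. flow (st a \<kappa>) t \<in> interior B \<and> fq a \<kappa> t < 1"
      using nearby_curves by blast
    then show ?thesis using t by (auto elim!: eventually_mono)
  qed
  have "open {x :: real \<times> real \<times> real. 0 < snd (snd x)}"
    by (intro open_Collect_less continuous_intros)
  then have ev2: "\<forall>\<^sub>F \<kappa> in at_left 1. \<forall>u\<in>{0..t}. flow (st a \<kappa>) u \<in> {x. 0 < snd (snd x)}"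
    using q_pos t by (intro flow_stays[OF tendsto_start _ sub]) (auto simp: fq_def)
  have lim: "((\<lambda>\<kappa>. flow (st a \<kappa>) t) \<longlongrightarrow> flow (st a 1) t) (at_left 1)"
    using sub t by (intro tendsto_flow tendsto_start tendsto_const) auto
  have lr: "((\<lambda>\<kappa>. fr a \<kappa> t) \<longlongrightarrow> fr a 1 t) (at_left 1)"
    and lw: "((\<lambda>\<kappa>. fw a \<kappa> t) \<longlongrightarrow> fw a 1 t) (at_left 1)"
    and lq: "((\<lambda>\<kappa>. fq a \<kappa> t) \<longlongrightarrow> fq a 1 t) (at_left 1)"
    unfolding fr_def fw_def fq_def by (intro tendsto_fst tendsto_snd lim)+
  have ne: "fr a 1 t \<noteq> 0" using r_ne[of t] t by simp
  then have "isCont (coef n) (fr a 1 t)" using coef_deriv DERIV_isCont by blast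
  then have lc: "((\<lambda>\<kappa>. coef n (fr a \<kappa> t)) \<longlongrightarrow> coef n (fr a 1 t)) (at_left 1)"
    using lr by (rule isCont_tendsto_compose)
  have "((\<lambda>\<kappa>. fE a \<kappa> t) \<longlongrightarrow> fE a 1 t) (at_left 1)"
    unfolding fE_def fD_def DD_def QQ_def dcoef_def by (intro tendsto_intros lc lq lw lr) (use ne in auto)
  then have "\<forall>\<^sub>F \<kappa> in at_left 1. fE a \<kappa> t < 0" using neg by (intro order_tendstoD(2)) auto
  moreover have "\<forall>\<^sub>F \<kappa> in at_left 1. \<kappa> \<in> {0<..<1::real}" by (rule eventually_at_left_real) simp
  ultimately have "\<forall>\<^sub>F \<kappa> in at_left 1. \<not> (\<forall>s\<in>portion a (profile_ivp n a (\<kappa> / (1 - \<kappa>))).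
      0 \<le> eta n a (max_solution (profile_ivp n a (\<kappa> / (1 - \<kappa>)))) s)"
    using ev1 ev2
  proof eventually_elim
    case (elim \<kappa>)
    have inB: "flow (st a \<kappa>) u \<in> interior B \<and> fq a \<kappa> u < 1 \<and> 0 \<le> fq a \<kappa> u" if "u \<in> {0..t}" for u
      using elim(3,4) that by (auto simp: fq_def intro: less_imp_le)
    have t': "0 \<le> t" "t < b" "\<kappa> < 1" using t T_less elim(2) by auto
    have C: "fr a \<kappa> t \<in> portion a (profile_ivp n a (\<kappa> / (1 - \<kappa>)))"
      "fE a \<kappa> t = (1 - fq a \<kappa> t) ^ 4 * eta n a (max_solution (profile_ivp n a (\<kappa> / (1 - \<kappa>)))) (fr a \<kappa> t)"
      by (rule curve_in_portion[OF t' inB], assumption)+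
    show ?case
    proof
      assume "\<forall>s\<in>portion a (profile_ivp n a (\<kappa> / (1 - \<kappa>))).
        0 \<le> eta n a (max_solution (profile_ivp n a (\<kappa> / (1 - \<kappa>)))) s"
      then have "0 \<le> fE a \<kappa> t" unfolding C(2) using C(1) by (intro mult_nonneg_nonneg) auto
      with elim(1) show False by simp
    qed
  qed
  with freq show False by (simp add: frequently_def)
qed

end

section \<open>Boxes, slopes and uniqueness of vertical solutions\<close>

lemma profile_equation_domain:
  assumes "profile_equation n J g"
  shows "open J" "is_interval J" "0 \<notin> J"
  using assms unfolding profile_equation_def by blast+

lemma ex_box:
  assumes "(a::real) \<le> r" "0 \<notin> {a..r}"
  shows "\<exists>lo hi. lo < a \<and> r < hi \<and> 0 \<notin> {lo..hi}"
proof (cases "0 < a")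
  case True
  then show ?thesis using assms by (intro exI[of _ "a / 2"] exI[of _ "r + 1"]) auto
next
  case False
  then have "r < 0" using assms by auto
  then show ?thesis using assms by (intro exI[of _ "a - 1"] exI[of _ "r / 2"]) auto
qed

lemma tendsto_slope_quotient: "((\<lambda>C::real. C / (1 + C)) \<longlongrightarrow> 1) at_top"
proof -
  have "((\<lambda>C::real. 1 - inverse (1 + C)) \<longlongrightarrow> 1 - 0) at_top"
    by (intro tendsto_diff tendsto_const tendsto_inverse_0_at_top
        filterlim_tendsto_add_at_top[OF tendsto_const filterlim_ident])
  moreover have "\<forall>\<^sub>F C in at_top. 1 - inverse (1 + C) = C / (1 + C :: real)"
    using eventually_gt_at_top[of 0] by eventually_elim (simp add: field_simps)
  ultimately show ?thesis using Lim_transform_eventually by fastforce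
qed

lemma filterlim_slope_quotient: "filterlim (\<lambda>C::real. C / (1 + C)) (at_left 1) at_top"
  unfolding filterlim_at
proof
  show "\<forall>\<^sub>F C in at_top. C / (1 + C) \<in> {..<1} \<and> C / (1 + C) \<noteq> (1::real)"
    using eventually_gt_at_top[of 0] by eventually_elim simp
qed (rule tendsto_slope_quotient)

lemma slope_quotient_inverse: "0 < C \<Longrightarrow> (C / (1 + C)) / (1 - C / (1 + C)) = (C::real)"
  by (simp add: field_simps)

text \<open>The slope tends to infinity at \<open>a\<close>, so g increases near \<open>a\<close>
  from its limit 0. This provides an initial piece to which \<open>profile_piece\<close> applies
  without assuming that the solution is nonnegative.\<close>

lemma vertical_ivp_start:
  assumes v: "vertical_ivp n a J g"
  shows "\<exists>c\<in>J. a < c \<and> {a<..c} \<subseteq> J \<and> (\<forall>s\<in>{a<..c}. 0 \<le> g s \<and> 0 \<le> deriv g s)"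
proof -
  obtain e where e: "a < e" "J = {a<..<e}" using v by (auto simp: vertical_ivp_def)
  have pe: "profile_equation n J g" and g0: "(g \<longlongrightarrow> 0) (at_right a)" using v by (auto simp: vertical_ivp_def)
  have "\<forall>\<^sub>F s in at_right a. 0 \<le> deriv g s"
    using v unfolding vertical_ivp_def filterlim_at_top by blast
  then obtain c0 where c0: "a < c0" "\<And>s. a < s \<Longrightarrow> s < c0 \<Longrightarrow> 0 \<le> deriv g s"
    unfolding eventually_at_right_field by blast
  obtain c where c: "a < c" "c < min c0 e" using dense[of a "min c0 e"] c0 e by auto
  have der: "0 \<le> deriv g s" if "s \<in> {a<..c}" for s using that c by (intro c0(2)) auto
  have sub: "{a<..c} \<subseteq> J" using c e by auto
  have "0 \<le> g s" if s: "s \<in> {a<..c}" for s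
  proof (rule tendsto_upperbound[OF g0])
    show "\<forall>\<^sub>F x in at_right a. g x \<le> g s"
      unfolding eventually_at_right_field
    proof (intro exI[of _ s] conjI allI impI)
      fix x assume x: "a < x" "x < s"
      show "g x \<le> g s"
      proof (rule DERIV_nonneg_imp_nondecreasing[where f=g and a=x and b=s])
        fix y assume "x \<le> y" "y \<le> s"
        then have y: "y \<in> {a<..c}" using x s by auto
        then have "y \<in> J" using sub by blast
        show "\<exists>d. (g has_real_derivative d) (at y) \<and> 0 \<le> d"
          by (intro exI conjI, rule profile_equationD(1)[OF pe \<open>y \<in> J\<close>], rule der[OF y])
      qed (use x in simp)
    qed (use s in simp)
  qed simp
  with c sub der e show ?thesis by (intro bexI[of _ c]) auto
qed

lemma vertical_ivp_piece:
  assumes v: "vertical_ivp n a J g" and "a < r" "{a<..r} \<subseteq> J"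
    and nonneg: "\<And>s. s \<in> {a<..r} \<Longrightarrow> 0 \<le> g s \<and> 0 \<le> deriv g s"
    and box: "lo < a" "r < hi" "0 \<notin> {lo..hi}" "g r < m" "1 < m" "r - a + g r < b"
  shows "profile_piece n lo hi m b J g a r 1"
proof
  show "((\<lambda>s. deriv g s / (1 + deriv g s)) \<longlongrightarrow> 1) (at_right a)"
    using filterlim_compose[OF tendsto_slope_quotient] v by (auto simp: vertical_ivp_def)
  have "0 \<le> g r" using nonneg[of r] assms(2) by simp
  then show "0 < m" "0 \<le> b" using box assms(2) by auto
qed (use assms in \<open>auto simp: vertical_ivp_def\<close>)

text \<open>Near \<open>a\<close> both graphs trace the same flow line from (a, 0, 1). At a common
  time they therefore share position, height and slope, and from that point
  \<open>profile_equation_unique\<close> carries the equality to \<open>r\<close>.\<close>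

lemma vertical_ivp_unique:
  assumes "a \<noteq> 0" and v1: "vertical_ivp n a J1 g1" and v2: "vertical_ivp n a J2 g2"
    and r: "r \<in> J1" "r \<in> J2"
  shows "g1 r = g2 r"
proof -
  obtain c1 where c1: "c1 \<in> J1" "a < c1" "{a<..c1} \<subseteq> J1" "\<And>s. s \<in> {a<..c1} \<Longrightarrow> 0 \<le> g1 s \<and> 0 \<le> deriv g1 s"
    using vertical_ivp_start[OF v1] by blast
  obtain c2 where c2: "c2 \<in> J2" "a < c2" "{a<..c2} \<subseteq> J2" "\<And>s. s \<in> {a<..c2} \<Longrightarrow> 0 \<le> g2 s \<and> 0 \<le> deriv g2 s"
    using vertical_ivp_start[OF v2] by blast
  define c where "c = min c1 c2"
  have c: "a < c" "{a<..c} \<subseteq> J1" "{a<..c} \<subseteq> J2" using c1 c2 by (auto simp: c_def)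
  have pe: "profile_equation n J1 g1" "profile_equation n J2 g2" using v1 v2 by (auto simp: vertical_ivp_def)
  then have "0 \<notin> {a<..c}" using c profile_equation_domain(3) by blast
  then have "0 \<notin> {a..c}" using \<open>a \<noteq> 0\<close> by auto
  then obtain lo hi where box: "lo < a" "c < hi" "0 \<notin> {lo..hi}" using ex_box[of a c] c(1) by auto
  \<comment> \<open>One box large enough for both graphs, so that both interpretations refer to the
    same \<open>flow\<close>.\<close>
  define m where "m = max (g1 c) (g2 c) + 2"
  define b where "b = c - a + m"
  have g0: "0 \<le> g1 c" "0 \<le> g2 c" using c1(4)[of c] c2(4)[of c] c(1) by (auto simp: c_def)
  have m: "g1 c < m" "g2 c < m" "1 < m" "c - a + g1 c < b" "c - a + g2 c < b"
    using g0 by (auto simp: m_def b_def)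
  interpret P1: profile_piece n lo hi m b J1 g1 a c 1
    by (rule vertical_ivp_piece[OF v1 c(1,2) c1(4) box m(1,3,4)]) (auto simp: c_def)
  interpret P2: profile_piece n lo hi m b J2 g2 a c 1
    by (rule vertical_ivp_piece[OF v2 c(1,3) c2(4) box m(2,3,5)]) (auto simp: c_def)
  define t where "t = min P1.T P2.T"
  have t: "t \<in> {0<..P1.T}" "t \<in> {0<..P2.T}" using P1.T_pos P2.T_pos by (auto simp: t_def)
  obtain s where s: "s \<in> {a<..c}" "P1.flow (P1.st a 1) t = P1.\<Gamma> s" using P1.curve_at[OF t(1)] by blast
  obtain s' where s': "s' \<in> {a<..c}" "P1.flow (P1.st a 1) t = P2.\<Gamma> s'" using P2.curve_at[OF t(2)] by blast
  have "P1.\<Gamma> s = P2.\<Gamma> s'" using s(2) s'(2) by simp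
  then have eq: "s' = s" "g1 s = g2 s" "deriv g1 s / (1 + deriv g1 s) = deriv g2 s / (1 + deriv g2 s)"
    by (auto simp: P1.\<Gamma>_def P2.\<Gamma>_def P1.p_def P2.p_def)
  have "0 < 1 + deriv g1 s" "0 < 1 + deriv g2 s" using P1.nonneg[OF s(1)] P2.nonneg[OF s(1)] by auto
  with eq(3) have "deriv g1 s = deriv g2 s" by (simp add: field_simps)
  then show ?thesis
    using profile_equation_unique[OF pe, of s r] s(1) c r eq(2) by blast
qed

lemma max_solution_vertical:
  assumes "a \<noteq> 0" "vertical_ivp n a J g" "r \<in> J"
  shows "max_solution (vertical_ivp n a) r = g r"
    and "deriv (max_solution (vertical_ivp n a)) r = deriv g r"
    and "deriv (deriv (max_solution (vertical_ivp n a))) r = deriv (deriv g) r"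
proof -
  have J: "open J" using assms by (auto simp: vertical_ivp_def profile_equation_def)
  have 1: "max_solution (vertical_ivp n a) s = g s" if "s \<in> J" for s
    by (rule max_solution_eq[where P="vertical_ivp n a", OF _ assms(2) that]) (rule vertical_ivp_unique[OF assms(1)])
  have 2: "deriv (max_solution (vertical_ivp n a)) s = deriv g s" if "s \<in> J" for s
    using J that 1 by (rule deriv_eq_on_open)
  show "max_solution (vertical_ivp n a) r = g r" using 1 assms by simp
  show "deriv (max_solution (vertical_ivp n a)) r = deriv g r" using 2 assms by simp
  show "deriv (deriv (max_solution (vertical_ivp n a))) r = deriv (deriv g) r"
    using J assms(3) 2 by (rule deriv_eq_on_open)
qed

lemma portionD:
  assumes sol: "max_solution P s = g s" "deriv (max_solution P) s = deriv g s"
      "deriv (deriv (max_solution P)) s = deriv (deriv g) s"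
    and "r \<in> portion a P" "P J g" "s \<in> J" "a \<le> s" "s \<le> r"
  shows "s \<in> portion a P" "0 \<le> g s" "0 \<le> deriv g s" "eta n a (max_solution P) s = eta n a g s"
proof -
  have s: "s \<in> max_domain P" using assms(5,6) unfolding max_domain_def by blast
  have *: "0 \<le> max_solution P x \<and> 0 \<le> deriv (max_solution P) x" if "x \<in> max_domain P" "a \<le> x" "x \<le> r" for x
    using assms(4) that by (auto simp: portion_def)
  show "s \<in> portion a P"
    unfolding portion_def using s assms(7,8) * by auto
  show "0 \<le> g s" "0 \<le> deriv g s" using *[OF s assms(7,8)] sol by auto
  show "eta n a (max_solution P) s = eta n a g s" by (simp only: eta_def sol)
qed

section \<open>Positivity of the linearized function\<close>

lemma linearized_pos_profile:
  assumes "coef n a < 0" and C: "0 < C"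
    and eta: "\<And>s. s \<in> portion a (profile_ivp n a C) \<Longrightarrow> 0 \<le> eta n a (max_solution (profile_ivp n a C)) s"
    and r: "r \<in> portion a (profile_ivp n a C)"
  shows "0 < linearized n a C r"
proof -
  obtain J g where ivp: "profile_ivp n a C J g" and "r \<in> J"
    using r by (auto simp: portion_def max_domain_def)
  have ar: "a \<le> r" using r by (simp add: portion_def)
  have pe: "profile_equation n J g" and "a \<in> J" and ga: "g a = 0" "deriv g a = C"
    using ivp by (auto simp: profile_ivp_def)
  have sub: "{a..r} \<subseteq> J"
  proof
    fix x assume "x \<in> {a..r}"
    moreover have "is_interval J" using pe by (rule profile_equation_domain)
    ultimately show "x \<in> J" using mem_is_interval_1_I[of J a r x] \<open>a \<in> J\<close> \<open>r \<in> J\<close> by simp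
  qed
  then have "0 \<notin> {a..r}" using profile_equation_domain(3)[OF pe] by blast
  then obtain lo hi where bounds: "lo < a" "r < hi" "0 \<notin> {lo..hi}" using ex_box[OF ar] by blast
  have D: "s \<in> portion a (profile_ivp n a C)" "0 \<le> g s" "0 \<le> deriv g s"
    "eta n a (max_solution (profile_ivp n a C)) s = eta n a g s" if "s \<in> {a..r}" for s
  proof -
    have sJ: "s \<in> J" and s: "a \<le> s" "s \<le> r" using that sub by auto
    note p = portionD[where P="profile_ivp n a C" and g=g and s=s, OF max_solution_profile[OF ivp sJ] r ivp sJ s]
    show "s \<in> portion a (profile_ivp n a C)" "0 \<le> g s" "0 \<le> deriv g s"
      "eta n a (max_solution (profile_ivp n a C)) s = eta n a g s" by (rule p)+
  qed
  define \<kappa> where "\<kappa> = C / (1 + C)"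
  have slope: "0 < \<kappa>" "\<kappa> < 1" "\<kappa> / (1 - \<kappa>) = C"
    using C slope_quotient_inverse[OF C] by (auto simp: \<kappa>_def)
  define m where "m = g r + 2"
  define b where "b = r - a + m"
  have g0: "0 \<le> g r" using D(2)[of r] ar by simp
  show ?thesis
  \<comment> \<open>For a finite slope the portion can contain the starting point itself, where no
    piece of positive length is available. There the formula at time 0 gives h = -
    \<open>coef n a\<close> * C directly.\<close>
  proof (cases "a = r")
    case True
    interpret profile_box n lo hi m b
      by unfold_locales (use bounds ar g0 in \<open>auto simp: m_def b_def\<close>)
    have "linearized n a (\<kappa> / (1 - \<kappa>)) (fr a \<kappa> 0) = fS a \<kappa> 0 / QQ (fq a \<kappa> 0) -
        fR a \<kappa> 0 * DD n (fr a \<kappa> 0) (fw a \<kappa> 0) (fq a \<kappa> 0) / (1 - fq a \<kappa> 0)"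
    proof (rule linearized_formula)
      have "(a, 0, \<kappa>) \<in> interior B"
        unfolding interior_B using bounds True slope g0 by (auto simp: m_def)
      then show "flow (st a \<kappa>) t \<in> interior B \<and> fq a \<kappa> t < 1" if "t \<in> {0..0}" for t
        using that slope init_f(3)[of a \<kappa>] by (simp add: st_def)
    qed (use slope g0 True in \<open>simp_all add: m_def b_def\<close>)
    also have "\<dots> = - (coef n a * \<kappa>) / (1 - \<kappa>)" by (simp add: init_f DD_def)
    also have "\<dots> > 0"
      using mult_neg_pos[OF assms(1) slope(1)] slope(2) by (intro divide_pos_pos) auto
    finally show ?thesis by (simp add: slope init_f True)
  next
    case False
    then have "a < r" using ar by simp
    have cont: "isCont g a" "isCont (deriv g) a"
      by (rule DERIV_isCont[OF profile_equationD(1)[OF pe \<open>a \<in> J\<close>]],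
          rule DERIV_isCont[OF profile_equationD(2)[OF pe \<open>a \<in> J\<close>]])
    interpret profile_piece n lo hi m b J g a r \<kappa>
    proof
      have "((\<lambda>s. deriv g s / (1 + deriv g s)) \<longlongrightarrow> deriv g a / (1 + deriv g a)) (at_right a)"
        using cont C ga by (intro tendsto_intros) (auto simp: isCont_def intro: tendsto_within_subset)
      then show "((\<lambda>s. deriv g s / (1 + deriv g s)) \<longlongrightarrow> \<kappa>) (at_right a)" by (simp add: ga \<kappa>_def)
      show "(g \<longlongrightarrow> 0) (at_right a)"
        using cont(1) ga by (auto simp: isCont_def intro: tendsto_within_subset)
      show "0 \<le> g s \<and> 0 \<le> deriv g s" if "s \<in> {a<..r}" for s using D(2,3)[of s] that by simp
      show "{a<..r} \<subseteq> J" using sub by auto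
    qed (use bounds pe \<open>a < r\<close> slope g0 in \<open>simp_all add: m_def b_def\<close>)
    have "0 < fS a \<kappa> T / QQ (fq a \<kappa> T) - fR a \<kappa> T * fD a \<kappa> T / (1 - fq a \<kappa> T)"
    proof (rule linearized_value_pos[OF trajectory_piece[OF assms(1)]])
      show "fq a \<kappa> T < 1" using curve_lt[of T] T_pos by simp
      show "0 \<le> fE a \<kappa> t" if "0 < t" "t < T" for t
      proof (rule fE_eta)
        show "0 \<le> eta n a g s" if "s \<in> {a<..r}" for s
          using eta[OF D(1)[of s]] D(4)[of s] that by simp
      qed (use that in auto)
    qed
    also have "\<dots> = linearized n a (\<kappa> / (1 - \<kappa>)) (fr a \<kappa> T)"
    proof (subst linearized_formula)
      show "flow (st a \<kappa>) t \<in> interior B \<and> fq a \<kappa> t < 1" if "t \<in> {0..T}" for t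
        using curve_props[OF that] curve_lt[of t] that slope init_f(3)[of a \<kappa>] by (cases "t = 0") auto
    qed (use T_pos T_less slope in \<open>auto simp: fD_def\<close>)
    finally show ?thesis by (simp add: slope curve_end)
  qed
qed

text \<open>The disjunction covers the hypothesis on the vertical solution and the one on
  arbitrarily large slopes. Both are reduced to nonnegativity of \<open>fE\<close> on the vertical
  curve. The limit of the linearized functions is computed explicitly, so \<open>L\<close> must
  equal it.\<close>

lemma vertical_linearized_pos:
  assumes n: "1 \<le> n" and "a \<noteq> 0" and r: "r \<in> portion a (vertical_ivp n a)"
    and lin: "vertical_linearized n a r L"
    and cases: "(\<forall>s\<in>portion a (vertical_ivp n a). 0 \<le> eta n a (max_solution (vertical_ivp n a)) s) \<or>
      (\<forall>M. \<exists>C>M. \<forall>s\<in>portion a (profile_ivp n a C). 0 \<le> eta n a (max_solution (profile_ivp n a C)) s)"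
  shows "0 < L"
proof -
  obtain J g where ivp: "vertical_ivp n a J g" and "r \<in> J"
    using r by (auto simp: portion_def max_domain_def)
  then obtain e where e: "J = {a<..<e}" by (auto simp: vertical_ivp_def)
  have ar: "a < r" and sub: "{a<..r} \<subseteq> J" using \<open>r \<in> J\<close> e by auto
  then have "0 \<notin> {a<..r}" using ivp profile_equation_domain(3)[of n J g] unfolding vertical_ivp_def by blast
  then have "0 \<notin> {a..r}" using \<open>a \<noteq> 0\<close> by auto
  then obtain lo hi where bounds: "lo < a" "r < hi" "0 \<notin> {lo..hi}" using ex_box[of a r] ar by auto
  have D: "s \<in> portion a (vertical_ivp n a)" "0 \<le> g s" "0 \<le> deriv g s"
    "eta n a (max_solution (vertical_ivp n a)) s = eta n a g s" if "s \<in> {a<..r}" for s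
  proof -
    have sJ: "s \<in> J" and s: "a \<le> s" "s \<le> r" using that sub by auto
    note p = portionD[where P="vertical_ivp n a" and g=g and s=s, OF max_solution_vertical[OF \<open>a \<noteq> 0\<close> ivp sJ] r ivp sJ s]
    show "s \<in> portion a (vertical_ivp n a)" "0 \<le> g s" "0 \<le> deriv g s"
      "eta n a (max_solution (vertical_ivp n a)) s = eta n a g s" by (rule p)+
  qed
  define m where "m = g r + 2"
  define b where "b = r - a + m"
  have g0: "0 \<le> g r" using D(2)[of r] ar by simp
  have "profile_piece n lo hi m b J g a r 1"
    by (rule vertical_ivp_piece[OF ivp ar sub _ bounds]) (use D g0 in \<open>auto simp: m_def b_def\<close>)
  then interpret vertical_piece n lo hi m b J g a r
    using n by (simp add: vertical_piece_def vertical_piece_axioms_def)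
  have fE: "0 \<le> fE a 1 t" if t: "0 < t" "t < T" for t
    using cases
  proof
    assume eta: "\<forall>s\<in>portion a (vertical_ivp n a). 0 \<le> eta n a (max_solution (vertical_ivp n a)) s"
    show ?thesis
    proof (rule fE_eta)
      show "0 \<le> eta n a g s" if "s \<in> {a<..r}" for s
        using bspec[OF eta D(1)[OF that]] unfolding D(4)[OF that] .
    qed (use t in auto)
  next
    let ?E = "\<lambda>C. \<forall>s\<in>portion a (profile_ivp n a C). 0 \<le> eta n a (max_solution (profile_ivp n a C)) s"
    assume large: "\<forall>M. \<exists>C>M. ?E C"
    \<comment> \<open>Arbitrarily large \<open>C\<close> correspond to \<kappa> = C / (1 + C)
      arbitrarily close to 1 from below.\<close>
    have "\<exists>\<^sub>F \<kappa> in at_left 1. ?E (\<kappa> / (1 - \<kappa>))"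
      unfolding frequently_def
    proof
      assume "\<forall>\<^sub>F \<kappa> in at_left 1. \<not> ?E (\<kappa> / (1 - \<kappa>))"
      then have "\<forall>\<^sub>F C in at_top. \<not> ?E ((C / (1 + C)) / (1 - C / (1 + C)))"
        by (rule eventually_compose_filterlim[OF _ filterlim_slope_quotient])
      then have "\<forall>\<^sub>F C in at_top. \<not> ?E C"
        using eventually_gt_at_top[of 0] by eventually_elim (simp only: slope_quotient_inverse simp_thms)
      then obtain M where "\<And>C. M \<le> C \<Longrightarrow> \<not> ?E C" unfolding eventually_at_top_linorder by blast
      then show False using large less_imp_le by blast
    qed
    then show ?thesis using t by (rule fE_nonneg_limit)
  qed
  have "((\<lambda>C. linearized n a ((C / (1 + C)) / (1 - C / (1 + C))) r) \<longlongrightarrow>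
      fS a 1 T / QQ (fq a 1 T) - fR a 1 T * fD a 1 T / (1 - fq a 1 T)) at_top"
    by (rule filterlim_compose[OF tendsto_linearized filterlim_slope_quotient])
  moreover have "\<forall>\<^sub>F C in at_top. linearized n a ((C / (1 + C)) / (1 - C / (1 + C))) r = linearized n a C r"
    using eventually_gt_at_top[of 0] by eventually_elim (simp only: slope_quotient_inverse)
  ultimately have "((\<lambda>C. linearized n a C r) \<longlongrightarrow>
      fS a 1 T / QQ (fq a 1 T) - fR a 1 T * fD a 1 T / (1 - fq a 1 T)) at_top"
    by (rule Lim_transform_eventually)
  then have "L = fS a 1 T / QQ (fq a 1 T) - fR a 1 T * fD a 1 T / (1 - fq a 1 T)"
    using lin unfolding vertical_linearized_def by (intro tendsto_unique[OF trivial_limit_at_top_linorder])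
  also have "0 < \<dots>"
  proof (rule linearized_value_pos[OF trajectory_piece[OF c0_neg]])
    show "fq a 1 T < 1" using curve_lt[of T] T_pos by simp
  qed (rule fE)
  finally show ?thesis .
qed

text \<open>Since \<open>coef n r\<close> = (r^2 - 2 (n - 1)) / (2 r), the two ranges are those
  where numerator and denominator have opposite signs.\<close>

lemma coef_neg:
  assumes "1 \<le> n" "r < - sqrt (2 * (real n - 1)) \<or> 0 < r \<and> r < sqrt (2 * (real n - 1))"
  shows "coef n r < 0"
proof -
  define k where "k = 2 * (real n - 1)"
  have k: "0 \<le> k" "sqrt k \<ge> 0" using assms(1) by (auto simp: k_def)
  show ?thesis
  proof (cases "0 < r")
    case True
    then have "r < sqrt k" using assms(2) k unfolding k_def[symmetric] by auto
    then have "r\<^sup>2 < k" using True k by (metis less_imp_le power_strict_mono real_sqrt_pow2 zero_less_numeral)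
    then show ?thesis using True by (simp add: coef_def k_def field_simps power2_eq_square)
  next
    case False
    then have "r < - sqrt k" using assms(2) unfolding k_def[symmetric] by auto
    then have "sqrt k < - r" "r < 0" using k(2) by linarith+
    then have "k < (- r)\<^sup>2" using k by (metis power_strict_mono real_sqrt_pow2 zero_less_numeral)
    then show ?thesis using \<open>r < 0\<close> by (simp add: coef_def k_def field_simps power2_eq_square)
  qed
qed

theorem lemma10:
  fixes n :: nat and r0 :: real
  assumes "n \<ge> 2" and "r0 \<noteq> 0"
  shows "(r0 < - sqrt (2 * (real n - 1)) \<or> 0 < r0 \<and> r0 < sqrt (2 * (real n - 1)) \<longrightarrow>
           (\<forall>C>0.
             (\<forall>r\<in>portion r0 (profile_ivp n r0 C).
                eta n r0 (max_solution (profile_ivp n r0 C)) r \<ge> 0) \<longrightarrow>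
             (\<forall>r\<in>portion r0 (profile_ivp n r0 C). linearized n r0 C r > 0)))
       \<and> ((\<forall>r\<in>portion r0 (vertical_ivp n r0).
              eta n r0 (max_solution (vertical_ivp n r0)) r > 0) \<longrightarrow>
          (\<forall>r\<in>portion r0 (vertical_ivp n r0). \<forall>L. vertical_linearized n r0 r L \<longrightarrow> L > 0))
       \<and> ((\<forall>M. \<exists>C>M. C > 0 \<and>
             (\<forall>r\<in>portion r0 (profile_ivp n r0 C).
                eta n r0 (max_solution (profile_ivp n r0 C)) r \<ge> 0)) \<longrightarrow>
          (\<forall>r\<in>portion r0 (vertical_ivp n r0). \<forall>L. vertical_linearized n r0 r L \<longrightarrow> L > 0))"
proof (intro conjI impI allI ballI)
  have n: "1 \<le> n" using assms by simp
  {
    fix C r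
    assume "r0 < - sqrt (2 * (real n - 1)) \<or> 0 < r0 \<and> r0 < sqrt (2 * (real n - 1))" "0 < C"
      and eta: "\<forall>r\<in>portion r0 (profile_ivp n r0 C). 0 \<le> eta n r0 (max_solution (profile_ivp n r0 C)) r"
      and "r \<in> portion r0 (profile_ivp n r0 C)"
    then show "0 < linearized n r0 C r"
      using linearized_pos_profile[OF coef_neg[OF n]] by blast
  next
    fix r L
    assume "\<forall>r\<in>portion r0 (vertical_ivp n r0). 0 < eta n r0 (max_solution (vertical_ivp n r0)) r"
      and r: "r \<in> portion r0 (vertical_ivp n r0)" "vertical_linearized n r0 r L"
    then show "0 < L"
      by (intro vertical_linearized_pos[OF n assms(2) r]) (auto intro: less_imp_le)
  next
    fix r L
    assume large: "\<forall>M. \<exists>C>M. 0 < C \<and> (\<forall>r\<in>portion r0 (profile_ivp n r0 C).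
        0 \<le> eta n r0 (max_solution (profile_ivp n r0 C)) r)"
      and r: "r \<in> portion r0 (vertical_ivp n r0)" "vertical_linearized n r0 r L"
    show "0 < L"
      by (rule vertical_linearized_pos[OF n assms(2) r], rule disjI2) (use large in blast)
  }
qed

end
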